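(* Let $H(T_B)$ be the space of holomorphic functions in $T_B$, let $1\le p<\infty$ and $\alpha>-1$. For any $r>0$, we have $$\mathcal B=H(T_B)\cap BMO^p_r\qquad\text{and}\qquad \mathcal B_0=H(T_B)\cap VMO^p_r .$$ Moreover, $\|f\|_{\mathcal B}$ and $\|f\|_{BMO^p_r}$ are equivalent.
   Context: Let $n$ be a positive integer. For $z=x+iy\in\mathbb C^n$ write $z'=(z_1,\dots,z_{n-1})$, $y'=(y_1,\dots,y_{n-1})$. The tubular domain is $T_B=\{z=x+iy\in\mathbb C^n:|y'|^2<y_n\}$, and $\rho(z)=y_n-|y'|^2$. For $\alpha>-1$, $dV_\alpha(z)=\rho(z)^\alpha dV(z)$, with $dV$ Lebesgue measure on $\mathbb C^n$. For $1\le p<\infty$, $L^p_\alpha(T_B)$ is the space of Lebesgue measurable functions $f$ on $T_B$ with $\int_{T_B}|f|^p\,dV_\alpha<\infty$. Bergman metric: $\mathbf B(z)=(b_{ij}(z))_{1\le i,j\le n}$ with $b_{ij}(z)=\frac{1}{n+1+\alpha}\frac{\partial^2}{\partial\bar z_i\partial z_j}\ln K_\alpha(z,z)$, where $K_\alpha(z,z)=\frac{\Gamma(n+1+\alpha)}{2^{n+1}\pi^n\Gamma(\alpha+1)}\rho(z)^{-(n+1+\alpha)}$ is the weighted Bergman kernel on the diagonal. For a $C^1$ curve $\gamma:[0,1]\to T_B$, $l(\gamma)=\int_0^1\langle\mathbf B(\gamma(t))\gamma'(t),\gamma'(t)\rangle^{1/2}dt$; $\beta(z,w)=\inf\{l(\gamma):\gamma(0)=z,\gamma(1)=w\}$;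 $D(z,r)=\{w\in T_B:\beta(z,w)<r\}$; $|D(z,r)|=V_\alpha(D(z,r))$. For $f\in L^p_\alpha(T_B)$ let $\widehat f_r(z)=\frac1{|D(z,r)|}\int_{D(z,r)}f\,dV_\alpha$ and $$MO_r(f)(z)=\Big(\frac1{|D(z,r)|}\int_{D(z,r)}|f(w)-\widehat f_r(z)|^p\,dV_\alpha(w)\Big)^{1/p}.$$ $BMO^p_r$ is the space of those functions $f\in L^p_\alpha(T_B)$ with $\|f\|_{BMO^p_r}=\sup_{z\in T_B}MO_r(f)(z)<\infty$, and $VMO^p_r$ is the space of those $f\in L^p_\alpha(T_B)$ with $MO_r(f)\in C_0(T_B)$. Here $C_0(T_B)$ is the space of complex-valued continuous functions $g$ on $T_B$ with $g(z)\to0$ as $z\to\partial\widehat{T_B}$, where $\widehat{T_B}$ is the one-point compactification of $T_B\cup\{\rho=0\}$ and $\partial\widehat{T_B}=\{\rho=0\}\cup\{\infty\}$; thus $z\to\partial\widehat{T_B}$ means $\rho(z)\to0$ or $|z|\to\infty$. Invariant gradient: for $f\in H(T_B)$, $$|\widetilde\nabla f(z)|^2=4\rho(z)\Big(2\rho(z)\Big|\frac{\partial f}{\partial z_n}(z)\Big|^2+\sum_{j=1}^{n-1}\Big|\frac{\partial f}{\partial z_j}(z)+2y_j\frac{\partial f}{\partial z_n}(z)\Big|^2\Big).$$ The Bloch space is $\mathcal B=\{f\in H(T_B):\|f\|_{\mathcal B}:=\sup_{z\in T_B}|\widetilde\nabla f(z)|<\infty\}$ ($\|\cdot\|_{\mathcal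 B}$ is a seminorm), and the little Bloch space is $\mathcal B_0=\{f\in\mathcal B:|\widetilde\nabla f(z)|\to0\text{ as }z\to\partial\widehat{T_B}\}$. "Equivalent" means that there is a constant $C\ge1$, independent of $f$, with $C^{-1}\|f\|_{\mathcal B}\le\|f\|_{BMO^p_r}\le C\|f\|_{\mathcal B}$ for all $f$ in the space $\mathcal B=H(T_B)\cap BMO^p_r$.
   Formalization: BMO and VMO are taken inside the functions p-integrable for dV_α on compact subsets of T_B instead of the global L^p_α(T_B); globally the claim fails, since f=1 lies in B and B_0 but V_α(T_B) is infinite. *)

theory Defs
  imports "HOL-Analysis.Analysis"
begin

text \<open>
  Points of $C^n$ are of type \<open>complex^'n\<close> with \<open>'n\<close> of classes finite and linorder, so
  every n \<ge> 1 occurs, n = 1 included (for instance via the numeral types). Functions on the tubular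
  domain are total functions of which only the restriction to \<open>TB\<close> is ever used.
\<close>

section \<open>The tubular domain\<close>

definition lst :: "'n::{finite,linorder}" where
  "lst = Max UNIV"

definition rho :: "complex^'n::{finite,linorder} \<Rightarrow> real" where
  "rho z = Im (z $ lst) - (\<Sum>j\<in>UNIV - {lst}. (Im (z $ j))\<^sup>2)"

definition TB :: "(complex^'n::{finite,linorder}) set" where
  "TB = {z. (\<Sum>j\<in>UNIV - {lst}. (Im (z $ j))\<^sup>2) < Im (z $ lst)}"

definition vol :: "real \<Rightarrow> (complex^'n::{finite,linorder}) measure" where
  "vol \<alpha> = density (lebesgue_on TB) (\<lambda>z. ennreal (rho z powr \<alpha>))"

text \<open>
  The approach to the boundary of the one-point compactification, from inside \<open>TB\<close>: \<open>rho z\<close> tends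
  to 0 (through positive values, which forces \<open>z \<in> TB\<close>) or \<open>norm z\<close> tends to infinity.
\<close>

definition to_boundary :: "(complex^'n::{finite,linorder}) filter" where
  "to_boundary = sup (filtercomap rho (at_right 0)) (inf at_infinity (principal TB))"

definition C0 :: "(complex^'n::{finite,linorder} \<Rightarrow> complex) set" where
  "C0 = {g. continuous_on TB g \<and> (g \<longlongrightarrow> 0) to_boundary}"


section \<open>Complex derivatives and holomorphic functions\<close>

definition dir_deriv ::
    "(complex^'n::{finite,linorder} \<Rightarrow> complex) \<Rightarrow>
     complex^'n::{finite,linorder} \<Rightarrow> complex^'n::{finite,linorder} \<Rightarrow>
     complex" where
  "dir_deriv f v z = vector_derivative (\<lambda>t::real. f (z + t *\<^sub>R v)) (at 0)"

definition dz ::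
    "'n::{finite,linorder} \<Rightarrow>
     (complex^'n::{finite,linorder} \<Rightarrow> complex) \<Rightarrow>
     complex^'n::{finite,linorder} \<Rightarrow> complex" where
  "dz j f z = (dir_deriv f (axis j 1) z - \<i> * dir_deriv f (axis j \<i>) z) / 2"

definition dzbar ::
    "'n::{finite,linorder} \<Rightarrow>
     (complex^'n::{finite,linorder} \<Rightarrow> complex) \<Rightarrow>
     complex^'n::{finite,linorder} \<Rightarrow> complex" where
  "dzbar j f z = (dir_deriv f (axis j 1) z + \<i> * dir_deriv f (axis j \<i>) z) / 2"

text \<open>Complex differentiability at every point: a real derivative that is complex linear.\<close>

definition holo :: "(complex^'n::{finite,linorder} \<Rightarrow> complex) set" where
  "holo = {f. \<forall>z\<in>TB. \<exists>f'. (f has_derivative f') (at z) \<and> (\<forall>c v. f' (c *s v) = c * f' v)}"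


section \<open>The Bergman metric\<close>

definition bergman_kernel :: "real \<Rightarrow> complex^'n::{finite,linorder} \<Rightarrow> real" where
  "bergman_kernel \<alpha> z =
     Gamma (real CARD('n) + 1 + \<alpha>) / (2 ^ (CARD('n) + 1) * pi ^ CARD('n) * Gamma (\<alpha> + 1))
     * rho z powr (- (real CARD('n) + 1 + \<alpha>))"

definition bergman_matrix ::
    "real \<Rightarrow> complex^'n::{finite,linorder} \<Rightarrow>
     complex^'n::{finite,linorder}^'n::{finite,linorder}" where
  "bergman_matrix \<alpha> z = (\<chi> i j.
     dzbar i (dz j (\<lambda>w. complex_of_real (ln (bergman_kernel \<alpha> w)))) z
       / complex_of_real (real CARD('n) + 1 + \<alpha>))"

definition herm :: "complex^'n::{finite,linorder} \<Rightarrow> complex^'n::{finite,linorder} \<Rightarrow> complex" where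
  "herm u v = (\<Sum>i\<in>UNIV. u $ i * cnj (v $ i))"

text \<open>\<open>bergman_matrix \<alpha> z\<close> is Hermitian and positive on \<open>TB\<close>, so the form below is real
  and taking its real part loses nothing.\<close>

definition curve_length :: "real \<Rightarrow> (real \<Rightarrow> complex^'n::{finite,linorder}) \<Rightarrow> real" where
  "curve_length \<alpha> \<gamma> = integral {0..1} (\<lambda>t.
     sqrt (Re (herm (bergman_matrix \<alpha> (\<gamma> t) *v vector_derivative \<gamma> (at t))
       (vector_derivative \<gamma> (at t)))))"

text \<open>
  \<open>C1_differentiable_on {0..1}\<close> asks for two-sided derivatives at 0 and 1. This is no restriction:
  a continuously differentiable map on the closed interval extends to the line, and only its values
  on the interval enter below.
\<close>

definition bergman_dist ::
    "real \<Rightarrow> complex^'n::{finite,linorder} \<Rightarrow>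
     complex^'n::{finite,linorder} \<Rightarrow> real" where
  "bergman_dist \<alpha> z w = Inf {curve_length \<alpha> \<gamma> | \<gamma>.
     \<gamma> C1_differentiable_on {0..1} \<and> \<gamma> ` {0..1} \<subseteq> TB \<and> \<gamma> 0 = z \<and> \<gamma> 1 = w}"

definition bergman_ball ::
    "real \<Rightarrow> complex^'n::{finite,linorder} \<Rightarrow> real \<Rightarrow>
     (complex^'n::{finite,linorder}) set" where
  "bergman_ball \<alpha> z r = {w \<in> TB. bergman_dist \<alpha> z w < r}"


section \<open>Mean oscillation\<close>

text \<open>
  The ambient space of \<open>BMO\<close> and \<open>VMO\<close> is the local Lebesgue space: p-th power integrability with
  respect to \<open>vol \<alpha>\<close> on the compact subsets of \<open>TB\<close>, which is what \<open>MO\<close> needs in order to be defined.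
  Integrability over all of \<open>TB\<close> cannot be asked for: \<open>vol \<alpha>\<close> has infinite total mass, so the nonzero
  constants, which lie in both Bloch spaces, are not globally integrable.
\<close>

definition Lp_loc :: "real \<Rightarrow> real \<Rightarrow> (complex^'n::{finite,linorder} \<Rightarrow> complex) set" where
  "Lp_loc p \<alpha> = {f. f \<in> borel_measurable (lebesgue_on TB) \<and>
     (\<forall>S. compact S \<and> S \<subseteq> TB \<longrightarrow> (\<integral>\<^sup>+ z\<in>S. ennreal (norm (f z) powr p) \<partial>vol \<alpha>) < \<infinity>)}"

definition avg ::
    "real \<Rightarrow> real \<Rightarrow>
     (complex^'n::{finite,linorder} \<Rightarrow> complex) \<Rightarrow>
     complex^'n::{finite,linorder} \<Rightarrow> complex" where
  "avg \<alpha> r f z = (LINT w:bergman_ball \<alpha> z r|vol \<alpha>. f w)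
     / complex_of_real (measure (vol \<alpha>) (bergman_ball \<alpha> z r))"

definition MO ::
    "real \<Rightarrow> real \<Rightarrow> real \<Rightarrow>
     (complex^'n::{finite,linorder} \<Rightarrow> complex) \<Rightarrow>
     complex^'n::{finite,linorder} \<Rightarrow> real" where
  "MO p \<alpha> r f z = (
     (LINT w:bergman_ball \<alpha> z r|vol \<alpha>. norm (f w - avg \<alpha> r f z) powr p)
       / measure (vol \<alpha>) (bergman_ball \<alpha> z r)) powr (1 / p)"

definition BMO :: "real \<Rightarrow> real \<Rightarrow> real \<Rightarrow> (complex^'n::{finite,linorder} \<Rightarrow> complex) set" where
  "BMO p \<alpha> r = {f \<in> Lp_loc p \<alpha>. bdd_above (MO p \<alpha> r f ` TB)}"

definition norm_BMO ::
    "real \<Rightarrow> real \<Rightarrow> real \<Rightarrow> (complex^'n::{finite,linorder} \<Rightarrow> complex) \<Rightarrow> real" where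
  "norm_BMO p \<alpha> r f = (SUP z\<in>TB. MO p \<alpha> r f z)"

definition VMO :: "real \<Rightarrow> real \<Rightarrow> real \<Rightarrow> (complex^'n::{finite,linorder} \<Rightarrow> complex) set" where
  "VMO p \<alpha> r = {f \<in> Lp_loc p \<alpha>. (\<lambda>z. complex_of_real (MO p \<alpha> r f z)) \<in> C0}"


section \<open>The Bloch spaces\<close>

definition inv_grad ::
    "(complex^'n::{finite,linorder} \<Rightarrow> complex) \<Rightarrow>
     complex^'n::{finite,linorder} \<Rightarrow> real" where
  "inv_grad f z = sqrt (4 * rho z * (2 * rho z * (norm (dz lst f z))\<^sup>2
     + (\<Sum>j\<in>UNIV - {lst}. (norm (dz j f z + 2 * complex_of_real (Im (z $ j)) * dz lst f z))\<^sup>2)))"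

definition Bloch :: "(complex^'n::{finite,linorder} \<Rightarrow> complex) set" where
  "Bloch = {f \<in> holo. bdd_above (inv_grad f ` TB)}"

definition norm_Bloch :: "(complex^'n::{finite,linorder} \<Rightarrow> complex) \<Rightarrow> real" where
  "norm_Bloch f = (SUP z\<in>TB. inv_grad f z)"

definition little_Bloch :: "(complex^'n::{finite,linorder} \<Rightarrow> complex) set" where
  "little_Bloch = {f \<in> Bloch. (inv_grad f \<longlongrightarrow> 0) to_boundary}"

end

theory Submission
  imports Defs "HOL-Complex_Analysis.Cauchy_Integral_Formula"
begin

text \<open>
  The affine maps \<open>TB_aut z\<close> act simply transitively on the domain, with \<open>TB_aut z base_point = z\<close>
  for the base point \<open>(0, \<dots>, 0, \<i>)\<close>. They multiply \<open>rho\<close> and Lebesgue measure by constants and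
  preserve the Bergman metric and the invariant gradient, so mean oscillation and invariant gradient
  of \<open>f\<close> at \<open>z\<close> are those of \<open>f \<circ> TB_aut z\<close> at the base point. There, the Bergman ball is open and
  relatively compact: Cauchy's formula on circles, averaged over a small Euclidean ball, bounds the
  gradient by the oscillation, and integrating the gradient over a compact convex set containing the
  ball bounds the oscillation by the gradient. For fixed \<open>u\<close> the point \<open>TB_aut z u\<close> tends to the
  boundary with \<open>z\<close>, uniformly for \<open>u\<close> in a compact set, which gives the little-o version.
\<close>

section \<open>Lebesgue measure under affine bijections\<close>

text \<open>Sending \<open>z'\<close> to z'/sqrt 2 and z_n to z_n + (i/2) (z_1^2 + ... + z_{n-1}^2)
  carries the domain onto the Siegel upper half-space. The nonisotropic dilations and Heisenberg
  translations of that space become complex affine in the tube coordinates; this is the group used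
  here. Affinity makes the change of variables a matter of uniqueness of translation-invariant
  measures. The Bergman distance has no closed form at hand. It enters only through curves shorter
  than \<open>r\<close>, and the constants at the base point come from compactness. The two
  comparisons are not symmetric. The gradient at \<open>z\<close> is bounded by the oscillation at
  the same \<open>z\<close>, because Cauchy's formula for a derivative tolerates the subtraction of
  any constant, in particular of the average. The oscillation at \<open>z\<close> involves the
  gradient on a whole compact image under \<open>TB_aut z\<close>, and this is where uniformity at
  the boundary is needed.\<close>

lemma emeasure_lborel_open_pos:
  fixes S :: "'a::euclidean_space set"
  assumes "open S" "x \<in> S"
  shows "emeasure lborel S > 0"
proof -
  obtain e where e: "e > 0" "ball x e \<subseteq> S"
    using assms openE by blast
  have "0 < emeasure lborel (ball x e)"
    using content_ball_pos[OF e(1), of x] emeasure_lborel_ball_finite[of x e]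
    by (simp add: measure_def enn2real_positive_iff)
  also have "\<dots> \<le> emeasure lborel S"
    using e assms by (intro emeasure_mono) auto
  finally show ?thesis .
qed

text \<open>The image measure \<open>\<mu>\<close> is translation invariant. Evaluating the double integral of
  \<open>indicator U y * indicator A (x + y)\<close> by translating \<open>x\<close> or \<open>y\<close> shows that it is a multiple of
  \<open>lborel\<close>, and no determinant is needed.\<close>

lemma distr_lborel_affine:
  fixes T T' :: "'a::euclidean_space \<Rightarrow> 'a"
  assumes T: "\<And>x y. T (x + y) = T x + T y - T 0"
    and cont: "continuous_on UNIV T" "continuous_on UNIV T'"
    and inv: "\<And>x. T (T' x) = x" "\<And>x. T' (T x) = x"
  obtains c :: real where "c > 0" "distr lborel borel T = density lborel (\<lambda>_. ennreal c)"
proof -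
  have mT [measurable]: "T \<in> borel_measurable borel" and mT' [measurable]: "T' \<in> borel_measurable borel"
    using cont by (auto intro: borel_measurable_continuous_onI)
  define \<mu> where "\<mu> = distr lborel borel T"
  have sets_mu [measurable_cong, simp]: "sets \<mu> = sets borel" by (simp add: \<mu>_def)
  have space_mu [simp]: "space \<mu> = UNIV" by (simp add: \<mu>_def)
  have shift: "(\<integral>\<^sup>+x. h (x + a) \<partial>\<mu>) = (\<integral>\<^sup>+x. h x \<partial>\<mu>)"
    if [measurable]: "h \<in> borel_measurable borel" for h :: "'a \<Rightarrow> ennreal" and a
  proof -
    \<comment> \<open>Chosen so that \<open>T b - T 0 = a\<close>: translating the source by
      \<open>b\<close> translates the image by \<open>a\<close>.\<close>
    define b where "b = T' (T 0 + a)"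
    have eq: "T x + a = T (b + x)" for x
      using T[of b x] by (simp add: b_def inv)
    have "(\<integral>\<^sup>+x. h (x + a) \<partial>\<mu>) = (\<integral>\<^sup>+x. h (T (b + x)) \<partial>lborel)"
      unfolding \<mu>_def by (subst nn_integral_distr) (auto simp: eq)
    also have "\<dots> = (\<integral>\<^sup>+x. h (T x) \<partial>distr lborel borel ((+) b))"
      by (subst nn_integral_distr) auto
    also have "\<dots> = (\<integral>\<^sup>+x. h (T x) \<partial>lborel)"
      by (simp add: lborel_distr_plus)
    also have "\<dots> = (\<integral>\<^sup>+x. h x \<partial>\<mu>)"
      unfolding \<mu>_def by (subst nn_integral_distr) auto
    finally show ?thesis .
  qed
  have lshift: "(\<integral>\<^sup>+x. h (a + x) \<partial>lborel) = (\<integral>\<^sup>+x. h x \<partial>lborel)"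
    if [measurable]: "h \<in> borel_measurable borel" for h :: "'a \<Rightarrow> ennreal" and a
  proof -
    have "(\<integral>\<^sup>+x. h (a + x) \<partial>lborel) = (\<integral>\<^sup>+x. h x \<partial>distr lborel borel ((+) a))"
      by (subst nn_integral_distr) auto
    then show ?thesis by (simp add: lborel_distr_plus)
  qed
  have em: "emeasure \<mu> A = emeasure lborel (T -` A)" if "A \<in> sets borel" for A
    using that by (simp add: \<mu>_def emeasure_distr)
  have em_fin: "emeasure lborel (T -` A) < \<infinity>" if "bounded A" for A
  proof -
    have "compact (T' ` closure A)"
      using that cont(2) by (intro compact_continuous_image) (auto simp: compact_closure intro: continuous_on_subset)
    moreover have "T -` A \<subseteq> T' ` closure A"
      using closure_subset[of A] inv(2) by (metis image_iff subsetD subsetI vimageE)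
    ultimately show ?thesis
      by (meson bounded_subset compact_imp_bounded emeasure_bounded_finite)
  qed
  \<comment> \<open>Required for Fubini. Since \<open>T'\<close> is continuous, preimages of balls
    under \<open>T\<close> are bounded and so have finite measure.\<close>
  have sf: "sigma_finite_measure \<mu>"
  proof
    show "\<exists>A. countable A \<and> A \<subseteq> sets \<mu> \<and> \<Union>A = space \<mu> \<and> (\<forall>a\<in>A. emeasure \<mu> a \<noteq> \<infinity>)"
    proof (intro exI[of _ "range (\<lambda>n::nat. ball 0 (real n))"] conjI ballI)
      show "\<Union>(range (\<lambda>n::nat. ball (0::'a) (real n))) = space \<mu>"
        using reals_Archimedean2 by auto
    next
      fix a :: "'a set" assume "a \<in> range (\<lambda>n::nat. ball 0 (real n))"
      then have "bounded a" "a \<in> sets borel" by auto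
      then show "emeasure \<mu> a \<noteq> \<infinity>" using em_fin[of a] em[of a] by auto
    qed auto
  qed
  interpret mu: sigma_finite_measure \<mu> by (rule sf)
  interpret pair_sigma_finite \<mu> "lborel :: 'a measure" ..
  define U :: "'a set" where "U = ball 0 1"
  have [measurable]: "U \<in> sets borel" by (simp add: U_def)
  have main: "emeasure lborel U * emeasure \<mu> A = emeasure \<mu> U * emeasure lborel A"
    if [measurable]: "A \<in> sets borel" for A
  proof -
    have "emeasure lborel U * emeasure \<mu> A = (\<integral>\<^sup>+y. indicator U y * (\<integral>\<^sup>+x. indicator A x \<partial>\<mu>) \<partial>lborel)"
      by (simp add: nn_integral_multc)
    also have "\<dots> = (\<integral>\<^sup>+y. (\<integral>\<^sup>+x. indicator U y * indicator A (x + y) \<partial>\<mu>) \<partial>lborel)"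
      by (simp add: nn_integral_cmult shift[of "indicator A"])
    also have "\<dots> = (\<integral>\<^sup>+x. (\<integral>\<^sup>+y. indicator U y * indicator A (x + y) \<partial>lborel) \<partial>\<mu>)"
      by (subst Fubini') auto
    also have "\<dots> = (\<integral>\<^sup>+x. (\<integral>\<^sup>+y. indicator U (y - x) * indicator A y \<partial>lborel) \<partial>\<mu>)"
    proof (rule nn_integral_cong)
      fix x
      show "(\<integral>\<^sup>+y. indicator U y * indicator A (x + y) \<partial>lborel) =
            (\<integral>\<^sup>+y. indicator U (y - x) * indicator A y \<partial>lborel)"
        using lshift[of "\<lambda>y. indicator U (y - x) * indicator A y" x] by simp
    qed
    also have "\<dots> = (\<integral>\<^sup>+y. (\<integral>\<^sup>+x. indicator U (y - x) * indicator A y \<partial>\<mu>) \<partial>lborel)"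
      by (subst Fubini') auto
    also have "\<dots> = (\<integral>\<^sup>+y. emeasure \<mu> U * indicator A y \<partial>lborel)"
    proof (rule nn_integral_cong)
      fix y
      have "(\<integral>\<^sup>+x. indicator U (y - x) \<partial>\<mu>) = (\<integral>\<^sup>+x. indicator U (y - (x + y)) \<partial>\<mu>)"
        by (rule shift[symmetric]) auto
      also have "\<dots> = (\<integral>\<^sup>+x. indicator U x \<partial>\<mu>)"
        by (intro nn_integral_cong) (auto simp: indicator_def U_def)
      also have "\<dots> = emeasure \<mu> U"
        by (simp add: U_def)
      finally show "(\<integral>\<^sup>+x. indicator U (y - x) * indicator A y \<partial>\<mu>) = emeasure \<mu> U * indicator A y"
        by (simp add: nn_integral_multc)
    qed
    also have "\<dots> = emeasure \<mu> U * emeasure lborel A"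
      by (simp add: nn_integral_cmult)
    finally show ?thesis .
  qed
  define a b where "a = measure lborel U" and "b = measure lborel (T -` U)"
  have a: "emeasure lborel U = ennreal a" "a > 0"
    unfolding a_def U_def using emeasure_lborel_ball_finite[of "0::'a" 1]
    by (auto simp: emeasure_eq_ennreal_measure content_ball_pos)
  have "open (T -` U)" "T' 0 \<in> T -` U"
    using cont inv(1)[of 0] by (auto simp: U_def intro: open_vimage)
  then have pos: "emeasure lborel (T -` U) > 0"
    by (intro emeasure_lborel_open_pos) auto
  have fin: "emeasure lborel (T -` U) < \<infinity>"
    by (rule em_fin) (simp add: U_def)
  have b: "emeasure lborel (T -` U) = ennreal b"
    unfolding b_def by (rule emeasure_eq_ennreal_measure) (use fin in auto)
  have b0: "b > 0"
    using pos by (simp add: b)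
  have "emeasure \<mu> A = ennreal (b / a) * emeasure lborel A" if "A \<in> sets borel" for A
  proof -
    have "emeasure \<mu> A = ennreal (1 / a) * (ennreal a * emeasure \<mu> A)"
      using a(2) by (simp add: mult.assoc[symmetric] ennreal_mult'[symmetric])
    also have "\<dots> = ennreal (1 / a) * (ennreal b * emeasure lborel A)"
      using main[OF that] by (simp add: a em[of U] b)
    also have "\<dots> = ennreal (b / a) * emeasure lborel A"
      using a(2) b0 by (simp add: mult.assoc[symmetric] ennreal_mult'[symmetric])
    finally show ?thesis .
  qed
  then have "\<mu> = density lborel (\<lambda>_. ennreal (b / a))"
    by (intro measure_eqI) (auto simp: emeasure_density nn_integral_cmult)
  then show ?thesis
    using a(2) b0 by (intro that[of "b / a"]) (auto simp: \<mu>_def)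
qed

section \<open>The simply transitive group of affine automorphisms\<close>

definition base_point :: "complex^'n::{finite,linorder}" where
  "base_point = axis lst \<i>"

text \<open>A dilation with weight \<open>sqrt (rho z)\<close> on the first coordinates and
  \<open>rho z\<close> on the last, followed by the shear that belongs to the translation by
  \<open>z\<close>.\<close>

definition TB_aut_lin :: "complex^'n::{finite,linorder} \<Rightarrow> complex^'n::{finite,linorder} \<Rightarrow> complex^'n::{finite,linorder}" where
  "TB_aut_lin z v = (\<chi> j. if j = lst
     then rho z * v $ lst + 2 * sqrt (rho z) * (\<Sum>k\<in>UNIV - {lst}. Im (z $ k) * v $ k)
     else sqrt (rho z) * v $ j)"

text \<open>The translation part is the boundary point beneath \<open>z\<close>, whose last
  imaginary part is |y'|^2. The base point, at height 1 above the origin, is thus sent to height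
  \<open>rho z\<close> above that boundary point.\<close>

definition TB_aut :: "complex^'n::{finite,linorder} \<Rightarrow> complex^'n::{finite,linorder} \<Rightarrow> complex^'n::{finite,linorder}" where
  "TB_aut z w = TB_aut_lin z w + (\<chi> j. if j = lst
     then Complex (Re (z $ lst)) (\<Sum>k\<in>UNIV - {lst}. (Im (z $ k))\<^sup>2) else z $ j)"

text \<open>Found by solving \<open>TB_aut z w = base_point\<close> for \<open>w\<close>. In the
  group structure that simple transitivity puts on \<open>TB\<close>, it is the inverse of
  \<open>z\<close>.\<close>

definition TB_inv :: "complex^'n::{finite,linorder} \<Rightarrow> complex^'n::{finite,linorder}" where
  "TB_inv z = (\<chi> j. if j = lst
     then Complex ((2 * (\<Sum>k\<in>UNIV - {lst}. Im (z $ k) * Re (z $ k)) - Re (z $ lst)) / rho z)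
       ((1 + (\<Sum>k\<in>UNIV - {lst}. (Im (z $ k))\<^sup>2)) / rho z)
     else - z $ j / sqrt (rho z))"

lemma TB_iff_rho_pos: "z \<in> TB \<longleftrightarrow> rho z > 0"
  by (simp add: TB_def rho_def)

lemma rho_base_point [simp]: "rho base_point = 1"
  by (simp add: rho_def base_point_def axis_def)

lemma base_point_in_TB [simp]: "base_point \<in> TB"
  by (simp add: TB_iff_rho_pos)

lemma Im_base_point: "j \<noteq> lst \<Longrightarrow> Im (base_point $ j) = 0"
  by (simp add: base_point_def axis_def)

text \<open>The shear is designed to cancel the cross term in the square of
  \<open>sqrt (rho z)\<close> Im w' + Im z', and the translation part cancels |Im z'|^2.\<close>

lemma rho_TB_aut:
  assumes "z \<in> TB"
  shows "rho (TB_aut z w) = rho z * rho w"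
proof -
  define s where "s = sqrt (rho z)"
  have s: "rho z = s * s" using assms by (simp add: s_def TB_iff_rho_pos)
  have "(\<Sum>j\<in>UNIV - {lst}. (Im (TB_aut z w $ j))\<^sup>2) = (\<Sum>j\<in>UNIV - {lst}. (s * Im (w $ j) + Im (z $ j))\<^sup>2)"
    by (intro sum.cong) (auto simp: TB_aut_def TB_aut_lin_def s_def)
  also have "\<dots> = s * s * (\<Sum>j\<in>UNIV - {lst}. (Im (w $ j))\<^sup>2)
     + 2 * s * (\<Sum>j\<in>UNIV - {lst}. Im (z $ j) * Im (w $ j)) + (\<Sum>j\<in>UNIV - {lst}. (Im (z $ j))\<^sup>2)"
    by (simp add: power2_eq_square algebra_simps sum.distrib sum_distrib_left)
  finally show ?thesis
    unfolding rho_def[of "TB_aut z w"]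
    by (simp add: TB_aut_def TB_aut_lin_def s_def[symmetric]) (simp add: rho_def[of w] s algebra_simps)
qed

lemma TB_aut_in_TB: "z \<in> TB \<Longrightarrow> w \<in> TB \<Longrightarrow> TB_aut z w \<in> TB"
  by (simp add: TB_iff_rho_pos rho_TB_aut)

lemma TB_aut_base_point [simp]:
  assumes "z \<in> TB"
  shows "TB_aut z base_point = z"
proof -
  have "(\<Sum>k\<in>UNIV - {lst}. Im (z $ k) * base_point $ k) = (0 :: complex)"
    by (intro sum.neutral) (auto simp: base_point_def axis_def)
  then show ?thesis
    by (auto simp: vec_eq_iff TB_aut_def TB_aut_lin_def complex_eq_iff) (auto simp: base_point_def axis_def rho_def)
qed

lemma rho_TB_inv:
  assumes "z \<in> TB"
  shows "rho (TB_inv z) = 1 / rho z"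
proof -
  have r: "rho z > 0" using assms by (simp add: TB_iff_rho_pos)
  have "(\<Sum>j\<in>UNIV - {lst}. (Im (TB_inv z $ j))\<^sup>2) = (\<Sum>j\<in>UNIV - {lst}. (Im (z $ j))\<^sup>2 / rho z)"
    using r by (intro sum.cong) (auto simp: TB_inv_def power2_eq_square)
  then show ?thesis
    unfolding rho_def[of "TB_inv z"] using r
    by (simp add: TB_inv_def sum_divide_distrib[symmetric] add_divide_distrib)
qed

lemma TB_inv_in_TB: "z \<in> TB \<Longrightarrow> TB_inv z \<in> TB"
  by (simp add: TB_iff_rho_pos rho_TB_inv)

text \<open>The group law (z u) u^-1 = z. It recovers \<open>z\<close> from \<open>u\<close> and
  \<open>TB_aut z u\<close> by a continuous formula, which confines \<open>z\<close> to a compact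
  set in \<open>eventually_to_boundary_TB_aut\<close>.\<close>

lemma TB_aut_TB_aut_TB_inv:
  assumes "z \<in> TB" "u \<in> TB"
  shows "TB_aut (TB_aut z u) (TB_inv u) = z"
proof -
  define s t where "s = sqrt (rho z)" and "t = sqrt (rho u)"
  have s: "rho z = s * s" "s > 0" and t: "rho u = t * t" "t > 0"
    using assms by (simp_all add: s_def t_def TB_iff_rho_pos)
  have st: "sqrt (rho (TB_aut z u)) = s * t"
    using assms by (simp add: rho_TB_aut s_def t_def real_sqrt_mult)
  have st': "sqrt (s * (s * (t * t))) = s * t"
    using s(2) t(2) by (simp add: real_sqrt_mult[of s] real_sqrt_mult[of t] flip: mult.assoc) (simp add: real_sqrt_mult)
  define Y where "Y = (\<lambda>k. Im (z $ k))"
  define X where "X = (\<lambda>k. Re (u $ k))"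
  define V where "V = (\<lambda>k. Im (u $ k))"
  let ?S = "\<lambda>f. \<Sum>k\<in>UNIV - {lst::'a}. f k"
  have nl: "TB_aut z u $ k = s * u $ k + z $ k" "TB_inv u $ k = - u $ k / t" if "k \<noteq> lst" for k
    using that by (simp_all add: TB_aut_def TB_aut_lin_def TB_inv_def s_def t_def)
  have lz: "Re (TB_aut z u $ lst) = s * s * Re (u $ lst) + 2 * s * ?S (\<lambda>k. Y k * X k) + Re (z $ lst)"
    by (simp add: TB_aut_def TB_aut_lin_def s(1) X_def Y_def real_sqrt_mult[symmetric] s(2) less_imp_le abs_of_pos)
  have S1: "?S (\<lambda>k. Im (TB_aut z u $ k) * Re (TB_inv u $ k)) = - (s / t) * ?S (\<lambda>k. V k * X k) - (1 / t) * ?S (\<lambda>k. Y k * X k)"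
    unfolding sum_distrib_left sum_subtractf[symmetric]
    by (intro sum.cong) (use t(2) in \<open>auto simp: nl X_def Y_def V_def divide_simps, simp_all add: algebra_simps\<close>)
  have S2: "?S (\<lambda>k. Im (TB_aut z u $ k) * Im (TB_inv u $ k)) = - (s / t) * ?S (\<lambda>k. V k * V k) - (1 / t) * ?S (\<lambda>k. Y k * V k)"
    unfolding sum_distrib_left sum_subtractf[symmetric]
    by (intro sum.cong) (use t(2) in \<open>auto simp: nl X_def Y_def V_def divide_simps, simp_all add: algebra_simps\<close>)
  have S3: "?S (\<lambda>k. (Im (TB_aut z u $ k))\<^sup>2) = s * s * ?S (\<lambda>k. V k * V k) + 2 * s * ?S (\<lambda>k. Y k * V k) + ?S (\<lambda>k. Y k * Y k)"
    unfolding sum_distrib_left sum.distrib[symmetric]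
    by (intro sum.cong) (auto simp: nl X_def Y_def V_def power2_eq_square algebra_simps)
  have lu: "Re (TB_inv u $ lst) = (2 * ?S (\<lambda>k. V k * X k) - Re (u $ lst)) / (t * t)"
      "Im (TB_inv u $ lst) = (1 + ?S (\<lambda>k. V k * V k)) / (t * t)"
    by (simp_all add: TB_inv_def t(1) V_def X_def power2_eq_square)
  have Zl: "Im (z $ lst) = s * s + ?S (\<lambda>k. Y k * Y k)"
    using s(1) by (simp add: rho_def Y_def power2_eq_square)
  have "TB_aut (TB_aut z u) (TB_inv u) $ j = z $ j" for j
  proof (cases "j = lst")
    case True
    have R: "Re (TB_aut (TB_aut z u) (TB_inv u) $ lst) = (s * t) * (s * t) * Re (TB_inv u $ lst)
        + 2 * (s * t) * ?S (\<lambda>k. Im (TB_aut z u $ k) * Re (TB_inv u $ k)) + Re (TB_aut z u $ lst)"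
      unfolding TB_aut_def[of "TB_aut z u"] TB_aut_lin_def[of "TB_aut z u"] using assms s t
      by (simp add: st st' rho_TB_aut[OF assms(1)] algebra_simps)
    have I: "Im (TB_aut (TB_aut z u) (TB_inv u) $ lst) = (s * t) * (s * t) * Im (TB_inv u $ lst)
        + 2 * (s * t) * ?S (\<lambda>k. Im (TB_aut z u $ k) * Im (TB_inv u $ k)) + ?S (\<lambda>k. (Im (TB_aut z u $ k))\<^sup>2)"
      unfolding TB_aut_def[of "TB_aut z u"] TB_aut_lin_def[of "TB_aut z u"] using assms s t
      by (simp add: st st' rho_TB_aut[OF assms(1)] algebra_simps)
    show ?thesis
      unfolding True complex_eq_iff R I S1 S2 S3 lu lz Zl using s(2) t(2)
      by (simp add: field_simps)
  next
    case False
    then show ?thesis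
      unfolding TB_aut_def[of "TB_aut z u"] TB_aut_lin_def[of "TB_aut z u"] using t(2)
      by (simp add: st nl field_simps)
  qed
  then show ?thesis by (simp add: vec_eq_iff)
qed

lemma TB_aut_right_inverse:
  assumes "z \<in> TB"
  shows "TB_aut z (TB_aut (TB_inv z) w) = w"
proof -
  define s where "s = sqrt (rho z)"
  have s: "rho z = s * s" "s > 0" using assms by (simp_all add: s_def TB_iff_rho_pos)
  have s': "sqrt (1 / (s * s)) = 1 / s" "rho (TB_inv z) = 1 / (s * s)"
    using assms s by (simp_all add: rho_TB_inv real_sqrt_divide)
  have nl: "TB_aut (TB_inv z) w $ k = w $ k / s - z $ k / s" "TB_inv z $ k = - z $ k / s" if "k \<noteq> lst" for k
    proof -
    show "TB_inv z $ k = - z $ k / s"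
      using that by (simp add: TB_inv_def s_def)
    then show "TB_aut (TB_inv z) w $ k = w $ k / s - z $ k / s"
      using that by (simp add: TB_aut_def TB_aut_lin_def s')
  qed
  let ?S = "\<lambda>f. \<Sum>k\<in>UNIV - {lst::'a}. f k"
  have S1: "?S (\<lambda>k. Im (z $ k) * TB_aut (TB_inv z) w $ k) = (1 / s) * (?S (\<lambda>k. Im (z $ k) * w $ k) - ?S (\<lambda>k. Im (z $ k) * z $ k))"
    unfolding sum_distrib_left sum_subtractf[symmetric]
    by (intro sum.cong) (auto simp: nl diff_divide_distrib right_diff_distrib mult_ac)
  have S2: "?S (\<lambda>k. Im (TB_inv z $ k) * w $ k) = - (1 / s) * ?S (\<lambda>k. Im (z $ k) * w $ k)"
    unfolding sum_distrib_left by (intro sum.cong) (auto simp: nl)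
  have S3: "?S (\<lambda>k. (Im (TB_inv z $ k))\<^sup>2) = (1 / (s * s)) * ?S (\<lambda>k. (Im (z $ k))\<^sup>2)"
    unfolding sum_distrib_left by (intro sum.cong) (auto simp: nl power2_eq_square)
  have S4: "?S (\<lambda>k. Im (z $ k) * z $ k) = Complex (?S (\<lambda>k. Im (z $ k) * Re (z $ k))) (?S (\<lambda>k. (Im (z $ k))\<^sup>2))"
    by (simp add: complex_eq_iff power2_eq_square)
  have lp: "TB_aut (TB_inv z) w $ lst = w $ lst / (s * s) - 2 / (s * s) * ?S (\<lambda>k. Im (z $ k) * w $ k)
     + Complex ((2 * ?S (\<lambda>k. Im (z $ k) * Re (z $ k)) - Re (z $ lst)) / (s * s)) (?S (\<lambda>k. (Im (z $ k))\<^sup>2) / (s * s))"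
    unfolding TB_aut_def TB_aut_lin_def by (simp add: s' S2 S3) (simp add: TB_inv_def s(1))
  have "TB_aut z (TB_aut (TB_inv z) w) $ j = w $ j" for j
  proof (cases "j = lst")
    case True
    have "TB_aut z (TB_aut (TB_inv z) w) $ lst = s * s * TB_aut (TB_inv z) w $ lst
       + 2 * s * ?S (\<lambda>k. Im (z $ k) * TB_aut (TB_inv z) w $ k) + Complex (Re (z $ lst)) (?S (\<lambda>k. (Im (z $ k))\<^sup>2))"
      by (simp add: TB_aut_def[of z] TB_aut_lin_def[of z] s_def[symmetric]) (simp add: s)
    then show ?thesis
      unfolding True S1 lp S4 complex_eq_iff using s(2) by (simp add: field_simps)
  next
    case False
    then show ?thesis
      unfolding TB_aut_def[of z] TB_aut_lin_def[of z] using s(2)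
      by (simp add: nl s_def[symmetric] field_simps)
  qed
  then show ?thesis by (simp add: vec_eq_iff)
qed

text \<open>Makes the right inverse \<open>TB_aut (TB_inv z)\<close> two-sided without a second
  computation in coordinates.\<close>

lemma TB_inv_TB_inv:
  assumes "z \<in> TB"
  shows "TB_inv (TB_inv z) = z"
  using TB_aut_TB_aut_TB_inv[of "TB_inv z" "TB_inv (TB_inv z)"] TB_aut_right_inverse[of "TB_inv z" base_point] assms
  by (simp add: TB_inv_in_TB) (metis TB_aut_base_point TB_aut_TB_aut_TB_inv TB_aut_right_inverse TB_inv_in_TB)

lemma TB_aut_left_inverse:
  assumes "z \<in> TB"
  shows "TB_aut (TB_inv z) (TB_aut z w) = w"
  using TB_aut_right_inverse[of "TB_inv z"] assms by (simp add: TB_inv_in_TB TB_inv_TB_inv)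

lemma inj_TB_aut: "z \<in> TB \<Longrightarrow> inj (TB_aut z)"
  by (metis injI TB_aut_left_inverse)

lemma linear_TB_aut_lin: "linear (TB_aut_lin z)"
proof
  fix b1 b2 :: "complex^'a::{finite,linorder}"
  have "(\<Sum>k\<in>UNIV - {lst}. Im (z $ k) * (b1 $ k + b2 $ k)) = (\<Sum>k\<in>UNIV - {lst}. Im (z $ k) * b1 $ k)
     + (\<Sum>k\<in>UNIV - {lst}. Im (z $ k) * b2 $ k)"
    by (simp add: algebra_simps sum.distrib)
  then show "TB_aut_lin z (b1 + b2) = TB_aut_lin z b1 + TB_aut_lin z b2"
    by (auto simp: vec_eq_iff TB_aut_lin_def algebra_simps)
next
  fix r and b :: "complex^'a::{finite,linorder}"
  have "(\<Sum>k\<in>UNIV - {lst}. Im (z $ k) * (r *\<^sub>R b $ k)) = r *\<^sub>R (\<Sum>k\<in>UNIV - {lst}. Im (z $ k) * b $ k)"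
    by (simp add: scaleR_sum_right)
  then show "TB_aut_lin z (r *\<^sub>R b) = r *\<^sub>R TB_aut_lin z b"
    unfolding TB_aut_lin_def by (simp add: vec_eq_iff scaleR_add_right)
qed

lemma TB_aut_lin_cmult: "TB_aut_lin z (c *s v) = c *s TB_aut_lin z v"
proof -
  have "(\<Sum>k\<in>UNIV - {lst}. Im (z $ k) * (c * v $ k)) = c * (\<Sum>k\<in>UNIV - {lst}. Im (z $ k) * v $ k)"
    by (simp add: sum_distrib_left mult_ac)
  then show ?thesis
    by (simp add: vec_eq_iff TB_aut_lin_def algebra_simps)
qed

lemma TB_aut_diff: "TB_aut z x - TB_aut z y = TB_aut_lin z (x - y)"
  by (simp add: TB_aut_def linear_diff[OF linear_TB_aut_lin])

lemma TB_aut_has_derivative: "(TB_aut z has_derivative TB_aut_lin z) (at w within S)"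
  unfolding TB_aut_def[abs_def] using linear_TB_aut_lin[of z]
  by (auto intro!: derivative_eq_intros bounded_linear_imp_has_derivative simp: linear_conv_bounded_linear)

section \<open>Continuity of the maps, openness and convexity of the domain\<close>

lemma continuous_on_If_const:
  "continuous_on S f \<Longrightarrow> continuous_on S g \<Longrightarrow> continuous_on S (\<lambda>x. if P then f x else g x)"
  by (cases P) simp_all

lemma continuous_on_rho [continuous_intros]:
  "continuous_on S f \<Longrightarrow> continuous_on S (\<lambda>x. rho (f x))"
  unfolding rho_def by (intro continuous_intros)

lemma continuous_on_TB_aut_lin [continuous_intros]:
  "continuous_on S f \<Longrightarrow> continuous_on S g \<Longrightarrow> continuous_on S (\<lambda>x. TB_aut_lin (f x) (g x))"
  unfolding TB_aut_lin_def
  by (intro continuous_on_vec_lambda continuous_on_If_const) (intro continuous_intros; assumption)+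

lemma continuous_on_TB_aut [continuous_intros]:
  "continuous_on S f \<Longrightarrow> continuous_on S g \<Longrightarrow> continuous_on S (\<lambda>x. TB_aut (f x) (g x))"
  unfolding TB_aut_def Complex_eq
  by (intro continuous_on_add continuous_on_TB_aut_lin continuous_on_vec_lambda continuous_on_If_const)
     (assumption | intro continuous_intros; assumption)+

lemma continuous_on_TB_inv: "continuous_on TB TB_inv"
  unfolding TB_inv_def Complex_eq
  by (intro continuous_on_vec_lambda continuous_on_If_const; intro continuous_intros)
     (auto simp: TB_iff_rho_pos)

lemma TB_eq: "TB = {z. 0 < rho z}"
  by (auto simp: TB_iff_rho_pos)

lemma open_TB: "open TB"
  unfolding TB_eq by (intro open_Collect_less continuous_intros)

text \<open>A linear function minus squares of linear functions is concave. Hence segments are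
  admissible curves in the domain, and superlevel sets of \<open>rho\<close> are convex, as the mean
  value inequality will require.\<close>

lemma rho_convex_comb:
  assumes "0 \<le> t" "t \<le> 1"
  shows "(1 - t) * rho x + t * rho y \<le> rho ((1 - t) *\<^sub>R x + t *\<^sub>R y)"
proof -
  have "((1 - t) * a + t * b)\<^sup>2 \<le> (1 - t) * a\<^sup>2 + t * b\<^sup>2" for a b :: real
  proof -
    have "(1 - t) * a\<^sup>2 + t * b\<^sup>2 - ((1 - t) * a + t * b)\<^sup>2 = t * (1 - t) * (a - b)\<^sup>2"
      by (simp add: power2_eq_square algebra_simps)
    moreover have "0 \<le> t * (1 - t) * (a - b)\<^sup>2" using assms by simp
    ultimately show ?thesis by linarith
  qed
  then have "(\<Sum>j\<in>UNIV - {lst}. ((1 - t) * Im (x $ j) + t * Im (y $ j))\<^sup>2)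
    \<le> (\<Sum>j\<in>UNIV - {lst}. (1 - t) * (Im (x $ j))\<^sup>2 + t * (Im (y $ j))\<^sup>2)"
    by (intro sum_mono)
  also have "\<dots> = (1 - t) * (\<Sum>j\<in>UNIV - {lst}. (Im (x $ j))\<^sup>2) + t * (\<Sum>j\<in>UNIV - {lst}. (Im (y $ j))\<^sup>2)"
    by (simp add: sum.distrib sum_distrib_left)
  finally show ?thesis
    by (simp add: rho_def) (simp add: algebra_simps)
qed

lemma convex_rho_ge: "convex {z. e \<le> rho z}"
  unfolding convex_alt
proof (intro ballI allI impI, elim conjE, unfold mem_Collect_eq)
  fix x y :: "complex^'a::{finite,linorder}" and u :: real
  assume *: "e \<le> rho x" "e \<le> rho y" "0 \<le> u" "u \<le> 1"
  then have "(1 - u) * e + u * e \<le> (1 - u) * rho x + u * rho y"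
    by (intro add_mono mult_left_mono) auto
  then show "e \<le> rho ((1 - u) *\<^sub>R x + u *\<^sub>R y)"
    using rho_convex_comb[of u x y] * by (simp add: algebra_simps)
qed

section \<open>The Bergman metric\<close>

text \<open>The Hermitian form of the mixed second derivatives of -log \<open>rho\<close>: the first
  summand comes from the second derivatives of \<open>rho\<close>, the second is the squared modulus
  of the complex differential of \<open>rho\<close> at \<open>v\<close>, divided by
  \<open>rho\<close>^2.\<close>

definition bergman_form :: "complex^'n::{finite,linorder} \<Rightarrow> complex^'n::{finite,linorder} \<Rightarrow> real" where
  "bergman_form z v = (\<Sum>j\<in>UNIV - {lst}. (cmod (v $ j))\<^sup>2) / (2 * rho z)
     + (cmod (v $ lst - 2 * (\<Sum>j\<in>UNIV - {lst}. Im (z $ j) * v $ j)))\<^sup>2 / (4 * (rho z)\<^sup>2)"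

definition rho_deriv :: "complex^'n::{finite,linorder} \<Rightarrow> complex^'n::{finite,linorder} \<Rightarrow> real" where
  "rho_deriv z v = Im (v $ lst) - 2 * (\<Sum>j\<in>UNIV - {lst}. Im (z $ j) * Im (v $ j))"

section \<open>Derivatives of \<open>rho\<close> and the explicit Bergman matrix\<close>

lemma sum_split_lst: "(\<Sum>j\<in>UNIV. f j) = f lst + (\<Sum>j\<in>UNIV - {lst}. f j)"
  by (rule sum.remove) auto

lemma has_vector_derivative_vec_nth:
  "(\<gamma> has_vector_derivative v) F \<Longrightarrow> ((\<lambda>t. \<gamma> t $ j) has_vector_derivative v $ j) F"
  by (rule bounded_linear.has_vector_derivative[OF bounded_linear_vec_nth])

lemma has_real_derivative_Im_vec_nth:
  assumes "(\<gamma> has_vector_derivative v) (at t within S)"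
  shows "((\<lambda>t. Im (\<gamma> t $ j)) has_real_derivative Im (v $ j)) (at t within S)"
  using bounded_linear.has_vector_derivative[OF bounded_linear_Im has_vector_derivative_vec_nth[OF assms]]
  by (simp add: has_real_derivative_iff_has_vector_derivative)

lemma rho_has_real_derivative:
  assumes "(\<gamma> has_vector_derivative v) (at t within S)"
  shows "((\<lambda>t. rho (\<gamma> t)) has_real_derivative rho_deriv (\<gamma> t) v) (at t within S)"
  unfolding rho_def rho_deriv_def
  by (rule derivative_eq_intros has_real_derivative_Im_vec_nth[OF assms] refl)+
     (simp add: sum_distrib_left mult_ac)

lemma line_has_vector_derivative: "((\<lambda>t. z + t *\<^sub>R v) has_vector_derivative v) (at t within S)"
  by (auto intro!: derivative_eq_intros)

lemma dir_derivI:
  "((\<lambda>t. f (z + t *\<^sub>R v)) has_vector_derivative d) (at 0) \<Longrightarrow> dir_deriv f v z = d"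
  unfolding dir_deriv_def by (rule vector_derivative_at)

text \<open>Closed formulas for the kernel and its first derivatives hold only on \<open>TB\<close>.
  As \<open>TB\<close> is open, derivatives at its points see nothing else.\<close>

lemma dir_deriv_cong_TB:
  assumes "z \<in> TB" "\<And>w. w \<in> TB \<Longrightarrow> f w = g w"
    and "((\<lambda>t. g (z + t *\<^sub>R v)) has_vector_derivative d) (at 0)"
  shows "dir_deriv f v z = d"
proof (rule dir_derivI, rule has_vector_derivative_transform_within_open[OF assms(3)])
  show "open ((\<lambda>t::real. z + t *\<^sub>R v) -` TB)"
    by (intro open_vimage open_TB continuous_intros)
qed (use assms in auto)

text \<open>The Wirtinger derivative of \<open>rho\<close> with respect to z_j.\<close>

definition rcoef :: "'n \<Rightarrow> complex^'n::{finite,linorder} \<Rightarrow> complex" where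
  "rcoef j z = (if j = lst then - \<i> / 2 else \<i> * Im (z $ j))"

lemma rho_deriv_axis:
  "rho_deriv z (axis j 1) = 0" "rho_deriv z (axis j \<i>) = (if j = lst then 1 else - 2 * Im (z $ j))"
proof -
  have *: "Im (axis j c $ k) = (if k = j then Im c else 0)" for k c
    by (simp add: axis_def)
  show "rho_deriv z (axis j 1) = 0" by (auto simp: rho_deriv_def * intro!: sum.neutral split: if_splits)
  show "rho_deriv z (axis j \<i>) = (if j = lst then 1 else - 2 * Im (z $ j))"
    by (auto simp: rho_deriv_def * sum.delta' if_distrib[of "\<lambda>x. _ * x"] cong: if_cong)
qed

lemma dz_ln_bergman_kernel:
  fixes z :: "complex^'n::{finite,linorder}"
  assumes "z \<in> TB" "-1 < \<alpha>"
  shows "dz j (\<lambda>w. complex_of_real (ln (bergman_kernel \<alpha> w))) z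
    = - (real CARD('n) + 1 + \<alpha>) * (rcoef j z / rho z)"
proof -
  define N where "N = real CARD('n) + 1 + \<alpha>"
  define c where "c = Gamma N / (2 ^ (CARD('n) + 1) * pi ^ CARD('n) * Gamma (\<alpha> + 1))"
  have "c > 0" unfolding c_def N_def using assms(2)
    by (intro divide_pos_pos mult_pos_pos Gamma_real_pos) auto
  then have ln_eq: "ln (bergman_kernel \<alpha> w) = ln c - N * ln (rho w)" if "w \<in> TB" for w :: "complex^'n::{finite,linorder}"
    using that unfolding bergman_kernel_def N_def[symmetric] c_def[symmetric] TB_iff_rho_pos
    by (subst ln_mult) (auto simp: ln_powr)
  have r: "rho z > 0" using assms by (simp add: TB_iff_rho_pos)
  have dd: "dir_deriv (\<lambda>w. complex_of_real (ln (bergman_kernel \<alpha> w))) v z = of_real (- N * rho_deriv z v / rho z)" for v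
  proof (rule dir_deriv_cong_TB[OF assms(1)])
    show "complex_of_real (ln (bergman_kernel \<alpha> w)) = of_real (ln c - N * ln (rho w))" if "w \<in> TB" for w :: "complex^'n::{finite,linorder}"
      using ln_eq[OF that] by simp
    have "((\<lambda>t. ln c - N * ln (rho (z + t *\<^sub>R v))) has_real_derivative (- N * rho_deriv z v / rho z)) (at 0)"
      using r by (auto intro!: derivative_eq_intros rho_has_real_derivative[OF line_has_vector_derivative])
    then show "((\<lambda>t. complex_of_real (ln c - N * ln (rho (z + t *\<^sub>R v)))) has_vector_derivative of_real (- N * rho_deriv z v / rho z)) (at 0)"
      by (rule has_vector_derivative_of_real)
  qed
  show ?thesis
    unfolding dz_def dd rho_deriv_axis N_def[symmetric] rcoef_def using r by (auto simp: field_simps)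
qed

text \<open>Up to a constant the logarithm of the kernel is -(n+1+\<alpha>) log \<open>rho\<close>,
  and the normalising factor of the metric removes n+1+\<alpha>, so that the result does not depend
  on \<alpha>. The quotient rule gives two terms; the mixed derivatives of \<open>rho\<close> are
  -1/2 on the diagonal away from \<open>lst\<close> and 0 elsewhere.\<close>

lemma bergman_matrix_eq:
  fixes z :: "complex^'n::{finite,linorder}"
  assumes "z \<in> TB" "-1 < \<alpha>"
  shows "bergman_matrix \<alpha> z $ i $ j =
    (if i = j \<and> j \<noteq> lst then 1 / (2 * rho z) else 0) + cnj (rcoef i z) * rcoef j z / (rho z)\<^sup>2"
proof -
  define N where "N = real CARD('n) + 1 + \<alpha>"
  have N: "N > 0" using assms(2) by (simp add: N_def)
  have r: "rho z > 0" using assms by (simp add: TB_iff_rho_pos)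
  define f where "f = dz j (\<lambda>w::complex^'n::{finite,linorder}. complex_of_real (ln (bergman_kernel \<alpha> w)))"
  define r' where "r' v = (if j = lst then 0 else \<i> * Im (v $ j))" for v :: "complex^'n::{finite,linorder}"
  have dd: "dir_deriv f v z = - N * (r' v / rho z - rcoef j z * rho_deriv z v / (rho z)\<^sup>2)" for v
  proof (rule dir_deriv_cong_TB[OF assms(1)])
    show "f w = - N * (rcoef j w / rho w)" if "w \<in> TB" for w
      using dz_ln_bergman_kernel[OF that assms(2)] by (simp add: f_def N_def)
    have 1: "((\<lambda>t. rcoef j (z + t *\<^sub>R v)) has_vector_derivative r' v) (at 0)"
    proof (cases "j = lst")
      case True
      then show ?thesis by (simp add: rcoef_def r'_def)
    next
      case False
      have "((\<lambda>t. complex_of_real (Im ((z + t *\<^sub>R v) $ j))) has_vector_derivative of_real (Im (v $ j))) (at 0)"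
        using has_real_derivative_Im_vec_nth[OF line_has_vector_derivative, of z v j 0]
        by (intro has_vector_derivative_of_real)
      from has_vector_derivative_mult_right[OF this, of \<i>] False show ?thesis
        by (simp add: rcoef_def r'_def)
    qed
    have 2: "((\<lambda>t. 1 / rho (z + t *\<^sub>R v)) has_real_derivative (- rho_deriv z v / (rho z)\<^sup>2)) (at 0)"
      using r by (auto intro!: derivative_eq_intros rho_has_real_derivative[OF line_has_vector_derivative] simp: power2_eq_square)
    have 3: "((\<lambda>t. rcoef j (z + t *\<^sub>R v) * complex_of_real (1 / rho (z + t *\<^sub>R v))) has_vector_derivative
       (rcoef j (z + 0 *\<^sub>R v) * of_real (- rho_deriv z v / (rho z)\<^sup>2) + r' v * of_real (1 / rho (z + 0 *\<^sub>R v)))) (at 0)"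
      by (rule has_vector_derivative_mult[OF 1 has_vector_derivative_of_real[OF 2]])
    show "((\<lambda>t. - N * (rcoef j (z + t *\<^sub>R v) / rho (z + t *\<^sub>R v))) has_vector_derivative
       (- N * (r' v / rho z - rcoef j z * rho_deriv z v / (rho z)\<^sup>2))) (at 0)"
      using has_vector_derivative_mult_right[OF 3, of "- complex_of_real N"] by (simp add: algebra_simps)
  qed
  have r1: "r' (axis i 1) = 0" "r' (axis i \<i>) = (if i = j \<and> j \<noteq> lst then \<i> else 0)"
    by (auto simp: r'_def axis_def)
  have "bergman_matrix \<alpha> z $ i $ j = dzbar i f z / N"
    by (simp add: bergman_matrix_def f_def N_def)
  also have "\<dots> = - (\<i> / 2) * ((if i = j \<and> j \<noteq> lst then \<i> else 0) / rho z - rcoef j z * rho_deriv z (axis i \<i>) / (rho z)\<^sup>2)"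
    unfolding dzbar_def dd r1 rho_deriv_axis(1) using N by (simp add: field_simps)
  also have "\<dots> = (if i = j \<and> j \<noteq> lst then 1 / (2 * rho z) else 0) + cnj (rcoef i z) * rcoef j z / (rho z)\<^sup>2"
    using r by (auto simp: rcoef_def rho_deriv_axis field_simps)
  finally show ?thesis .
qed

lemma Re_herm_bergman_matrix:
  fixes z :: "complex^'n::{finite,linorder}"
  assumes "z \<in> TB" "-1 < \<alpha>"
  shows "Re (herm (bergman_matrix \<alpha> z *v v) v) = bergman_form z v"
proof -
  \<comment> \<open>The complex differential of \<open>rho\<close> applied to \<open>v\<close>. The
    second term of the matrix is the rank-one form that it induces.\<close>
  define T where "T = (\<Sum>j\<in>UNIV. rcoef j z * v $ j)"
  have T: "T = - (\<i> / 2) * (v $ lst - 2 * (\<Sum>j\<in>UNIV - {lst}. Im (z $ j) * v $ j))"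
  proof -
    have "(\<Sum>j\<in>UNIV - {lst}. rcoef j z * v $ j) = \<i> * (\<Sum>j\<in>UNIV - {lst}. Im (z $ j) * v $ j)"
      unfolding sum_distrib_left by (intro sum.cong) (auto simp: rcoef_def)
    then show ?thesis
      unfolding T_def sum_split_lst by (simp add: rcoef_def algebra_simps)
  qed
  have "(bergman_matrix \<alpha> z *v v) $ i = (if i = lst then 0 else v $ i / (2 * rho z)) + cnj (rcoef i z) * T / (rho z)\<^sup>2" for i
  proof -
    have "(bergman_matrix \<alpha> z *v v) $ i = (\<Sum>j\<in>UNIV. (if i = j \<and> j \<noteq> lst then 1 / (2 * rho z) else 0) * v $ j
       + cnj (rcoef i z) / (rho z)\<^sup>2 * (rcoef j z * v $ j))"
      by (simp add: matrix_vector_mult_def bergman_matrix_eq[OF assms] algebra_simps)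
    also have "(\<lambda>j. (if i = j \<and> j \<noteq> lst then 1 / (2 * rho z) else 0) * v $ j)
      = (\<lambda>j. if j = i then (if i = lst then 0 else v $ i / (2 * rho z)) else 0)"
      by auto
    finally show ?thesis
      unfolding sum.distrib sum_distrib_left[symmetric] T_def[symmetric] by simp
  qed
  then have "herm (bergman_matrix \<alpha> z *v v) v
    = (\<Sum>i\<in>UNIV. (if i = lst then 0 else (cmod (v $ i))\<^sup>2 / (2 * rho z))) + (\<Sum>i\<in>UNIV. T / (rho z)\<^sup>2 * cnj (rcoef i z * v $ i))"
    unfolding herm_def of_real_sum sum.distrib[symmetric]
    by (intro sum.cong) (auto simp: algebra_simps complex_norm_square[symmetric] simp flip: of_real_power)
  also have "(\<Sum>i\<in>UNIV. (if i = lst then 0 else (cmod (v $ i))\<^sup>2 / (2 * rho z))) = (\<Sum>i\<in>UNIV - {lst}. (cmod (v $ i))\<^sup>2) / (2 * rho z)"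
    unfolding sum_split_lst sum_divide_distrib by (auto intro!: sum.cong)
  also have "(\<Sum>i\<in>UNIV. T / (rho z)\<^sup>2 * cnj (rcoef i z * v $ i)) = of_real ((cmod T)\<^sup>2 / (rho z)\<^sup>2)"
    unfolding sum_distrib_left[symmetric] cnj_sum[symmetric] T_def[symmetric]
    by (simp add: complex_norm_square[symmetric])
  finally have "Re (herm (bergman_matrix \<alpha> z *v v) v) = (\<Sum>i\<in>UNIV - {lst}. (cmod (v $ i))\<^sup>2) / (2 * rho z) + (cmod T)\<^sup>2 / (rho z)\<^sup>2"
    by simp
  also have "\<dots> = bergman_form z v"
    by (simp add: bergman_form_def T norm_mult norm_divide power_mult_distrib power_divide)
  finally show ?thesis .
qed

lemma bergman_form_nonneg: "z \<in> TB \<Longrightarrow> 0 \<le> bergman_form z v"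
  unfolding bergman_form_def TB_iff_rho_pos by (intro add_nonneg_nonneg divide_nonneg_nonneg sum_nonneg) auto

text \<open>Composition with \<open>TB_aut z\<close> multiplies \<open>rho\<close> by a constant, so
  log \<open>rho\<close> changes by a constant that second derivatives do not see. In coordinates,
  the first components of \<open>v\<close> scale by \<open>sqrt (rho z)\<close> and the complex
  differential of \<open>rho\<close> scales by \<open>rho z\<close>.\<close>

lemma bergman_form_TB_aut:
  assumes "z \<in> TB" "w \<in> TB"
  shows "bergman_form (TB_aut z w) (TB_aut_lin z v) = bergman_form w v"
proof -
  define s where "s = sqrt (rho z)"
  have s: "rho z = s * s" "s > 0" using assms by (simp_all add: s_def TB_iff_rho_pos)
  have 1: "(\<Sum>j\<in>UNIV - {lst}. (cmod (TB_aut_lin z v $ j))\<^sup>2) = s * s * (\<Sum>j\<in>UNIV - {lst}. (cmod (v $ j))\<^sup>2)"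
    unfolding sum_distrib_left
    by (intro sum.cong) (auto simp: TB_aut_lin_def s_def norm_mult power_mult_distrib power2_eq_square)
  have 2: "(\<Sum>j\<in>UNIV - {lst}. Im (TB_aut z w $ j) * TB_aut_lin z v $ j)
    = s * s * (\<Sum>j\<in>UNIV - {lst}. Im (w $ j) * v $ j) + s * (\<Sum>j\<in>UNIV - {lst}. Im (z $ j) * v $ j)"
    unfolding sum_distrib_left sum.distrib[symmetric]
    by (intro sum.cong) (auto simp: TB_aut_lin_def TB_aut_def s_def[symmetric] algebra_simps)
  have 3: "TB_aut_lin z v $ lst = s * s * v $ lst + 2 * s * (\<Sum>k\<in>UNIV - {lst}. Im (z $ k) * v $ k)"
    using s(2) by (simp add: TB_aut_lin_def s_def[symmetric]) (simp add: s(1))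
  have "TB_aut_lin z v $ lst - 2 * (\<Sum>j\<in>UNIV - {lst}. Im (TB_aut z w $ j) * TB_aut_lin z v $ j)
    = of_real (s * s) * (v $ lst - 2 * (\<Sum>j\<in>UNIV - {lst}. Im (w $ j) * v $ j))"
    unfolding 2 3 by (simp add: algebra_simps)
  then show ?thesis
    unfolding bergman_form_def rho_TB_aut[OF assms(1)] 1 using s assms(2)
    by (simp add: norm_mult power_mult_distrib TB_iff_rho_pos power2_eq_square)
qed

lemma continuous_on_bergman_form [continuous_intros]:
  assumes "continuous_on S f" "continuous_on S g" "\<And>x. x \<in> S \<Longrightarrow> f x \<in> TB"
  shows "continuous_on S (\<lambda>x. bergman_form (f x) (g x))"
  unfolding bergman_form_def using assms by (intro continuous_intros) (force simp: TB_iff_rho_pos)+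

section \<open>Bergman balls\<close>

text \<open>The derivative is carried as data: affine images and perturbations of a curve then come
  with an explicit derivative, and \<open>vector_derivative\<close> need not be evaluated
  again.\<close>

definition curve_in_TB ::
  "(real \<Rightarrow> complex^'n::{finite,linorder}) \<Rightarrow> (real \<Rightarrow> complex^'n::{finite,linorder}) \<Rightarrow>
   complex^'n::{finite,linorder} \<Rightarrow> complex^'n::{finite,linorder} \<Rightarrow> bool" where
  "curve_in_TB \<gamma> D z w \<longleftrightarrow> (\<forall>t\<in>{0..1}. (\<gamma> has_vector_derivative D t) (at t)) \<and>
     continuous_on {0..1} D \<and> \<gamma> ` {0..1} \<subseteq> TB \<and> \<gamma> 0 = z \<and> \<gamma> 1 = w"

definition speed_integral ::
  "(real \<Rightarrow> complex^'n::{finite,linorder}) \<Rightarrow> (real \<Rightarrow> complex^'n::{finite,linorder}) \<Rightarrow> real" where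
  "speed_integral \<gamma> D = integral {0..1} (\<lambda>t. sqrt (bergman_form (\<gamma> t) (D t)))"

lemma curve_in_TB_continuous: "curve_in_TB \<gamma> D z w \<Longrightarrow> continuous_on {0..1} \<gamma>"
  unfolding curve_in_TB_def by (meson continuous_at_imp_continuous_on has_vector_derivative_continuous)

lemma curve_in_TB_D: "curve_in_TB \<gamma> D z w \<Longrightarrow> t \<in> {0..1} \<Longrightarrow> \<gamma> t \<in> TB"
  unfolding curve_in_TB_def by auto

lemma continuous_on_speed:
  assumes "curve_in_TB \<gamma> D z w"
  shows "continuous_on {0..1} (\<lambda>t. sqrt (bergman_form (\<gamma> t) (D t)))"
  using assms curve_in_TB_continuous[OF assms] curve_in_TB_D[OF assms]
  by (intro continuous_intros) (auto simp: curve_in_TB_def)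

lemma curve_length_eq:
  assumes "curve_in_TB \<gamma> D z w" "-1 < \<alpha>"
  shows "curve_length \<alpha> \<gamma> = speed_integral \<gamma> D"
  unfolding curve_length_def speed_integral_def
proof (rule integral_cong)
  fix t :: real assume t: "t \<in> {0..1}"
  then have "vector_derivative \<gamma> (at t) = D t"
    using assms by (intro vector_derivative_at) (auto simp: curve_in_TB_def)
  then show "sqrt (Re (herm (bergman_matrix \<alpha> (\<gamma> t) *v vector_derivative \<gamma> (at t)) (vector_derivative \<gamma> (at t)))) = sqrt (bergman_form (\<gamma> t) (D t))"
    using Re_herm_bergman_matrix[OF curve_in_TB_D[OF assms(1) t] assms(2)] by simp
qed

lemma speed_integral_nonneg:
  assumes "curve_in_TB \<gamma> D z w"
  shows "0 \<le> speed_integral \<gamma> D"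
  unfolding speed_integral_def
  using continuous_on_speed[OF assms] curve_in_TB_D[OF assms]
  by (intro integral_nonneg integrable_continuous_interval) (auto intro: bergman_form_nonneg)

lemma segment_in_TB:
  assumes "z \<in> TB" "w \<in> TB"
  shows "curve_in_TB (\<lambda>t. z + t *\<^sub>R (w - z)) (\<lambda>_. w - z) z w"
proof -
  have "z + t *\<^sub>R (w - z) \<in> TB" if "0 \<le> t" "t \<le> 1" for t
  proof -
    have "0 < (1 - t) * rho z + t * rho w"
      using assms that unfolding TB_iff_rho_pos
      by (cases "t = 0") (auto intro!: add_nonneg_pos mult_pos_pos)
    also have "\<dots> \<le> rho ((1 - t) *\<^sub>R z + t *\<^sub>R w)"
      using that by (rule rho_convex_comb)
    also have "(1 - t) *\<^sub>R z + t *\<^sub>R w = z + t *\<^sub>R (w - z)"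
      by (simp add: algebra_simps)
    finally show ?thesis by (simp add: TB_iff_rho_pos)
  qed
  then show ?thesis
    by (auto simp: curve_in_TB_def line_has_vector_derivative)
qed

text \<open>An infimum below \<open>r\<close> yields a curve shorter than \<open>r\<close> because
  the set of lengths is nonempty, by the segment, and bounded below by 0. Every later argument about
  balls works with such a curve in place of the distance.\<close>

lemma mem_bergman_ball_iff:
  assumes "z \<in> TB" "-1 < \<alpha>"
  shows "w \<in> bergman_ball \<alpha> z r \<longleftrightarrow> (\<exists>\<gamma> D. curve_in_TB \<gamma> D z w \<and> speed_integral \<gamma> D < r)"
proof (cases "w \<in> TB")
  case False
  then show ?thesis using curve_in_TB_D[of _ _ z w 1]
    by (auto simp: bergman_ball_def curve_in_TB_def)
next
  case True
  define S where "S = {speed_integral \<gamma> D | \<gamma> D. curve_in_TB \<gamma> D z w}"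
  have "{curve_length \<alpha> \<gamma> |\<gamma>. \<gamma> C1_differentiable_on {0..1} \<and> \<gamma> ` {0..1} \<subseteq> TB \<and> \<gamma> 0 = z \<and> \<gamma> 1 = w} = S"
    (is "?L = S")
  proof
    show "?L \<subseteq> S"
    proof
      fix x assume "x \<in> ?L"
      then obtain \<gamma> D where x: "x = curve_length \<alpha> \<gamma>" "curve_in_TB \<gamma> D z w"
        by (auto simp: C1_differentiable_on_def curve_in_TB_def)
      then have "x = speed_integral \<gamma> D" using curve_length_eq[OF x(2) assms(2)] by simp
      then show "x \<in> S" using x(2) unfolding S_def by blast
    qed
    show "S \<subseteq> ?L"
    proof
      fix x assume "x \<in> S"
      then obtain \<gamma> D where x: "x = speed_integral \<gamma> D" "curve_in_TB \<gamma> D z w"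
        by (auto simp: S_def)
      then have "x = curve_length \<alpha> \<gamma>" using curve_length_eq[OF x(2) assms(2)] by simp
      then show "x \<in> ?L" using x(2) by (auto simp: C1_differentiable_on_def curve_in_TB_def)
    qed
  qed
  then have "bergman_dist \<alpha> z w = Inf S"
    by (simp add: bergman_dist_def)
  moreover have "S \<noteq> {}" using segment_in_TB[OF assms(1) True] by (auto simp: S_def)
  moreover have "bdd_below S"
    by (rule bdd_belowI[of _ 0]) (auto simp: S_def speed_integral_nonneg)
  ultimately show ?thesis
    using True by (auto simp: bergman_ball_def cInf_less_iff S_def)
qed

lemma curve_in_TB_TB_aut:
  assumes "curve_in_TB \<gamma> D z w" "u \<in> TB"
  shows "curve_in_TB (\<lambda>t. TB_aut u (\<gamma> t)) (\<lambda>t. TB_aut_lin u (D t)) (TB_aut u z) (TB_aut u w)"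
    and "speed_integral (\<lambda>t. TB_aut u (\<gamma> t)) (\<lambda>t. TB_aut_lin u (D t)) = speed_integral \<gamma> D"
proof -
  have "((\<lambda>t. TB_aut u (\<gamma> t)) has_vector_derivative TB_aut_lin u (D t)) (at t)" if "t \<in> {0..1}" for t
  proof -
    have "(\<gamma> has_derivative (\<lambda>x. x *\<^sub>R D t)) (at t)"
      using assms that by (auto simp: curve_in_TB_def has_vector_derivative_def)
    from has_derivative_compose[OF this TB_aut_has_derivative] show ?thesis
      by (simp add: has_vector_derivative_def linear_cmul[OF linear_TB_aut_lin])
  qed
  then show "curve_in_TB (\<lambda>t. TB_aut u (\<gamma> t)) (\<lambda>t. TB_aut_lin u (D t)) (TB_aut u z) (TB_aut u w)"
    using assms by (auto simp: curve_in_TB_def image_subset_iff intro!: continuous_intros TB_aut_in_TB)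
  show "speed_integral (\<lambda>t. TB_aut u (\<gamma> t)) (\<lambda>t. TB_aut_lin u (D t)) = speed_integral \<gamma> D"
    unfolding speed_integral_def using curve_in_TB_D[OF assms(1)] assms(2)
    by (intro integral_cong) (simp add: bergman_form_TB_aut)
qed

lemma TB_aut_mem_bergman_ball:
  assumes "w \<in> bergman_ball \<alpha> z r" "u \<in> TB" "z \<in> TB" "-1 < \<alpha>"
  shows "TB_aut u w \<in> bergman_ball \<alpha> (TB_aut u z) r"
  using assms curve_in_TB_TB_aut[OF _ assms(2)]
  unfolding mem_bergman_ball_iff[OF assms(3,4)] mem_bergman_ball_iff[OF TB_aut_in_TB[OF assms(2,3)] assms(4)]
  by metis

lemma bergman_ball_eq_TB_aut_image:
  assumes "z \<in> TB" "-1 < \<alpha>"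
  shows "bergman_ball \<alpha> z r = TB_aut z ` bergman_ball \<alpha> base_point r"
proof
  show "TB_aut z ` bergman_ball \<alpha> base_point r \<subseteq> bergman_ball \<alpha> z r"
    using TB_aut_mem_bergman_ball[of _ \<alpha> base_point r z] assms by auto
  show "bergman_ball \<alpha> z r \<subseteq> TB_aut z ` bergman_ball \<alpha> base_point r"
  proof
    fix w assume "w \<in> bergman_ball \<alpha> z r"
    then have "TB_aut (TB_inv z) w \<in> bergman_ball \<alpha> (TB_aut (TB_inv z) z) r"
      using assms by (intro TB_aut_mem_bergman_ball) (auto simp: TB_inv_in_TB)
    moreover have "TB_aut (TB_inv z) z = base_point"
      using TB_aut_left_inverse[of z base_point] assms by simp
    ultimately show "w \<in> TB_aut z ` bergman_ball \<alpha> base_point r"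
      using TB_aut_right_inverse[of z w] assms(1) by (metis image_eqI)
  qed
qed

lemma center_in_bergman_ball:
  assumes "z \<in> TB" "-1 < \<alpha>" "0 < r"
  shows "z \<in> bergman_ball \<alpha> z r"
proof -
  have "speed_integral (\<lambda>t. z + t *\<^sub>R (z - z)) (\<lambda>_. z - z) = 0"
    by (simp add: speed_integral_def bergman_form_def)
  then show ?thesis
    using segment_in_TB[OF assms(1,1)] assms(3) unfolding mem_bergman_ball_iff[OF assms(1,2)] by force
qed

text \<open>Adding \<open>t *\<^sub>R h\<close> to a curve moves its end point by \<open>h\<close> and changes its length continuously.\<close>

lemma open_bergman_ball:
  fixes z :: "complex^'n::{finite,linorder}"
  assumes "z \<in> TB" "-1 < \<alpha>"
  shows "open (bergman_ball \<alpha> z r)"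
proof (rule Topological_Spaces.openI)
  fix w assume "w \<in> bergman_ball \<alpha> z r"
  then obtain \<gamma> D where c: "curve_in_TB \<gamma> D z w" and len: "speed_integral \<gamma> D < r"
    using mem_bergman_ball_iff[OF assms] by auto
  have "compact (\<gamma> ` {0..1})" "\<gamma> ` {0..1} \<subseteq> TB"
    using c curve_in_TB_continuous[OF c] by (auto simp: curve_in_TB_def intro: compact_continuous_image)
  \<comment> \<open>A uniform tube around the compact trace keeps every perturbed curve with
    \<open>norm h < e\<close> inside the domain.\<close>
  then obtain e where e: "e > 0" "(\<Union>x\<in>\<gamma> ` {0..1}. ball x e) \<subseteq> TB"
    using compact_subset_open_imp_ball_epsilon_subset[OF _ open_TB] by blast
  have in_TB: "\<gamma> t + t *\<^sub>R h \<in> TB" if "t \<in> {0..1}" "norm h < e" for t h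
  proof -
    have "norm (t *\<^sub>R h) \<le> norm h" using that by (simp add: mult_left_le_one_le)
    then have "\<gamma> t + t *\<^sub>R h \<in> ball (\<gamma> t) e" using that by (simp add: dist_norm)
    then show ?thesis using e that by blast
  qed
  define q where "q h t = sqrt (bergman_form (\<gamma> t + t *\<^sub>R h) (D t + h))" for h t
  have "continuous_on (ball 0 e) (\<lambda>h. integral (cbox 0 1) (q h))"
  proof (rule integral_continuous_on_param)
    have "continuous_on (ball 0 e \<times> {0..1}) (\<lambda>x. \<gamma> (snd x))" "continuous_on (ball 0 e \<times> {0..1}) (\<lambda>x. D (snd x))"
      using curve_in_TB_continuous[OF c] c unfolding curve_in_TB_def
      by (auto intro!: continuous_on_compose2[of "{0..1}" _ _ snd] continuous_intros)
    then show "continuous_on (ball 0 e \<times> cbox 0 1) (\<lambda>(h, t). q h t)"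
      unfolding q_def split_beta using in_TB by (intro continuous_intros) auto
  qed
  moreover have "integral (cbox 0 1) (q 0) < r"
    using len by (simp add: speed_integral_def q_def[abs_def])
  ultimately have "\<forall>\<^sub>F h in at 0 within ball 0 e. integral (cbox 0 1) (q h) < r"
    using e(1) by (auto simp: continuous_on_def dest!: bspec[of _ _ 0] intro: order_tendstoD)
  then obtain d where d: "d > 0" "\<And>h. norm h < e \<Longrightarrow> h \<noteq> 0 \<Longrightarrow> norm h < d \<Longrightarrow> integral (cbox 0 1) (q h) < r"
    by (auto simp: eventually_at dist_norm)
  show "\<exists>T. open T \<and> w \<in> T \<and> T \<subseteq> bergman_ball \<alpha> z r"
  proof (intro exI conjI subsetI)
    show "open (ball w (min d e))" "w \<in> ball w (min d e)" using d e by auto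
    fix w' assume w': "w' \<in> ball w (min d e)"
    define h where "h = w' - w"
    have h: "norm h < d" "norm h < e" using w' by (auto simp: h_def dist_norm norm_minus_commute)
    have "curve_in_TB (\<lambda>t. \<gamma> t + t *\<^sub>R h) (\<lambda>t. D t + h) z w'"
      using c in_TB[OF _ h(2)] unfolding curve_in_TB_def
      by (auto simp: h_def intro!: continuous_intros derivative_eq_intros)
    \<comment> \<open>The limit at 0 gives no information at \<open>h = 0\<close> itself, which is
      the original curve and is treated apart.\<close>
    moreover have "speed_integral (\<lambda>t. \<gamma> t + t *\<^sub>R h) (\<lambda>t. D t + h) < r"
    proof (cases "h = 0")
      case True
      then show ?thesis using len by simp
    next
      case False
      then show ?thesis using d(2)[OF h(2) _ h(1)] by (simp add: speed_integral_def q_def[abs_def])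
    qed
    ultimately show "w' \<in> bergman_ball \<alpha> z r"
      using mem_bergman_ball_iff[OF assms] by blast
  qed
qed

text \<open>With \<open>q\<close> the Bergman speed of a curve, any quantity whose rate of change is
  at most \<open>c\<close> times the speed varies by at most \<open>c\<close> times the total
  length, up to every intermediate time \<open>s\<close>.\<close>

lemma norm_diff_le_integral:
  fixes g g' :: "real \<Rightarrow> 'a::euclidean_space"
  assumes g: "\<And>t. t \<in> {0..1} \<Longrightarrow> (g has_vector_derivative g' t) (at t)"
    and q: "continuous_on {0..1} q" "\<And>t. t \<in> {0..1} \<Longrightarrow> 0 \<le> q t"
    and le: "\<And>t. t \<in> {0..1} \<Longrightarrow> norm (g' t) \<le> c * q t" and "0 \<le> c" and s: "s \<in> {0..1}"
  shows "norm (g s - g 0) \<le> c * integral {0..1} q"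
proof -
  have "(g' has_integral (g s - g 0)) {0..s}"
    using s by (intro fundamental_theorem_of_calculus) (auto intro!: has_vector_derivative_at_within[OF g])
  then have i: "g' integrable_on {0..s}" "integral {0..s} g' = g s - g 0"
    by (auto simp: integral_unique has_integral_integrable)
  have qs: "q integrable_on {0..s}" "q integrable_on {0..1}"
    using q(1) s by (auto intro!: integrable_continuous_interval intro: continuous_on_subset)
  have "norm (g s - g 0) \<le> integral {0..s} (\<lambda>t. c * q t)"
    unfolding i(2)[symmetric] using i qs s le
    by (intro integral_norm_bound_integral) (auto intro: integrable_on_mult_right)
  also have "\<dots> = c * integral {0..s} q" by simp
  also have "\<dots> \<le> c * integral {0..1} q"
    using \<open>0 \<le> c\<close> s qs q by (intro mult_left_mono integral_subset_le) auto
  finally show ?thesis .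
qed

text \<open>Each bound drops one of the two nonnegative summands of the form; the third is the
  imaginary part of the second.\<close>

lemma bergman_form_bounds:
  assumes "z \<in> TB"
  shows "j \<noteq> lst \<Longrightarrow> (cmod (v $ j))\<^sup>2 \<le> 2 * rho z * bergman_form z v"
    and "cmod (v $ lst - 2 * (\<Sum>j\<in>UNIV - {lst}. Im (z $ j) * v $ j)) \<le> 2 * rho z * sqrt (bergman_form z v)"
    and "\<bar>rho_deriv z v\<bar> \<le> 2 * rho z * sqrt (bergman_form z v)"
proof -
  have r: "rho z > 0" using assms by (simp add: TB_iff_rho_pos)
  let ?S = "\<Sum>j\<in>UNIV - {lst}. (cmod (v $ j))\<^sup>2"
  let ?T = "v $ lst - 2 * (\<Sum>j\<in>UNIV - {lst}. Im (z $ j) * v $ j)"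
  have S0: "?S \<ge> 0" by (intro sum_nonneg) auto
  have eq: "bergman_form z v = ?S / (2 * rho z) + (cmod ?T)\<^sup>2 / (4 * (rho z)\<^sup>2)" by (simp add: bergman_form_def)
  show "(cmod (v $ j))\<^sup>2 \<le> 2 * rho z * bergman_form z v" if "j \<noteq> lst"
  proof -
    have "(cmod (v $ j))\<^sup>2 \<le> ?S" using that by (intro member_le_sum) auto
    also have "\<dots> = 2 * rho z * (?S / (2 * rho z))" using r by simp
    also have "\<dots> \<le> 2 * rho z * bergman_form z v" using r unfolding eq by (intro mult_left_mono) auto
    finally show ?thesis .
  qed
  have "(cmod ?T)\<^sup>2 = (2 * rho z)\<^sup>2 * ((cmod ?T)\<^sup>2 / (4 * (rho z)\<^sup>2))"
    using r by (simp add: power_mult_distrib)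
  also have "\<dots> \<le> (2 * rho z)\<^sup>2 * bergman_form z v"
    using r S0 unfolding eq by (intro mult_left_mono) auto
  also have "\<dots> = (2 * rho z * sqrt (bergman_form z v))\<^sup>2"
    using bergman_form_nonneg[OF assms] by (simp add: power_mult_distrib)
  finally show T: "cmod ?T \<le> 2 * rho z * sqrt (bergman_form z v)"
    by (rule power2_le_imp_le) (use r bergman_form_nonneg[OF assms] in auto)
  have "rho_deriv z v = Im ?T" by (simp add: rho_deriv_def)
  then show "\<bar>rho_deriv z v\<bar> \<le> 2 * rho z * sqrt (bergman_form z v)"
    using abs_Im_le_cmod[of ?T] T by linarith
qed

lemma norm_vec_le_sum: "norm (x :: complex^'n::{finite,linorder}) \<le> (\<Sum>j\<in>UNIV. cmod (x $ j))"
  unfolding norm_vec_def by (rule L2_set_le_sum) auto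

text \<open>Along a curve of length below \<open>r\<close> the logarithm of \<open>rho\<close>
  starts at 0 and moves at most twice as fast as the length, so \<open>rho\<close> stays between
  exp(-2r) and exp(2r). This bounds the first coordinates at all times, and only then the last one,
  whose velocity involves them through the shear.\<close>

lemma bergman_ball_base_point_bounded:
  assumes "-1 < \<alpha>"
  obtains e M where "e > 0" "bergman_ball \<alpha> (base_point :: complex^'n::{finite,linorder}) r \<subseteq> {w. e \<le> rho w} \<inter> cball 0 M"
proof -
  \<comment> \<open>\<open>E\<close> bounds \<open>rho\<close>; \<open>R\<close> turns (cmod v_j)^2
    <= 2 \<open>rho\<close> times the form into a bound by the speed; \<open>c\<close> adds the
    shear term to the rate \<open>2 * E\<close> of the last coordinate; the 1 in \<open>M\<close> is
    the norm of the base point.\<close>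
  define E where "E = exp (2 * r)"
  define R where "R = sqrt (2 * E)"
  define c where "c = 2 * E + 2 * (real CARD('n) * (R * r * R))"
  define M where "M = 1 + c * r + real CARD('n) * (R * r)"
  have E: "E > 0" and R: "R > 0" by (auto simp: E_def R_def)
  have "1 / E \<le> rho w \<and> norm w \<le> M" if w: "w \<in> bergman_ball \<alpha> base_point r" for w :: "complex^'n::{finite,linorder}"
  proof -
    obtain \<gamma> D where cu: "curve_in_TB \<gamma> D base_point w" and len: "speed_integral \<gamma> D < r"
      using w unfolding mem_bergman_ball_iff[OF base_point_in_TB assms] by blast
    define q where "q t = sqrt (bergman_form (\<gamma> t) (D t))" for t
    define L where "L = integral {0..1} q"
    have L: "L < r" using len by (simp add: L_def q_def[abs_def] speed_integral_def)
    have q: "continuous_on {0..1} q" "\<And>t. t \<in> {0..1} \<Longrightarrow> 0 \<le> q t"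
      using continuous_on_speed[OF cu] curve_in_TB_D[OF cu] bergman_form_nonneg by (auto simp: q_def)
    have L0: "0 \<le> L" unfolding L_def using q by (intro integral_nonneg integrable_continuous_interval) auto
    have D: "(\<gamma> has_vector_derivative D t) (at t)" if "t \<in> {0..1}" for t
      using cu that by (simp add: curve_in_TB_def)
    have g01: "\<gamma> 0 = base_point" "\<gamma> 1 = w" using cu by (auto simp: curve_in_TB_def)
    have pos: "rho (\<gamma> t) > 0" if "t \<in> {0..1}" for t
      using curve_in_TB_D[OF cu that] by (simp add: TB_iff_rho_pos)
    have "\<bar>ln (rho (\<gamma> s))\<bar> \<le> 2 * L" if "s \<in> {0..1}" for s
    proof -
      have "norm (ln (rho (\<gamma> s)) - ln (rho (\<gamma> 0))) \<le> 2 * integral {0..1} q"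
      proof (rule norm_diff_le_integral[where g' = "\<lambda>t. rho_deriv (\<gamma> t) (D t) / rho (\<gamma> t)"])
        fix t :: real assume t: "t \<in> {0..1}"
        show "((\<lambda>a. ln (rho (\<gamma> a))) has_vector_derivative rho_deriv (\<gamma> t) (D t) / rho (\<gamma> t)) (at t)"
          unfolding has_real_derivative_iff_has_vector_derivative[symmetric] using pos[OF t]
          by (auto intro!: derivative_eq_intros rho_has_real_derivative D t)
        show "norm (rho_deriv (\<gamma> t) (D t) / rho (\<gamma> t)) \<le> 2 * q t"
          using bergman_form_bounds(3)[OF curve_in_TB_D[OF cu t], of "D t"] pos[OF t] by (simp add: q_def field_simps)
      qed (use q that in auto)
      then show ?thesis by (simp add: g01 L_def)
    qed
    then have ln_le: "\<bar>ln (rho (\<gamma> s))\<bar> < 2 * r" if "s \<in> {0..1}" for s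
      using that L by fastforce
    have rho_le: "1 / E \<le> rho (\<gamma> s)" "rho (\<gamma> s) \<le> E" if s: "s \<in> {0..1}" for s
    proof -
      have "exp (- (2 * r)) \<le> exp (ln (rho (\<gamma> s)))" "exp (ln (rho (\<gamma> s))) \<le> E"
        using ln_le[OF s] by (auto simp: abs_less_iff E_def)
      then show "1 / E \<le> rho (\<gamma> s)" "rho (\<gamma> s) \<le> E"
        using pos[OF s] by (auto simp: E_def exp_minus inverse_eq_divide)
    qed
    have Dj: "cmod (D t $ j) \<le> R * q t" if "t \<in> {0..1}" "j \<noteq> lst" for t j
    proof (rule power2_le_imp_le)
      have "(cmod (D t $ j))\<^sup>2 \<le> 2 * rho (\<gamma> t) * bergman_form (\<gamma> t) (D t)"
        using bergman_form_bounds(1)[OF curve_in_TB_D[OF cu that(1)] that(2)] .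
      also have "\<dots> \<le> 2 * E * bergman_form (\<gamma> t) (D t)"
        using rho_le[OF that(1)] bergman_form_nonneg[OF curve_in_TB_D[OF cu that(1)]] by (intro mult_right_mono) auto
      also have "\<dots> = (R * q t)\<^sup>2"
        using E bergman_form_nonneg[OF curve_in_TB_D[OF cu that(1)]] by (simp add: R_def q_def power_mult_distrib)
      finally show "(cmod (D t $ j))\<^sup>2 \<le> (R * q t)\<^sup>2" .
      show "0 \<le> R * q t" using q that R by simp
    qed
    have gj: "cmod (\<gamma> s $ j) \<le> R * r" if "s \<in> {0..1}" "j \<noteq> lst" for s j
    proof -
      have "norm (\<gamma> s $ j - \<gamma> 0 $ j) \<le> R * integral {0..1} q"
        by (rule norm_diff_le_integral[where g' = "\<lambda>t. D t $ j"])
           (use q that R Dj in \<open>auto intro!: has_vector_derivative_vec_nth D\<close>)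
      also have "\<dots> \<le> R * r" using L R by (simp add: L_def)
      finally show ?thesis using that by (simp add: g01 base_point_def axis_def)
    qed
    have Dn: "cmod (D t $ lst) \<le> c * q t" if t: "t \<in> {0..1}" for t
    proof -
      have "cmod (\<Sum>j\<in>UNIV - {lst}. Im (\<gamma> t $ j) * D t $ j) \<le> (\<Sum>j\<in>UNIV - {lst::'n}. R * r * (R * q t))"
      proof (rule sum_norm_le)
        fix j :: 'n assume "j \<in> UNIV - {lst}"
        then show "cmod (Im (\<gamma> t $ j) * D t $ j) \<le> R * r * (R * q t)"
          using gj[OF t, of j] Dj[OF t, of j] abs_Im_le_cmod[of "\<gamma> t $ j"] R
          by (auto simp: norm_mult intro!: mult_mono intro: order_trans)
      qed
      also have "\<dots> = real (card (UNIV - {lst::'n})) * (R * r * (R * q t))"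
        by simp
      also have "\<dots> \<le> real CARD('n) * (R * r * (R * q t))"
        using R L L0 q(2)[OF t] by (intro mult_right_mono) (auto intro: card_mono)
      also have "\<dots> = real CARD('n) * (R * r * R) * q t"
        by (simp only: mult.assoc)
      finally have S: "cmod (\<Sum>j\<in>UNIV - {lst}. Im (\<gamma> t $ j) * D t $ j) \<le> real CARD('n) * (R * r * R) * q t" .
      have "cmod (D t $ lst) \<le> cmod (D t $ lst - 2 * (\<Sum>j\<in>UNIV - {lst}. Im (\<gamma> t $ j) * D t $ j))
          + cmod (2 * (\<Sum>j\<in>UNIV - {lst}. Im (\<gamma> t $ j) * D t $ j))"
        by (subst add.commute) (rule norm_triangle_sub[of "D t $ lst" "2 * (\<Sum>j\<in>UNIV - {lst}. Im (\<gamma> t $ j) * D t $ j)"])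
      also have "\<dots> \<le> 2 * rho (\<gamma> t) * q t + 2 * (real CARD('n) * (R * r * R) * q t)"
        using bergman_form_bounds(2)[OF curve_in_TB_D[OF cu t], of "D t"] S
        by (intro add_mono) (auto simp: q_def norm_mult)
      also have "\<dots> \<le> 2 * E * q t + 2 * (real CARD('n) * (R * r * R) * q t)"
        using rho_le[OF t] q(2)[OF t] by (intro add_right_mono mult_right_mono) auto
      also have "\<dots> = c * q t" by (simp add: c_def algebra_simps)
      finally show ?thesis .
    qed
    have c0: "0 \<le> c" unfolding c_def using E R L L0 by simp
    have "norm (\<gamma> 1 $ lst - \<gamma> 0 $ lst) \<le> c * integral {0..1} q"
      by (rule norm_diff_le_integral[where g' = "\<lambda>t. D t $ lst"])
         (use q c0 Dn in \<open>auto intro!: has_vector_derivative_vec_nth D\<close>)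
    also have "\<dots> \<le> c * r" using L c0 by (intro mult_left_mono) (auto simp: L_def)
    finally have "cmod (w $ lst - \<i>) \<le> c * r" by (simp add: g01 base_point_def)
    then have "cmod (w $ lst) \<le> 1 + c * r"
      using norm_triangle_ineq2[of "w $ lst" \<i>] by simp
    moreover have "(\<Sum>j\<in>UNIV - {lst}. cmod (w $ j)) \<le> (\<Sum>j\<in>UNIV - {lst::'n}. R * r)"
      using gj[of 1] g01 by (intro sum_mono) auto
    moreover have "\<dots> \<le> real CARD('n) * (R * r)"
      using R L L0 by (simp add: mult_right_mono)
    ultimately have "norm w \<le> M"
      using norm_vec_le_sum[of w] unfolding sum_split_lst M_def by linarith
    then show ?thesis using rho_le(1)[of 1] g01 by simp
  qed
  then show ?thesis using E by (intro that[of "1 / E" M]) auto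
qed

section \<open>Mean oscillation under automorphisms\<close>

lemma borel_measurable_rho [measurable]: "rho \<in> borel_measurable borel"
  by (intro borel_measurable_continuous_onI continuous_intros)

lemma sets_vol: "sets (vol \<alpha>) = sets (lebesgue_on TB)"
  by (simp add: vol_def)

lemma TB_borel [measurable]: "TB \<in> sets borel"
  by (rule borel_open[OF open_TB])

lemma TB_lebesgue: "TB \<in> sets lebesgue"
  by (rule sets_completionI_sets) simp

lemma borel_measurable_lebesgue_on_TB:
  "f \<in> borel_measurable borel \<Longrightarrow> f \<in> borel_measurable (lebesgue_on TB)"
  by (intro measurable_restrict_space1 measurable_completion) simp

lemma sets_vol_borel: "S \<in> sets borel \<Longrightarrow> S \<subseteq> TB \<Longrightarrow> S \<in> sets (vol \<alpha>)"
  using TB_lebesgue by (auto simp: sets_vol sets_restrict_space_iff)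

text \<open>The weighted measure lives on the Lebesgue completion, whereas image measures under
  \<open>TB_aut\<close> are computed for Borel sets. For Borel integrands the passage to
  \<open>lborel\<close> changes nothing.\<close>

lemma nn_integral_vol:
  assumes [measurable]: "h \<in> borel_measurable borel" "S \<in> sets borel" and "S \<subseteq> TB"
  shows "(\<integral>\<^sup>+w\<in>S. h w \<partial>vol \<alpha>) = (\<integral>\<^sup>+w\<in>S. ennreal (rho w powr \<alpha>) * h w \<partial>lborel)"
proof -
  have "(\<integral>\<^sup>+w\<in>S. h w \<partial>vol \<alpha>) = (\<integral>\<^sup>+w. ennreal (rho w powr \<alpha>) * (h w * indicator S w) \<partial>lebesgue_on TB)"
    unfolding vol_def by (intro nn_integral_density borel_measurable_lebesgue_on_TB) measurable
  also have "\<dots> = (\<integral>\<^sup>+w. ennreal (rho w powr \<alpha>) * (h w * indicator S w) * indicator TB w \<partial>lebesgue)"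
    using TB_lebesgue by (simp add: nn_integral_restrict_space)
  also have "\<dots> = (\<integral>\<^sup>+w. ennreal (rho w powr \<alpha>) * (h w * indicator S w) * indicator TB w \<partial>lborel)"
    by (intro nn_integral_completion) measurable
  also have "\<dots> = (\<integral>\<^sup>+w\<in>S. ennreal (rho w powr \<alpha>) * h w \<partial>lborel)"
    using assms(3) by (intro nn_integral_cong) (auto simp: indicator_def)
  finally show ?thesis .
qed

lemma set_lebesgue_integral_vol:
  fixes g :: "complex^'n::{finite,linorder} \<Rightarrow> 'b::{banach,second_countable_topology}"
  assumes S: "S \<in> sets borel" "S \<subseteq> TB" and g: "continuous_on S g"
  shows "(LINT w:S|vol \<alpha>. g w) = (\<integral>w. indicator S w *\<^sub>R (rho w powr \<alpha> *\<^sub>R g w) \<partial>lborel)"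
proof -
  have [measurable]: "S \<in> sets borel" "(\<lambda>w. indicator S w *\<^sub>R g w) \<in> borel_measurable borel"
    using S g by (auto intro: borel_measurable_continuous_on_indicator)
  have "(LINT w:S|vol \<alpha>. g w) = (\<integral>w. rho w powr \<alpha> *\<^sub>R (indicator S w *\<^sub>R g w) \<partial>lebesgue_on TB)"
    unfolding set_lebesgue_integral_def vol_def
    by (intro integral_density borel_measurable_lebesgue_on_TB AE_I2 powr_ge_zero) measurable
  also have "\<dots> = (\<integral>w. indicator TB w *\<^sub>R (rho w powr \<alpha> *\<^sub>R (indicator S w *\<^sub>R g w)) \<partial>lebesgue)"
    using TB_lebesgue by (simp add: integral_restrict_space)
  also have "\<dots> = (\<integral>w. indicator TB w *\<^sub>R (rho w powr \<alpha> *\<^sub>R (indicator S w *\<^sub>R g w)) \<partial>lborel)"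
    by (intro integral_completion) measurable
  also have "\<dots> = (\<integral>w. indicator S w *\<^sub>R (rho w powr \<alpha> *\<^sub>R g w) \<partial>lborel)"
    using S(2) by (intro Bochner_Integration.integral_cong) (auto simp: indicator_def)
  finally show ?thesis .
qed

text \<open>The exponent \<alpha> may have either sign, so the bounds come from continuity on a
  compact set and not from monotonicity of the power.\<close>

lemma compact_rho_bounds:
  assumes "compact S" "S \<subseteq> TB"
  obtains a b where "0 < a" "\<And>w. w \<in> S \<Longrightarrow> a \<le> rho w powr \<alpha>" "\<And>w. w \<in> S \<Longrightarrow> rho w powr \<alpha> \<le> b"
proof (cases "S = {}")
  case True
  then show ?thesis by (intro that[of 1]) auto
next
  case False
  have c: "continuous_on S (\<lambda>w. rho w powr \<alpha>)"
    using assms(2) by (intro continuous_intros) (force simp: TB_iff_rho_pos)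
  obtain x where x: "x \<in> S" "\<And>w. w \<in> S \<Longrightarrow> rho x powr \<alpha> \<le> rho w powr \<alpha>"
    using continuous_attains_inf[OF assms(1) False c] by auto
  obtain y where y: "y \<in> S" "\<And>w. w \<in> S \<Longrightarrow> rho w powr \<alpha> \<le> rho y powr \<alpha>"
    using continuous_attains_sup[OF assms(1) False c] by auto
  have "0 < rho x" using assms(2) x(1) by (auto simp: TB_iff_rho_pos)
  then show ?thesis using x y by (intro that[of "rho x powr \<alpha>" "rho y powr \<alpha>"]) auto
qed

lemma emeasure_vol:
  assumes "S \<in> sets borel" "S \<subseteq> TB"
  shows "emeasure (vol \<alpha>) S = (\<integral>\<^sup>+w\<in>S. ennreal (rho w powr \<alpha>) \<partial>lborel)"
  using nn_integral_vol[of "\<lambda>_. 1" S \<alpha>] assms sets_vol_borel[OF assms] by (simp add: nn_integral_indicator)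

lemma emeasure_vol_compact:
  assumes "compact S" "S \<subseteq> TB"
  shows "emeasure (vol \<alpha>) S < \<infinity>"
proof -
  obtain a b where b: "\<And>w. w \<in> S \<Longrightarrow> rho w powr \<alpha> \<le> b"
    using compact_rho_bounds[OF assms, where \<alpha> = \<alpha>] by metis
  have [measurable]: "S \<in> sets borel" using assms(1) by (simp add: borel_compact)
  have "emeasure (vol \<alpha>) S \<le> (\<integral>\<^sup>+w\<in>S. ennreal b \<partial>lborel)"
    unfolding emeasure_vol[OF \<open>S \<in> sets borel\<close> assms(2)]
    using b by (intro nn_integral_mono) (auto simp: indicator_def intro: ennreal_leI)
  also have "\<dots> = ennreal b * emeasure lborel S"
    by (simp add: nn_integral_cmult)
  also have "\<dots> < \<infinity>"
    using emeasure_compact_finite[OF assms(1)] by (simp add: ennreal_mult_less_top)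
  finally show ?thesis .
qed

lemma continuous_on_norm_powr:
  fixes f :: "'a::topological_space \<Rightarrow> 'b::real_normed_vector"
  shows "continuous_on S f \<Longrightarrow> 0 < p \<Longrightarrow> continuous_on S (\<lambda>x. norm (f x) powr p)"
  by (intro continuous_on_powr' continuous_intros) auto

lemma holo_continuous_on: "f \<in> holo \<Longrightarrow> continuous_on TB f"
  unfolding holo_def
  by (intro continuous_at_imp_continuous_on) (auto dest!: bspec intro: has_derivative_continuous)

lemma holo_in_Lp_loc:
  assumes "f \<in> holo" "1 \<le> p"
  shows "f \<in> Lp_loc p \<alpha>"
proof -
  note c = holo_continuous_on[OF assms(1)]
  have "(\<integral>\<^sup>+ z\<in>S. ennreal (norm (f z) powr p) \<partial>vol \<alpha>) < \<infinity>" if S: "compact S" "S \<subseteq> TB" for S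
  proof -
    have "compact ((\<lambda>z. norm (f z) powr p) ` S)"
      using c S assms(2) by (intro compact_continuous_image continuous_on_norm_powr) (auto intro: continuous_on_subset)
    then obtain B where B: "\<And>z. z \<in> S \<Longrightarrow> norm (f z) powr p \<le> B"
      by (meson bounded_imp_bdd_above bdd_above_def compact_imp_bounded image_eqI)
    have "S \<in> sets (vol \<alpha>)" using S by (intro sets_vol_borel) (auto simp: borel_compact)
    have "(\<integral>\<^sup>+ z\<in>S. ennreal (norm (f z) powr p) \<partial>vol \<alpha>) \<le> (\<integral>\<^sup>+ z\<in>S. ennreal B \<partial>vol \<alpha>)"
      using B by (intro nn_integral_mono) (auto simp: indicator_def intro: ennreal_leI)
    also have "\<dots> = ennreal B * emeasure (vol \<alpha>) S"
      using \<open>S \<in> sets (vol \<alpha>)\<close> by (simp add: nn_integral_cmult)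
    also have "\<dots> < \<infinity>"
      using emeasure_vol_compact[OF S] by (simp add: ennreal_mult_less_top)
    finally show ?thesis .
  qed
  moreover have "f \<in> borel_measurable (lebesgue_on TB)"
    using c TB_lebesgue by (rule continuous_imp_measurable_on_sets_lebesgue)
  ultimately show ?thesis by (simp add: Lp_loc_def)
qed

text \<open>A continuous function on an open Bergman ball could be unbounded. Continuity on a
  compact \<open>K\<close> around the ball bounds it, on a set of finite measure.\<close>

lemma set_integrable_vol:
  fixes g :: "complex^'n::{finite,linorder} \<Rightarrow> 'b::{banach,second_countable_topology}"
  assumes "S \<in> sets borel" "S \<subseteq> K" "compact K" "K \<subseteq> TB" "continuous_on K g"
  shows "set_integrable (vol \<alpha>) S g"
proof -
  have "compact (g ` K)" using assms by (intro compact_continuous_image)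
  then obtain B where B: "\<And>w. w \<in> K \<Longrightarrow> norm (g w) \<le> B"
    by (metis bounded_iff compact_imp_bounded image_eqI)
  have S: "S \<in> sets (vol \<alpha>)" using assms by (intro sets_vol_borel) auto
  have K: "K \<in> sets (vol \<alpha>)" using assms by (intro sets_vol_borel) (auto simp: borel_compact)
  show ?thesis
    unfolding set_integrable_def
  proof (rule integrableI_bounded_set[where A = S and B = B])
    show "(\<lambda>w. indicator S w *\<^sub>R g w) \<in> borel_measurable (vol \<alpha>)"
      using assms unfolding vol_def
      by (auto intro!: borel_measurable_lebesgue_on_TB borel_measurable_continuous_on_indicator intro: continuous_on_subset)
    have "emeasure (vol \<alpha>) S \<le> emeasure (vol \<alpha>) K"
      using assms(2) K by (intro emeasure_mono)
    then show "emeasure (vol \<alpha>) S < \<infinity>"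
      using emeasure_vol_compact[OF assms(3,4), of \<alpha>] by (simp add: le_less_trans)
  qed (use S assms(2) B in auto)
qed

section \<open>Change of variables on Bergman balls\<close>

lemma bergman_ball_subset_TB: "bergman_ball \<alpha> z r \<subseteq> TB"
  by (auto simp: bergman_ball_def)

lemma TB_aut_lborel:
  fixes z :: "complex^'n::{finite,linorder}"
  assumes "z \<in> TB"
  obtains c :: real where "c > 0" "distr lborel borel (TB_aut z) = density lborel (\<lambda>_. ennreal c)"
proof (rule distr_lborel_affine[of "TB_aut z" "TB_aut (TB_inv z)"])
  show "TB_aut z (x + y) = TB_aut z x + TB_aut z y - TB_aut z 0" for x y
    using TB_aut_diff[of z "x + y" x] TB_aut_diff[of z y 0] by (simp add: algebra_simps)
qed (use assms in \<open>auto simp: TB_aut_left_inverse TB_aut_right_inverse intro!: continuous_intros that\<close>)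

text \<open>The constant \<open>c\<close> is the reciprocal of the real Jacobian of
  \<open>TB_aut z\<close>, and the weight contributes \<open>rho z powr \<alpha>\<close>. Only
  positivity of the total factor matters, since it cancels in every average.\<close>

lemma set_lebesgue_integral_bergman_ball:
  fixes g :: "complex^'n::{finite,linorder} \<Rightarrow> 'b::{banach,second_countable_topology}"
  assumes z: "z \<in> TB" and \<alpha>: "-1 < \<alpha>"
    and c: "c > 0" "distr lborel borel (TB_aut z) = density lborel (\<lambda>_. ennreal c)"
    and g: "continuous_on (bergman_ball \<alpha> z r) g"
  shows "(LINT w:bergman_ball \<alpha> z r|vol \<alpha>. g w)
    = (rho z powr \<alpha> / c) *\<^sub>R (LINT w:bergman_ball \<alpha> base_point r|vol \<alpha>. g (TB_aut z w))"
proof -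
  let ?B = "bergman_ball \<alpha> z r" and ?C = "bergman_ball \<alpha> base_point r :: (complex^'n::{finite,linorder}) set"
  have im: "?B = TB_aut z ` ?C" by (rule bergman_ball_eq_TB_aut_image[OF z \<alpha>])
  have B: "?B \<in> sets borel" "?B \<subseteq> TB" and B0: "?C \<in> sets borel" "?C \<subseteq> TB"
    using open_bergman_ball[OF z \<alpha>] open_bergman_ball[OF base_point_in_TB \<alpha>]
    by (auto dest: subsetD[OF bergman_ball_subset_TB] intro: borel_open)
  have TB_aut_m [measurable]: "TB_aut z \<in> borel_measurable borel"
    by (intro borel_measurable_continuous_onI continuous_intros)
  define h where "h w = indicator ?B w *\<^sub>R (rho w powr \<alpha> *\<^sub>R g w)" for w
  have h [measurable]: "h \<in> borel_measurable borel"
    unfolding h_def using B g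
    by (intro borel_measurable_continuous_on_indicator continuous_intros) (force simp: TB_iff_rho_pos)+
  have gphi: "continuous_on ?C (\<lambda>w. g (TB_aut z w))"
    using g im by (intro continuous_on_compose2[OF g] continuous_intros) auto
  have "c *\<^sub>R (\<integral>w. h w \<partial>lborel) = (\<integral>w. h w \<partial>density lborel (\<lambda>_. ennreal c))"
    using c(1) by (subst integral_density) auto
  also have "\<dots> = (\<integral>w. h (TB_aut z w) \<partial>lborel)"
    unfolding c(2)[symmetric] by (rule integral_distr) auto
  also have "\<dots> = (\<integral>w. rho z powr \<alpha> *\<^sub>R (indicator ?C w *\<^sub>R (rho w powr \<alpha> *\<^sub>R g (TB_aut z w))) \<partial>lborel)"
  proof (intro Bochner_Integration.integral_cong refl)
    fix w
    have "TB_aut z w \<in> ?B \<longleftrightarrow> w \<in> ?C"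
      unfolding im using inj_TB_aut[OF z] by (simp add: inj_image_mem_iff)
    then show "h (TB_aut z w) = rho z powr \<alpha> *\<^sub>R (indicator ?C w *\<^sub>R (rho w powr \<alpha> *\<^sub>R g (TB_aut z w)))"
      using B0 z by (auto simp: h_def indicator_def rho_TB_aut TB_iff_rho_pos powr_mult)
  qed
  also have "\<dots> = rho z powr \<alpha> *\<^sub>R (LINT w:?C|vol \<alpha>. g (TB_aut z w))"
    unfolding set_lebesgue_integral_vol[OF B0 gphi] by (rule integral_scaleR_right)
  finally have "c *\<^sub>R (LINT w:?B|vol \<alpha>. g w) = rho z powr \<alpha> *\<^sub>R (LINT w:?C|vol \<alpha>. g (TB_aut z w))"
    unfolding set_lebesgue_integral_vol[OF B g] h_def .
  then have "(1 / c) *\<^sub>R (c *\<^sub>R (LINT w:?B|vol \<alpha>. g w)) = (1 / c) *\<^sub>R (rho z powr \<alpha> *\<^sub>R (LINT w:?C|vol \<alpha>. g (TB_aut z w)))"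
    by simp
  then show ?thesis using c(1) by simp
qed

lemma measure_eq_set_integral_1: "S \<in> sets M \<Longrightarrow> measure M S = (LINT w:S|M. (1::real))"
  unfolding set_lebesgue_integral_def using sets.sets_into_space[of S M] by (simp add: Int_absorb2)

text \<open>Numerators and the measure of the ball acquire the same factor \<open>k\<close>, so
  means over the ball at \<open>z\<close> are means over the ball at the base point.\<close>

lemma
  fixes f :: "complex^'n::{finite,linorder} \<Rightarrow> complex"
  assumes z: "z \<in> TB" and \<alpha>: "-1 < \<alpha>" and f: "continuous_on TB f" and p: "1 \<le> p"
  shows avg_TB_aut: "avg \<alpha> r f z = avg \<alpha> r (\<lambda>w. f (TB_aut z w)) base_point"
    and MO_TB_aut: "MO p \<alpha> r f z = MO p \<alpha> r (\<lambda>w. f (TB_aut z w)) base_point"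
proof -
  let ?B = "bergman_ball \<alpha> z r" and ?C = "bergman_ball \<alpha> base_point r :: (complex^'n::{finite,linorder}) set"
  obtain c where c: "c > 0" "distr lborel borel (TB_aut z) = density lborel (\<lambda>_. ennreal c)"
    using TB_aut_lborel[OF z] by metis
  define k where "k = rho z powr \<alpha> / c"
  have k: "k > 0" using c z by (simp add: k_def TB_iff_rho_pos)
  have B: "?B \<in> sets (vol \<alpha>)" "?C \<in> sets (vol \<alpha>)" and sub: "?B \<subseteq> TB"
    using open_bergman_ball[OF z \<alpha>] open_bergman_ball[OF base_point_in_TB \<alpha>]
    by (auto dest: subsetD[OF bergman_ball_subset_TB] intro!: sets_vol_borel borel_open)
  note int = set_lebesgue_integral_bergman_ball[OF z \<alpha> c, folded k_def]
  have m: "measure (vol \<alpha>) ?B = k * measure (vol \<alpha>) ?C"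
    unfolding measure_eq_set_integral_1[OF B(1)] measure_eq_set_integral_1[OF B(2)]
    using int[of r "\<lambda>_. 1 :: real"] by simp
  have fB: "continuous_on ?B f" using f sub by (rule continuous_on_subset)
  show a: "avg \<alpha> r f z = avg \<alpha> r (\<lambda>w. f (TB_aut z w)) base_point"
    unfolding avg_def m int[OF fB] using k by (simp add: scaleR_conv_of_real)
  have "continuous_on ?B (\<lambda>w. norm (f w - avg \<alpha> r f z) powr p)"
    using fB p by (intro continuous_on_norm_powr continuous_intros) auto
  then show "MO p \<alpha> r f z = MO p \<alpha> r (\<lambda>w. f (TB_aut z w)) base_point"
    unfolding MO_def m using k by (simp add: int a)
qed

text \<open>By compactness of \<open>K\<close>, \<open>g z\<close> converges to \<open>g z0\<close>
  uniformly on \<open>K\<close> as \<open>z\<close> tends to \<open>z0\<close>, and \<open>S\<close>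
  has finite measure.\<close>

lemma continuous_on_set_integral_vol:
  fixes g :: "'a::topological_space \<Rightarrow> complex^'n::{finite,linorder} \<Rightarrow> 'b::{banach,second_countable_topology}"
  assumes S: "S \<in> sets borel" "S \<subseteq> K" and K: "compact K" "K \<subseteq> TB"
    and g: "continuous_on (U \<times> K) (\<lambda>(z, w). g z w)"
  shows "continuous_on U (\<lambda>z. LINT w:S|vol \<alpha>. g z w)"
  unfolding continuous_on_def
proof (intro ballI tendstoI)
  fix z0 and e :: real assume z0: "z0 \<in> U" and e: "0 < e"
  define V where "V = measure (vol \<alpha> :: (complex^'n::{finite,linorder}) measure) S"
  \<comment> \<open>\<open>V + 1\<close> allows for a null set \<open>S\<close> and makes the final
    bound strictly smaller than \<open>e\<close>.\<close>
  define e' where "e' = e / (V + 1)"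
  have V0: "0 \<le> V" by (simp add: V_def)
  then have e': "e' > 0" using e by (simp add: e'_def)
  have Sv: "S \<in> sets (vol \<alpha>)" using S K by (intro sets_vol_borel) auto
  have int: "set_integrable (vol \<alpha>) S (g z)" if "z \<in> U" for z
    by (rule set_integrable_vol[OF S K], rule continuous_on_compose2[OF g, of K "\<lambda>w. (z, w)", simplified])
       (use that in \<open>auto intro!: continuous_intros\<close>)
  obtain X0 where X0: "z0 \<in> X0" "open X0"
    and le: "\<And>z w. z \<in> X0 \<Longrightarrow> z \<in> U \<Longrightarrow> w \<in> K \<Longrightarrow> dist (g z w) (g z0 w) \<le> e'"
    using continuous_on_prod_compactE[OF g K(1) z0 e'] by (metis IntI case_prod_conv)
  have "dist (LINT w:S|vol \<alpha>. g z w) (LINT w:S|vol \<alpha>. g z0 w) < e" if z: "z \<in> X0" "z \<in> U" for z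
  proof -
    have int': "set_integrable (vol \<alpha>) S (\<lambda>w. g z w - g z0 w)"
      using int[OF z(2)] int[OF z0] by (rule set_integral_diff)
    have "dist (LINT w:S|vol \<alpha>. g z w) (LINT w:S|vol \<alpha>. g z0 w) = norm (LINT w:S|vol \<alpha>. g z w - g z0 w)"
      using int[OF z(2)] int[OF z0] by (simp add: dist_norm set_integral_diff)
    also have "\<dots> \<le> (LINT w:S|vol \<alpha>. norm (g z w - g z0 w))"
      using int' by (rule set_integral_norm_bound)
    also have "\<dots> \<le> (LINT w:S|vol \<alpha>. e')"
    proof (rule set_integral_mono)
      show "set_integrable (vol \<alpha>) S (\<lambda>w. norm (g z w - g z0 w))" using int' by (rule set_integrable_norm)
      show "set_integrable (vol \<alpha>) S (\<lambda>w. e')" by (rule set_integrable_vol[OF S K]) simp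
      show "norm (g z w - g z0 w) \<le> e'" if "w \<in> S" for w
        using le[OF z, of w] that S by (auto simp: dist_norm)
    qed
    also have "\<dots> = e' * V"
      using sets.sets_into_space[OF Sv] by (simp add: V_def set_lebesgue_integral_def Int_absorb2 mult.commute)
    also have "\<dots> < e"
      using e V0 by (simp add: e'_def field_simps)
    finally show ?thesis .
  qed
  then show "\<forall>\<^sub>F z in at z0 within U. dist (LINT w:S|vol \<alpha>. g z w) (LINT w:S|vol \<alpha>. g z0 w) < e"
    unfolding eventually_at_topological using X0 by blast
qed

lemma bergman_ball_base_point_compact:
  assumes "-1 < \<alpha>"
  obtains K where "compact K" "convex K" "K \<subseteq> TB"
    "bergman_ball \<alpha> (base_point :: complex^'n::{finite,linorder}) r \<subseteq> K"
proof -
  obtain e M where eM: "e > 0" "bergman_ball \<alpha> (base_point :: complex^'n::{finite,linorder}) r \<subseteq> {w. e \<le> rho w} \<inter> cball 0 M"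
    using bergman_ball_base_point_bounded[OF assms] by metis
  have "closed {w :: complex^'n::{finite,linorder}. e \<le> rho w}" by (intro closed_Collect_le continuous_intros)
  then show ?thesis
    using eM by (intro that[of "{w. e \<le> rho w} \<inter> cball 0 M"])
      (auto simp: TB_iff_rho_pos intro: convex_Int convex_rho_ge closed_Int_compact)
qed

text \<open>In the definition the domain of integration moves with \<open>z\<close>. Transport to
  the base point fixes the ball and moves the dependence on \<open>z\<close> into the integrand,
  which is jointly continuous. Membership in \<open>C0\<close> asks for this continuity.\<close>

lemma continuous_on_MO:
  fixes f :: "complex^'n::{finite,linorder} \<Rightarrow> complex"
  assumes \<alpha>: "-1 < \<alpha>" and f: "continuous_on TB f" and p: "1 \<le> p"
  shows "continuous_on TB (MO p \<alpha> r f)"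
proof -
  let ?C = "bergman_ball \<alpha> base_point r :: (complex^'n::{finite,linorder}) set"
  obtain K where K: "compact K" "convex K" "K \<subseteq> TB" "?C \<subseteq> K"
    using bergman_ball_base_point_compact[OF \<alpha>] by metis
  have C: "?C \<in> sets borel" by (intro borel_open open_bergman_ball base_point_in_TB \<alpha>)
  define a where "a z = avg \<alpha> r (\<lambda>w. f (TB_aut z w)) base_point" for z
  have f': "continuous_on (TB \<times> K) (\<lambda>x. f (TB_aut (fst x) (snd x)))"
    using K(3) by (intro continuous_on_compose2[OF f] continuous_intros) (auto intro!: TB_aut_in_TB)
  have a: "continuous_on TB a"
    unfolding a_def avg_def divide_inverse
    by (intro continuous_intros continuous_on_set_integral_vol[OF C K(4,1,3)])
       (use f' in \<open>simp add: split_beta\<close>)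
  have "continuous_on (TB \<times> K) (\<lambda>x. norm (f (TB_aut (fst x) (snd x)) - a (fst x)) powr p)"
    using p f' by (intro continuous_on_norm_powr continuous_intros continuous_on_compose2[OF a]) auto
  then have "continuous_on TB (\<lambda>z. LINT w:?C|vol \<alpha>. norm (f (TB_aut z w) - a z) powr p)"
    by (intro continuous_on_set_integral_vol[OF C K(4,1,3)]) (simp add: split_beta)
  then have "continuous_on TB (\<lambda>z. ((LINT w:?C|vol \<alpha>. norm (f (TB_aut z w) - a z) powr p) / measure (vol \<alpha>) ?C) powr (1 / p))"
    using p unfolding divide_inverse[of _ "measure _ _"]
    by (intro continuous_on_powr' continuous_intros) (auto simp: set_lebesgue_integral_def intro!: mult_nonneg_nonneg integral_nonneg)
  then show ?thesis
    by (rule continuous_on_cong[THEN iffD1, rotated -1])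
       (simp_all add: MO_TB_aut[OF _ \<alpha> f p] MO_def[of _ _ _ _ base_point] a_def)
qed

lemma MO_nonneg: "0 \<le> MO p \<alpha> r f z"
  by (simp add: MO_def)

section \<open>Invariant gradient and boundary behaviour\<close>

text \<open>Since \<open>axis j \<i>\<close> is \<i> times \<open>axis j 1\<close>, complex
  linearity makes the two halves of the Wirtinger derivative equal, and \<open>dz\<close> becomes
  the value of the derivative on a coordinate vector.\<close>

lemma holoE:
  assumes "f \<in> holo" "z \<in> TB"
  obtains f' where "(f has_derivative f') (at z)" "\<And>c v. f' (c *s v) = c * f' v" "\<And>j. dz j f z = f' (axis j 1)"
proof -
  obtain f' where f': "(f has_derivative f') (at z)" "\<And>c v. f' (c *s v) = c * f' v"
    using assms unfolding holo_def by blast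
  have dd: "dir_deriv f v z = f' v" for v
  proof (rule dir_derivI)
    have "((\<lambda>t::real. z + t *\<^sub>R v) has_derivative (\<lambda>t. t *\<^sub>R v)) (at 0)"
      by (auto intro!: derivative_eq_intros)
    moreover have "(f has_derivative f') (at (z + 0 *\<^sub>R v))" using f'(1) by simp
    ultimately have "((\<lambda>t. f (z + t *\<^sub>R v)) has_derivative (\<lambda>t. f' (t *\<^sub>R v))) (at 0)"
      by (rule has_derivative_compose)
    then show "((\<lambda>t. f (z + t *\<^sub>R v)) has_vector_derivative f' v) (at 0)"
      using linear_cmul[OF has_derivative_linear[OF f'(1)]] by (simp add: has_vector_derivative_def)
  qed
  have "axis j \<i> = \<i> *s axis j 1" for j :: 'a
    by (simp add: axis_def vec_eq_iff)
  then have "dz j f z = f' (axis j 1)" for j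
    by (simp add: dz_def dd f'(2))
  then show ?thesis using that f' by blast
qed

lemma holo_comp_TB_aut:
  assumes "f \<in> holo" "z \<in> TB"
  shows "(\<lambda>w. f (TB_aut z w)) \<in> holo"
  unfolding holo_def mem_Collect_eq
proof (intro ballI)
  fix w :: "complex^'a::{finite,linorder}" assume "w \<in> TB"
  then obtain f' where f': "(f has_derivative f') (at (TB_aut z w))" "\<And>c v. f' (c *s v) = c * f' v"
    using holoE[OF assms(1) TB_aut_in_TB[OF assms(2)]] by metis
  have "((\<lambda>w. f (TB_aut z w)) has_derivative (\<lambda>v. f' (TB_aut_lin z v))) (at w)"
    using TB_aut_has_derivative f'(1) by (rule has_derivative_compose)
  then show "\<exists>F'. ((\<lambda>w. f (TB_aut z w)) has_derivative F') (at w) \<and> (\<forall>c v. F' (c *s v) = c * F' v)"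
    using f'(2) by (auto simp: TB_aut_lin_cmult)
qed

lemma TB_aut_lin_axis:
  "TB_aut_lin z (axis lst 1) = of_real (rho z) *s axis lst 1"
  "j \<noteq> lst \<Longrightarrow> TB_aut_lin z (axis j 1) = of_real (sqrt (rho z)) *s axis j 1 + of_real (2 * sqrt (rho z) * Im (z $ j)) *s axis lst 1"
proof -
  have "(\<Sum>k\<in>UNIV - {lst}. Im (z $ k) * axis lst (1::complex) $ k) = 0"
    by (intro sum.neutral) (auto simp: axis_def)
  then show "TB_aut_lin z (axis lst 1) = of_real (rho z) *s axis lst 1"
    by (simp add: vec_eq_iff TB_aut_lin_def axis_def)
  assume j: "j \<noteq> lst"
  then have "(\<Sum>k\<in>UNIV - {lst}. Im (z $ k) * axis j (1::complex) $ k) = Im (z $ j)"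
    by (simp add: axis_def sum.delta' if_distrib[of "\<lambda>x. _ * x"] cong: if_cong)
  then show "TB_aut_lin z (axis j 1) = of_real (sqrt (rho z)) *s axis j 1 + of_real (2 * sqrt (rho z) * Im (z $ j)) *s axis lst 1"
    using j by (auto simp: vec_eq_iff TB_aut_lin_def) (auto simp: axis_def)
qed

text \<open>The fields \<open>rho\<close> d/dz_n and sqrt(\<open>rho\<close>) (d/dz_j + 2 y_j
  d/dz_n) form a frame that the maps \<open>TB_aut z\<close> preserve, and the squared gradient is a
  combination of the squares of \<open>f\<close> differentiated along it, with constant
  coefficients.\<close>

lemma inv_grad_TB_aut:
  fixes z :: "complex^'n::{finite,linorder}"
  assumes f: "f \<in> holo" and z: "z \<in> TB" and w: "w \<in> TB"
  shows "inv_grad (\<lambda>w. f (TB_aut z w)) w = inv_grad f (TB_aut z w)"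
proof -
  define s where "s = sqrt (rho z)"
  have s: "rho z = s * s" "s > 0" using z by (simp_all add: s_def TB_iff_rho_pos)
  obtain f' where f': "(f has_derivative f') (at (TB_aut z w))" "\<And>c v. f' (c *s v) = c * f' v"
      "\<And>j. dz j f (TB_aut z w) = f' (axis j 1)"
    using holoE[OF f TB_aut_in_TB[OF z w]] by metis
  obtain F' where F': "((\<lambda>w. f (TB_aut z w)) has_derivative F') (at w)"
      "\<And>j. dz j (\<lambda>w. f (TB_aut z w)) w = F' (axis j 1)"
    using holoE[OF holo_comp_TB_aut[OF f z] w] by metis
  have "((\<lambda>w. f (TB_aut z w)) has_derivative (\<lambda>v. f' (TB_aut_lin z v))) (at w)"
    using TB_aut_has_derivative f'(1) by (rule has_derivative_compose)
  then have F'_eq: "F' = (\<lambda>v. f' (TB_aut_lin z v))" using F'(1) by (rule has_derivative_unique[rotated])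
  define d where "d j = dz j f (TB_aut z w)" for j
  have dl: "dz lst (\<lambda>w. f (TB_aut z w)) w = of_real (s * s) * d lst"
    unfolding F'(2) F'_eq TB_aut_lin_axis f'(2) by (simp add: d_def f'(3) s(1))
  have dj: "dz j (\<lambda>w. f (TB_aut z w)) w = of_real s * (d j + 2 * of_real (Im (z $ j)) * d lst)" if "j \<noteq> lst" for j
    unfolding F'(2) F'_eq TB_aut_lin_axis(2)[OF that] linear_add[OF has_derivative_linear[OF f'(1)]] f'(2)
    by (simp add: d_def f'(3) s_def[symmetric] algebra_simps)
  have "(\<Sum>j\<in>UNIV - {lst}. (cmod (dz j (\<lambda>w. f (TB_aut z w)) w + 2 * of_real (Im (w $ j)) * dz lst (\<lambda>w. f (TB_aut z w)) w))\<^sup>2)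
    = (\<Sum>j\<in>UNIV - {lst}. s * s * (cmod (d j + 2 * of_real (Im (TB_aut z w $ j)) * d lst))\<^sup>2)"
  proof (intro sum.cong refl)
    fix j :: 'n assume "j \<in> UNIV - {lst}"
    then have j: "j \<noteq> lst" by simp
    have "Im (TB_aut z w $ j) = s * Im (w $ j) + Im (z $ j)"
      using j by (simp add: TB_aut_def TB_aut_lin_def s_def)
    then have "dz j (\<lambda>w. f (TB_aut z w)) w + 2 * of_real (Im (w $ j)) * dz lst (\<lambda>w. f (TB_aut z w)) w
      = of_real s * (d j + 2 * of_real (Im (TB_aut z w $ j)) * d lst)"
      unfolding dl dj[OF j] by (simp add: algebra_simps)
    then show "(cmod (dz j (\<lambda>w. f (TB_aut z w)) w + 2 * of_real (Im (w $ j)) * dz lst (\<lambda>w. f (TB_aut z w)) w))\<^sup>2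
      = s * s * (cmod (d j + 2 * of_real (Im (TB_aut z w $ j)) * d lst))\<^sup>2"
      using s(2) by (simp add: norm_mult power_mult_distrib power2_eq_square)
  qed
  then have sums: "(\<Sum>j\<in>UNIV - {lst}. (cmod (dz j (\<lambda>w. f (TB_aut z w)) w + 2 * of_real (Im (w $ j)) * dz lst (\<lambda>w. f (TB_aut z w)) w))\<^sup>2)
    = s * s * (\<Sum>j\<in>UNIV - {lst}. (cmod (d j + 2 * of_real (Im (TB_aut z w $ j)) * d lst))\<^sup>2)"
    by (simp only: sum_distrib_left)
  have nl: "cmod (dz lst (\<lambda>w. f (TB_aut z w)) w) = s * s * cmod (d lst)"
    unfolding dl norm_mult norm_of_real by simp
  show ?thesis
    unfolding inv_grad_def sums nl rho_TB_aut[OF z] s(1) d_def[symmetric]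
    by (rule arg_cong[of _ _ sqrt]) (simp only: power2_eq_square algebra_simps)
qed

text \<open>Keeping one summand of the gradient controls the last derivative first; the triangle
  inequality then removes the shear from the others. On compact sets this compares the invariant
  with the Euclidean gradient.\<close>

lemma dz_le_inv_grad:
  assumes "z \<in> TB"
  shows "cmod (dz lst f z) \<le> inv_grad f z / rho z"
    and "j \<noteq> lst \<Longrightarrow> cmod (dz j f z) \<le> inv_grad f z / sqrt (rho z) + 2 * \<bar>Im (z $ j)\<bar> * (inv_grad f z / rho z)"
proof -
  have r: "rho z > 0" using assms by (simp add: TB_iff_rho_pos)
  let ?T = "\<lambda>j. (cmod (dz j f z + 2 * of_real (Im (z $ j)) * dz lst f z))\<^sup>2"
  have S0: "0 \<le> sum ?T (UNIV - {lst})" by (intro sum_nonneg) auto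
  have sq: "(inv_grad f z)\<^sup>2 = 8 * (rho z)\<^sup>2 * (cmod (dz lst f z))\<^sup>2 + 4 * rho z * sum ?T (UNIV - {lst})"
    unfolding inv_grad_def using r S0
    by (subst real_sqrt_pow2) (auto intro!: mult_nonneg_nonneg add_nonneg_nonneg simp: power2_eq_square algebra_simps)
  have i0: "0 \<le> inv_grad f z" unfolding inv_grad_def using r S0 by auto
  have "(rho z * cmod (dz lst f z))\<^sup>2 \<le> (inv_grad f z)\<^sup>2"
    unfolding sq power_mult_distrib using r S0 by (intro add_increasing2) (auto intro!: mult_right_mono)
  then have "rho z * cmod (dz lst f z) \<le> inv_grad f z" using i0 by (rule power2_le_imp_le)
  then show l: "cmod (dz lst f z) \<le> inv_grad f z / rho z" using r by (simp add: field_simps)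
  show "cmod (dz j f z) \<le> inv_grad f z / sqrt (rho z) + 2 * \<bar>Im (z $ j)\<bar> * (inv_grad f z / rho z)" if j: "j \<noteq> lst"
  proof -
    let ?t = "dz j f z + 2 * of_real (Im (z $ j)) * dz lst f z"
    have "?T j \<le> sum ?T (UNIV - {lst})" using j by (intro member_le_sum) auto
    then have "4 * rho z * ?T j \<le> 4 * rho z * sum ?T (UNIV - {lst})" using r by simp
    moreover have "rho z * ?T j \<le> 4 * rho z * ?T j" using r by (intro mult_right_mono) auto
    moreover have "0 \<le> 8 * (rho z)\<^sup>2 * (cmod (dz lst f z))\<^sup>2" by simp
    ultimately have "rho z * ?T j \<le> (inv_grad f z)\<^sup>2" unfolding sq by linarith
    then have "(sqrt (rho z) * cmod ?t)\<^sup>2 \<le> (inv_grad f z)\<^sup>2"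
      using r by (simp add: power_mult_distrib)
    then have "sqrt (rho z) * cmod ?t \<le> inv_grad f z" using i0 by (rule power2_le_imp_le)
    then have t: "cmod ?t \<le> inv_grad f z / sqrt (rho z)" using r by (simp add: field_simps)
    have "dz j f z = ?t - 2 * of_real (Im (z $ j)) * dz lst f z" by simp
    then have "cmod (dz j f z) \<le> cmod ?t + cmod (2 * of_real (Im (z $ j)) * dz lst f z)"
      by (metis norm_triangle_ineq4)
    also have "\<dots> \<le> inv_grad f z / sqrt (rho z) + 2 * \<bar>Im (z $ j)\<bar> * (inv_grad f z / rho z)"
    proof (rule add_mono[OF t])
      show "cmod (2 * of_real (Im (z $ j)) * dz lst f z) \<le> 2 * \<bar>Im (z $ j)\<bar> * (inv_grad f z / rho z)"
        unfolding norm_mult norm_of_real using l by (intro mult_mono) auto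
    qed
    finally show ?thesis .
  qed
qed

lemma inv_grad_nonneg: "z \<in> TB \<Longrightarrow> 0 \<le> inv_grad f z"
  unfolding inv_grad_def TB_iff_rho_pos by (auto intro!: add_nonneg_nonneg sum_nonneg mult_nonneg_nonneg)

text \<open>At the base point \<open>rho\<close> is 1 and the shear terms vanish. The n - 1
  remaining squares are counted generously as n.\<close>

lemma inv_grad_base_point_le:
  fixes f :: "complex^'n::{finite,linorder} \<Rightarrow> complex"
  assumes "\<And>j. cmod (dz j f base_point) \<le> B"
  shows "inv_grad f base_point \<le> sqrt (4 * (2 + real CARD('n))) * B"
proof -
  have B: "0 \<le> B" using assms[of lst] norm_ge_zero order_trans by blast
  have "(\<Sum>j\<in>UNIV - {lst}. (cmod (dz j f base_point + 2 * of_real (Im (base_point $ j)) * dz lst f base_point))\<^sup>2) \<le> (\<Sum>j\<in>UNIV - {lst::'n}. B\<^sup>2)"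
    using assms by (intro sum_mono) (auto simp: Im_base_point intro!: power_mono)
  also have "\<dots> \<le> real CARD('n) * B\<^sup>2"
    by (auto intro!: mult_right_mono card_mono simp del: card_Diff_insert)
  finally have "4 * rho base_point * (2 * rho base_point * (cmod (dz lst f base_point))\<^sup>2 +
     (\<Sum>j\<in>UNIV - {lst}. (cmod (dz j f base_point + 2 * of_real (Im (base_point $ j)) * dz lst f base_point))\<^sup>2))
     \<le> 4 * (2 + real CARD('n)) * B\<^sup>2"
    using power_mono[OF assms[of lst], of 2] by (simp add: algebra_simps)
  then have "inv_grad f base_point \<le> sqrt (4 * (2 + real CARD('n)) * B\<^sup>2)"
    unfolding inv_grad_def by (rule real_sqrt_le_mono)
  then show ?thesis using B by (simp add: real_sqrt_mult)
qed

text \<open>The points excluded here form the sets where \<open>e \<le> rho z\<close> and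
  \<open>norm z \<le> M\<close>, with \<open>e > 0\<close>. They are compact subsets of the domain,
  so a limit at the boundary is a limit outside compact sets.\<close>

lemma eventually_to_boundary:
  "eventually P (to_boundary :: (complex^'n::{finite,linorder}) filter) \<longleftrightarrow>
    (\<exists>e>0. \<exists>M. \<forall>z\<in>TB. rho z < e \<or> M < norm z \<longrightarrow> P z)"
proof
  assume "eventually P to_boundary"
  then have 1: "eventually P (filtercomap rho (at_right 0))" and 2: "eventually P (inf at_infinity (principal TB))"
    by (auto simp: to_boundary_def eventually_sup)
  obtain Q where Q: "eventually Q (at_right 0)" "\<And>z. Q (rho z) \<Longrightarrow> P z"
    using 1 by (auto simp: eventually_filtercomap)
  obtain e where e: "e > 0" "\<And>x. 0 < x \<Longrightarrow> x < e \<Longrightarrow> Q x"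
    using Q(1) by (auto simp: eventually_at_right_field)
  obtain M where "\<And>z. M \<le> norm z \<Longrightarrow> z \<in> TB \<Longrightarrow> P z"
    using 2 by (auto simp: eventually_inf_principal eventually_at_infinity)
  then show "\<exists>e>0. \<exists>M. \<forall>z\<in>TB. rho z < e \<or> M < norm z \<longrightarrow> P z"
    using e Q(2) by (intro exI[of _ e] conjI exI[of _ M]) (auto simp: TB_iff_rho_pos)
next
  assume "\<exists>e>0. \<exists>M. \<forall>z\<in>TB. rho z < e \<or> M < norm z \<longrightarrow> P z"
  then obtain e M where *: "e > 0" "\<And>z. z \<in> TB \<Longrightarrow> rho z < e \<or> M < norm z \<Longrightarrow> P z"
    by blast
  have "eventually (\<lambda>x. 0 < x \<and> x < e) (at_right 0)"
    using *(1) by (auto simp: eventually_at_right_field)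
  then have "eventually P (filtercomap rho (at_right 0))"
    unfolding eventually_filtercomap using *(2) by (auto simp: TB_iff_rho_pos)
  moreover have "eventually P (inf at_infinity (principal TB))"
    unfolding eventually_inf_principal eventually_at_infinity
    \<comment> \<open>The filter at infinity uses a weak inequality where the right-hand side has a
      strict one, hence the shift by 1.\<close>
    using *(2) by (intro exI[of _ "M + 1"]) auto
  ultimately show "eventually P to_boundary"
    by (simp add: to_boundary_def eventually_sup)
qed

lemma compact_core: "e > 0 \<Longrightarrow> compact ({w. e \<le> rho w} \<inter> cball 0 M)"
  by (intro closed_Int_compact closed_Collect_le continuous_intros) auto

text \<open>If \<open>TB_aut z u\<close> stays in a compact core \<open>C\<close> for some
  \<open>u\<close> in \<open>K\<close>, then \<open>z\<close> is the image of that point and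
  \<open>u\<close> under the continuous map of \<open>TB_aut_TB_aut_TB_inv\<close>. So
  \<open>z\<close> lies in a compact set depending only on \<open>C\<close> and \<open>K\<close>,
  which a \<open>z\<close> near the boundary avoids.\<close>

lemma eventually_to_boundary_TB_aut:
  fixes K :: "(complex^'n::{finite,linorder}) set"
  assumes K: "compact K" "K \<subseteq> TB" and P: "eventually P to_boundary"
  shows "eventually (\<lambda>z. \<forall>u\<in>K. P (TB_aut z u)) to_boundary"
proof -
  obtain e M where eM: "e > 0" "\<And>z. z \<in> TB \<Longrightarrow> rho z < e \<or> M < norm z \<Longrightarrow> P z"
    using P by (auto simp: eventually_to_boundary)
  define C :: "(complex^'n::{finite,linorder}) set" where "C = {w. e \<le> rho w} \<inter> cball 0 M"
  \<comment> \<open>The base point is added so that \<open>T\<close> is nonempty and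
    \<open>rho\<close> attains a minimum on it.\<close>
  define T where "T = insert base_point ((\<lambda>(w, u). TB_aut w (TB_inv u)) ` (C \<times> K))"
  have C: "compact C" "C \<subseteq> TB"
    using eM(1) compact_core[OF eM(1)] by (auto simp: C_def TB_iff_rho_pos)
  have "compact ((\<lambda>(w, u). TB_aut w (TB_inv u)) ` (C \<times> K))"
    unfolding split_beta using C K
    by (intro compact_continuous_image compact_Times continuous_intros continuous_on_compose2[OF continuous_on_TB_inv]) auto
  then have T: "compact T" "T \<subseteq> TB" "T \<noteq> {}"
    using C K by (auto simp: T_def intro!: TB_aut_in_TB TB_inv_in_TB)
  obtain x where x: "x \<in> T" "\<And>y. y \<in> T \<Longrightarrow> rho x \<le> rho y"
    using continuous_attains_inf[OF T(1,3) continuous_on_rho[OF continuous_on_id]] by blast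
  obtain B where B: "\<And>y. y \<in> T \<Longrightarrow> norm y \<le> B"
    using T(1) compact_imp_bounded bounded_iff by metis
  have "rho x > 0" using x(1) T(2) by (auto simp: TB_iff_rho_pos)
  moreover have "P (TB_aut z u)" if z: "z \<in> TB" "rho z < rho x \<or> B < norm z" and u: "u \<in> K" for z u
  proof -
    have uT: "u \<in> TB" using u K by auto
    have "z \<notin> T" using z x(2)[of z] B[of z] by auto
    have "(\<lambda>(w, u). TB_aut w (TB_inv u)) (TB_aut z u, u) \<in> T" if "TB_aut z u \<in> C"
      unfolding T_def using that u by (intro insertI2 imageI) simp
    with \<open>z \<notin> T\<close> have "TB_aut z u \<notin> C"
      by (auto simp: TB_aut_TB_aut_TB_inv[OF z(1) uT])
    then show ?thesis using eM(2)[OF TB_aut_in_TB[OF z(1) uT]] by (auto simp: C_def not_le)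
  qed
  ultimately show ?thesis unfolding eventually_to_boundary by blast
qed

section \<open>Cauchy estimates in the mean\<close>

lemma norm_vector_cmult: "norm (c *s u) = cmod c * norm (u :: complex^'n::{finite,linorder})"
  by (simp add: norm_vec_def norm_mult L2_set_right_distrib)

lemma continuous_on_vector_cmult [continuous_intros]:
  "continuous_on S f \<Longrightarrow> continuous_on S g \<Longrightarrow>
    continuous_on S (\<lambda>x. f x *s (g x :: complex^'n::{finite,linorder}))"
  unfolding vector_scalar_mult_def by (intro continuous_intros; assumption?)

text \<open>The image measure is a multiple of \<open>lborel\<close>, and the unit ball, invariant
  and of positive finite measure, forces the multiple to be 1.\<close>

lemma distr_lborel_rotation:
  fixes c :: complex
  assumes "cmod c = 1"
  shows "distr lborel borel (\<lambda>u :: complex^'n::{finite,linorder}. c *s u) = lborel"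
proof -
  let ?T = "\<lambda>u :: complex^'n::{finite,linorder}. c *s u"
  have c0: "c \<noteq> 0" using assms by auto
  have [measurable]: "?T \<in> borel_measurable borel"
    by (intro borel_measurable_continuous_onI continuous_intros)
  obtain k where k: "k > 0" "distr lborel borel ?T = density lborel (\<lambda>_. ennreal k)"
    by (rule distr_lborel_affine[of ?T "\<lambda>u. inverse c *s u"])
       (use c0 in \<open>auto simp: vec_eq_iff algebra_simps intro!: continuous_intros\<close>)
  let ?U = "ball 0 1 :: (complex^'n::{finite,linorder}) set"
  have "?T -` ?U = ?U" using assms by (auto simp: norm_vector_cmult)
  then have "emeasure (distr lborel borel ?T) ?U = emeasure lborel ?U"
    by (subst emeasure_distr) auto
  then have "ennreal k * emeasure lborel ?U = emeasure lborel ?U"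
    unfolding k(2) by (simp add: emeasure_density nn_integral_cmult_indicator)
  moreover have U: "emeasure lborel ?U = ennreal (measure lborel ?U)" "measure lborel ?U > 0"
    using emeasure_lborel_ball_finite[of "0::complex^'n::{finite,linorder}" 1] content_ball_pos[of 1 "0::complex^'n::{finite,linorder}"]
    by (auto intro!: emeasure_eq_ennreal_measure)
  ultimately have "k * measure lborel ?U = measure lborel ?U"
    using k(1) by (simp add: ennreal_mult'[symmetric])
  then have "k = 1" using U(2) by simp
  then show ?thesis using k(2) by (simp add: density_1)
qed

text \<open>One-variable Cauchy theory on the complex line through \<open>b\<close> in direction
  \<open>u\<close>: the derivative at 0 along the line is \<open>L u\<close>, and subtracting
  \<open>c\<close> does not affect it.\<close>

lemma derivative_le_circle_mean:
  fixes f :: "complex^'n::{finite,linorder} \<Rightarrow> complex"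
  assumes f: "f \<in> holo" and L: "(f has_derivative L) (at b)"
    and sub: "\<And>\<zeta>. cmod \<zeta> \<le> 1 \<Longrightarrow> b + \<zeta> *s u \<in> TB"
  shows "ennreal (cmod (L u)) \<le>
    (\<integral>\<^sup>+t\<in>{0..1}. ennreal (cmod (f (b + exp (2 * of_real pi * \<i> * of_real t) *s u) - c)) \<partial>lborel)"
proof -
  define G where "G \<zeta> = f (b + \<zeta> *s u) - c" for \<zeta>
  define E where "E t = exp (2 * of_real pi * \<i> * of_real t)" for t :: real
  have E: "cmod (E t) = 1" for t by (simp add: E_def norm_exp_eq_Re)
  have lin: "((\<lambda>\<zeta>. b + \<zeta> *s u) has_derivative (\<lambda>h. h *s u)) (at \<zeta>)" for \<zeta>
  proof -
    have "linear (\<lambda>h. h *s u)" by (rule linearI) (simp_all add: vec_eq_iff algebra_simps)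
    then have "bounded_linear (\<lambda>h. h *s u)" by (simp add: linear_conv_bounded_linear)
    then show ?thesis by (auto intro!: derivative_eq_intros bounded_linear_imp_has_derivative)
  qed
  have der: "\<exists>d. (G has_field_derivative d) (at \<zeta>)" if \<zeta>: "cmod \<zeta> \<le> 1" for \<zeta>
  proof -
    obtain f' where f': "(f has_derivative f') (at (b + \<zeta> *s u))" "\<And>c v. f' (c *s v) = c * f' v"
      using holoE[OF f sub[OF \<zeta>]] by metis
    have "((\<lambda>\<zeta>. f (b + \<zeta> *s u)) has_derivative (\<lambda>h. f' (h *s u))) (at \<zeta>)"
      using lin f'(1) by (rule has_derivative_compose)
    then have "(G has_derivative (\<lambda>h. f' (h *s u))) (at \<zeta>)"
      unfolding G_def by (auto intro!: derivative_eq_intros)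
    then show ?thesis
      by (auto simp: f'(2) has_field_derivative_def mult.commute[of _ "f' u"])
  qed
  have bTB: "b \<in> TB" using sub[of 0] by simp
  obtain f' where f': "(f has_derivative f') (at b)" "\<And>c v. f' (c *s v) = c * f' v"
    using holoE[OF f bTB] by metis
  have "f' = L" using f'(1) L by (rule has_derivative_unique)
  have "((\<lambda>\<zeta>. f (b + \<zeta> *s u)) has_derivative (\<lambda>h. L (h *s u))) (at 0)"
    using lin by (rule has_derivative_compose) (simp add: L)
  then have "(G has_derivative (\<lambda>h. L (h *s u))) (at 0)"
    unfolding G_def by (auto intro!: derivative_eq_intros)
  then have "(G has_field_derivative L u) (at 0)"
    using f'(2) by (simp add: \<open>f' = L\<close> has_field_derivative_def mult.commute[of _ "L u"])
  then have dG: "deriv G 0 = L u" by (rule DERIV_imp_deriv)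
  have contG: "continuous_on (cball 0 1) G"
  proof (intro continuous_at_imp_continuous_on ballI)
    fix x :: complex assume "x \<in> cball 0 1"
    then obtain d where "(G has_field_derivative d) (at x)" using der[of x] by auto
    then show "isCont G x" by (rule DERIV_isCont)
  qed
  have "G holomorphic_on ball 0 1"
    unfolding holomorphic_on_def field_differentiable_def
  proof
    fix x :: complex assume "x \<in> ball 0 1"
    then obtain d where "(G has_field_derivative d) (at x)" using der[of x] by auto
    then show "\<exists>d. (G has_field_derivative d) (at x within ball 0 1)"
      by (auto intro: has_field_derivative_at_within)
  qed
  then have "((\<lambda>\<zeta>. G \<zeta> / (\<zeta> - 0) ^ Suc 1) has_contour_integral (2 * pi * \<i> / fact 1 * (deriv ^^ 1) G 0)) (circlepath 0 1)"
    by (intro Cauchy_has_contour_integral_higher_derivative_circlepath contG) auto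
  then have "((\<lambda>t. G (circlepath 0 1 t) / (circlepath 0 1 t)\<^sup>2 * vector_derivative (circlepath 0 1) (at t within {0..1})) has_integral (2 * pi * \<i> * L u)) {0..1}"
    unfolding has_contour_integral_def by (simp add: dG power2_eq_square)
  \<comment> \<open>On the unit circle the differential is 2 pi i \<open>E t\<close> dt. One power
    of \<open>E t\<close> and the factor 2 pi i cancel, so that \<open>L u\<close> becomes the mean
    of \<open>G (E t) / E t\<close>.\<close>
  then have "((\<lambda>t. G (E t) / (E t)\<^sup>2 * (2 * pi * \<i> * E t)) has_integral (2 * pi * \<i> * L u)) {0..1}"
    by (rule has_integral_eq[rotated])
       (simp add: vector_derivative_circlepath01, simp add: circlepath E_def)
  then have "((\<lambda>t. 1 / (2 * pi * \<i>) * (G (E t) / (E t)\<^sup>2 * (2 * pi * \<i> * E t))) has_integral (1 / (2 * pi * \<i>) * (2 * pi * \<i> * L u))) {0..1}"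
    by (rule has_integral_mult_right)
  then have hi: "((\<lambda>t. G (E t) / E t) has_integral L u) {0..1}"
    by (simp add: power2_eq_square E_def)
  have cont: "continuous_on UNIV (\<lambda>t. cmod (G (E t)))"
    by (intro continuous_intros continuous_on_compose2[OF contG]) (auto simp: E E_def[abs_def] intro!: continuous_intros)
  then have int: "(\<lambda>t. cmod (G (E t))) integrable_on {0..1}"
    by (intro integrable_continuous_interval) (auto intro: continuous_on_subset)
  have "cmod (L u) = cmod (integral {0..1} (\<lambda>t. G (E t) / E t))"
    using hi by (simp add: integral_unique)
  also have "\<dots> \<le> integral {0..1} (\<lambda>t. cmod (G (E t)))"
    using hi int by (intro integral_norm_bound_integral) (auto simp: norm_divide E)
  finally have "ennreal (cmod (L u)) \<le> ennreal (integral {0..1} (\<lambda>t. cmod (G (E t))))"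
    by (rule ennreal_leI)
  also have "\<dots> = (\<integral>\<^sup>+t. ennreal (indicator {0..1} t * cmod (G (E t))) \<partial>lborel)"
    using int by (intro nn_integral_has_integral_lebesgue[symmetric]) (auto intro: integrable_integral)
  also have "\<dots> = (\<integral>\<^sup>+t\<in>{0..1}. ennreal (cmod (G (E t))) \<partial>lborel)"
    by (intro nn_integral_cong) (auto simp: indicator_def)
  finally show ?thesis unfolding G_def E_def .
qed

text \<open>Averaging the previous bound over \<open>u\<close> in a ball and exchanging the integrals removes the
  circle, because the ball and Lebesgue measure are invariant under \<open>u \<mapsto> e u\<close> for unimodular \<open>e\<close>.\<close>

lemma derivative_le_ball_mean:
  fixes f :: "complex^'n::{finite,linorder} \<Rightarrow> complex"
  assumes f: "f \<in> holo" and L: "(f has_derivative L) (at b)" and sub: "ball b \<delta> \<subseteq> TB"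
  shows "(\<integral>\<^sup>+u\<in>ball 0 \<delta>. ennreal (cmod (L u)) \<partial>lborel) \<le> (\<integral>\<^sup>+w\<in>ball b \<delta>. ennreal (cmod (f w - c)) \<partial>lborel)"
proof -
  define h where "h u = ennreal (indicator (ball 0 \<delta>) u *\<^sub>R cmod (f (b + u) - c))" for u
  define E where "E t = exp (2 * of_real pi * \<i> * of_real t)" for t :: real
  have E: "cmod (E t) = 1" for t by (simp add: E_def norm_exp_eq_Re)
  have inTB: "b + u \<in> TB" if "norm u < \<delta>" for u
    using that sub by (auto simp: dist_norm subset_iff)
  have "continuous_on (ball 0 \<delta>) (\<lambda>u. cmod (f (b + u) - c))"
    using sub by (intro continuous_intros continuous_on_compose2[OF holo_continuous_on[OF f]]) auto
  then have h [measurable]: "h \<in> borel_measurable borel"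
    unfolding h_def by (intro measurable_compose[OF borel_measurable_continuous_on_indicator measurable_ennreal]) auto
  have L' [measurable]: "L \<in> borel_measurable borel"
    using L by (intro borel_measurable_continuous_onI linear_continuous_on has_derivative_bounded_linear)
  \<comment> \<open>Fubini needs measurability jointly in \<open>u\<close> and the angle
    \<open>t\<close>, which follows from joint continuity of the rotation.\<close>
  have E_m: "(\<lambda>x :: (complex^'n::{finite,linorder}) \<times> real. E (snd x) *s fst x) \<in> borel_measurable borel"
    unfolding E_def by (intro borel_measurable_continuous_onI continuous_intros)
  have [measurable]: "(\<lambda>x. h (E (snd x) *s fst x)) \<in> borel_measurable (lborel \<Otimes>\<^sub>M lborel)"
  proof -
    have "(\<lambda>x. h (E (snd x) *s fst x)) \<in> borel_measurable borel"
      using E_m h by (rule measurable_compose)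
    then show ?thesis by (simp add: lborel_prod)
  qed
  have le: "ennreal (cmod (L u)) * indicator (ball 0 \<delta>) u \<le> (\<integral>\<^sup>+t\<in>{0..1}. h (E t *s u) \<partial>lborel)" for u
  proof (cases "u \<in> ball 0 \<delta>")
    case True
    have "b + \<zeta> *s u \<in> TB" if "cmod \<zeta> \<le> 1" for \<zeta>
    proof (rule inTB)
      have "norm (\<zeta> *s u) \<le> norm u" using that by (simp add: norm_vector_cmult mult_left_le_one_le)
      then show "norm (\<zeta> *s u) < \<delta>" using True by simp
    qed
    from derivative_le_circle_mean[OF f L this, of c]
    have "ennreal (cmod (L u)) \<le> (\<integral>\<^sup>+t\<in>{0..1}. ennreal (cmod (f (b + E t *s u) - c)) \<partial>lborel)"
      by (simp add: E_def)
    also have "\<dots> = (\<integral>\<^sup>+t\<in>{0..1}. h (E t *s u) \<partial>lborel)"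
      using True by (intro nn_integral_cong) (simp add: h_def norm_vector_cmult E)
    finally show ?thesis using True by simp
  qed simp
  have "(\<integral>\<^sup>+u\<in>ball 0 \<delta>. ennreal (cmod (L u)) \<partial>lborel) \<le> (\<integral>\<^sup>+u. (\<integral>\<^sup>+t\<in>{0..1}. h (E t *s u) \<partial>lborel) \<partial>lborel)"
    using le by (intro nn_integral_mono)
  also have "\<dots> = (\<integral>\<^sup>+t. (\<integral>\<^sup>+u. h (E t *s u) * indicator {0..1} t \<partial>lborel) \<partial>lborel)"
    by (rule lborel_pair.Fubini'[symmetric]) (simp add: split_beta)
  also have "\<dots> = (\<integral>\<^sup>+t. (\<integral>\<^sup>+u. h u \<partial>lborel) * indicator {0..1} t \<partial>(lborel :: real measure))"
  proof (rule nn_integral_cong)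
    fix t
    have [measurable]: "(\<lambda>u :: complex^'n::{finite,linorder}. E t *s u) \<in> borel_measurable borel"
      by (intro borel_measurable_continuous_onI continuous_intros)
    have "(\<integral>\<^sup>+u. h (E t *s u) \<partial>lborel) = (\<integral>\<^sup>+u. h u \<partial>distr lborel borel (\<lambda>u. E t *s u))"
      by (rule nn_integral_distr[symmetric]) auto
    also have "\<dots> = (\<integral>\<^sup>+u. h u \<partial>lborel)" by (simp add: distr_lborel_rotation[OF E])
    finally show "(\<integral>\<^sup>+u. h (E t *s u) * indicator {0..1} t \<partial>lborel) = (\<integral>\<^sup>+u. h u \<partial>lborel) * indicator {0..1} t"
      by (simp add: nn_integral_multc)
  qed
  also have "\<dots> = (\<integral>\<^sup>+u. h u \<partial>lborel)" by (simp add: nn_integral_cmult)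
  also have "\<dots> = (\<integral>\<^sup>+w. h (w - b) \<partial>lborel)"
  proof -
    have "(\<integral>\<^sup>+u. h u \<partial>lborel) = (\<integral>\<^sup>+u. h u \<partial>distr lborel borel ((+) (- b)))"
      by (simp only: lborel_distr_plus)
    also have "\<dots> = (\<integral>\<^sup>+w. h (w - b) \<partial>lborel)" by (subst nn_integral_distr) auto
    finally show ?thesis .
  qed
  also have "\<dots> = (\<integral>\<^sup>+w\<in>ball b \<delta>. ennreal (cmod (f w - c)) \<partial>lborel)"
    by (intro nn_integral_cong) (auto simp: h_def indicator_def dist_norm norm_minus_commute)
  finally show ?thesis .
qed

text \<open>Writing \<open>L v = L (u + v) - L u\<close> and integrating over \<open>u\<close>.\<close>

lemma linear_le_ball_mean:
  fixes L :: "'a::euclidean_space \<Rightarrow> complex"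
  assumes L: "linear L" and v: "norm v \<le> s"
  shows "ennreal (cmod (L v)) * emeasure lborel (ball (0::'a) s) \<le> 2 * (\<integral>\<^sup>+u\<in>ball 0 (2 * s). ennreal (cmod (L u)) \<partial>lborel)"
proof -
  define h where "h u = ennreal (cmod (L u)) * indicator (ball 0 (2 * s)) u" for u
  have [measurable]: "L \<in> borel_measurable borel"
    using L by (intro borel_measurable_continuous_onI linear_continuous_on) (simp add: linear_conv_bounded_linear)
  have [measurable]: "ball (0 :: 'a) (2 * s) \<in> sets borel" by simp
  have h [measurable]: "h \<in> borel_measurable borel" unfolding h_def by measurable
  have "ennreal (cmod (L v)) * emeasure lborel (ball (0::'a) s) = (\<integral>\<^sup>+u\<in>ball (0::'a) s. ennreal (cmod (L v)) \<partial>lborel)"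
    by (simp add: nn_integral_cmult_indicator)
  also have "\<dots> \<le> (\<integral>\<^sup>+u. h (v + u) + h u \<partial>lborel)"
  proof (rule nn_integral_mono)
    fix u
    show "ennreal (cmod (L v)) * indicator (ball 0 s) u \<le> h (v + u) + h u"
    proof (cases "u \<in> ball 0 s")
      case True
      have "norm u < s" using True by simp
      then have "norm (v + u) < 2 * s" "norm u < 2 * s"
        using v norm_triangle_ineq[of v u] norm_ge_zero[of u] by linarith+
      moreover have "cmod (L v) \<le> cmod (L (v + u)) + cmod (L u)"
        using norm_triangle_ineq4[of "L (v + u)" "L u"] by (simp add: linear_add[OF L])
      ultimately show ?thesis
        using True by (simp add: h_def ennreal_plus[symmetric] ennreal_leI del: ennreal_plus)
    qed simp
  qed
  also have "\<dots> = (\<integral>\<^sup>+u. h (v + u) \<partial>lborel) + (\<integral>\<^sup>+u. h u \<partial>lborel)"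
    by (rule nn_integral_add) auto
  also have "(\<integral>\<^sup>+u. h (v + u) \<partial>lborel) = (\<integral>\<^sup>+u. h u \<partial>distr lborel borel ((+) v))"
    by (subst nn_integral_distr) auto
  also have "\<dots> = (\<integral>\<^sup>+u. h u \<partial>lborel)" by (simp only: lborel_distr_plus)
  finally show ?thesis unfolding h_def mult_2 .
qed

section \<open>Oscillation and gradient at the base point\<close>

lemma vec_eq_sum_axis: "(v :: complex^'n::{finite,linorder}) = (\<Sum>j\<in>UNIV. v $ j *s axis j 1)"
  by (simp add: vec_eq_iff axis_def if_distrib[of "\<lambda>x. _ * x"] cong: if_cong)

lemma norm_derivative_le_dz:
  fixes f' :: "complex^'n::{finite,linorder} \<Rightarrow> complex"
  assumes lin: "linear f'" and f': "\<And>c v. f' (c *s v) = c * f' v"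
  shows "cmod (f' v) \<le> (\<Sum>j\<in>UNIV. cmod (f' (axis j 1))) * norm v"
proof -
  have "f' v = f' (\<Sum>j\<in>UNIV. v $ j *s axis j 1)"
    by (simp only: vec_eq_sum_axis[symmetric])
  also have "\<dots> = (\<Sum>j\<in>UNIV. v $ j * f' (axis j 1))"
    by (simp add: linear_sum[OF lin] f')
  finally have "cmod (f' v) \<le> (\<Sum>j\<in>UNIV. cmod (v $ j * f' (axis j 1)))"
    by (simp only: norm_sum)
  also have "\<dots> \<le> (\<Sum>j\<in>UNIV. norm v * cmod (f' (axis j 1)))"
    unfolding norm_mult
    by (intro sum_mono mult_right_mono) (auto intro: Finite_Cartesian_Product.norm_nth_le)
  finally show ?thesis by (simp add: sum_distrib_left mult.commute)
qed

text \<open>If \<open>F\<close> stays within \<open>B\<close> of some reference value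
  \<open>a\<close>, so does its average; the triangle inequality through \<open>a\<close> gives the
  factor 2.\<close>

lemma MO_base_point_le_sup:
  fixes F :: "complex^'n::{finite,linorder} \<Rightarrow> complex"
  assumes \<alpha>: "-1 < \<alpha>" and F: "continuous_on TB F" and p: "1 \<le> p"
    and le: "\<And>w. w \<in> bergman_ball \<alpha> base_point r \<Longrightarrow> cmod (F w - a) \<le> B" and B: "0 \<le> B"
    and V: "0 < measure (vol \<alpha>) (bergman_ball \<alpha> (base_point :: complex^'n::{finite,linorder}) r)"
  shows "MO p \<alpha> r F base_point \<le> 2 * B"
proof -
  let ?C = "bergman_ball \<alpha> base_point r :: (complex^'n::{finite,linorder}) set"
  define V where "V = measure (vol \<alpha>) ?C"
  have V: "V > 0" using V by (simp add: V_def)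
  obtain K where K: "compact K" "convex K" "K \<subseteq> TB" "?C \<subseteq> K"
    using bergman_ball_base_point_compact[OF \<alpha>] by metis
  have C: "?C \<in> sets borel" by (intro borel_open open_bergman_ball base_point_in_TB \<alpha>)
  have Cv: "?C \<in> sets (vol \<alpha>)" using C bergman_ball_subset_TB by (rule sets_vol_borel)
  have FK: "continuous_on K F" using F K(3) by (rule continuous_on_subset)
  have const: "(LINT w:?C|vol \<alpha>. c) = V *\<^sub>R c" for c :: "'b::{banach,second_countable_topology}"
    unfolding set_lebesgue_integral_def V_def
    using emeasure_vol_compact[OF K(1,3), of \<alpha>] emeasure_mono[OF K(4) sets_vol_borel[OF borel_compact[OF K(1)] K(3)], of \<alpha>] Cv
      sets.sets_into_space[OF Cv]
    by (subst integral_scaleR_left) (auto simp: Int_absorb2 intro!: integrable_real_indicator le_less_trans)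
  have i1: "set_integrable (vol \<alpha>) ?C (\<lambda>w. F w - a)"
    using FK by (intro set_integrable_vol[OF C K(4,1,3)] continuous_intros)
  have "(LINT w:?C|vol \<alpha>. F w) = (LINT w:?C|vol \<alpha>. (F w - a) + a)" by simp
  also have "\<dots> = (LINT w:?C|vol \<alpha>. F w - a) + V *\<^sub>R a"
    unfolding const[symmetric] by (intro set_integral_add i1 set_integrable_vol[OF C K(4,1,3)]) simp
  finally have avg_eq: "avg \<alpha> r F base_point - a = (LINT w:?C|vol \<alpha>. F w - a) / V"
    using V unfolding avg_def V_def[symmetric] by (simp add: field_simps scaleR_conv_of_real)
  have "cmod (LINT w:?C|vol \<alpha>. F w - a) \<le> B * V"
  proof -
    have "cmod (LINT w:?C|vol \<alpha>. F w - a) \<le> (LINT w:?C|vol \<alpha>. cmod (F w - a))"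
      using i1 by (rule set_integral_norm_bound)
    also have "\<dots> \<le> (LINT w:?C|vol \<alpha>. B)"
      using le by (intro set_integral_mono set_integrable_norm i1 set_integrable_vol[OF C K(4,1,3), of "\<lambda>_. B"]) auto
    finally show ?thesis by (simp add: const mult.commute)
  qed
  then have avg: "cmod (avg \<alpha> r F base_point - a) \<le> B"
    unfolding avg_eq norm_divide using V by (simp add: pos_divide_le_eq)
  have "(LINT w:?C|vol \<alpha>. norm (F w - avg \<alpha> r F base_point) powr p) \<le> (LINT w:?C|vol \<alpha>. (2 * B) powr p)"
  proof (rule set_integral_mono)
    show "set_integrable (vol \<alpha>) ?C (\<lambda>w. norm (F w - avg \<alpha> r F base_point) powr p)"
      using FK p by (intro set_integrable_vol[OF C K(4,1,3)] continuous_on_norm_powr continuous_intros) auto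
    show "set_integrable (vol \<alpha>) ?C (\<lambda>w. (2 * B) powr p)"
      by (intro set_integrable_vol[OF C K(4,1,3)]) simp
    fix w assume w: "w \<in> ?C"
    have "norm (F w - avg \<alpha> r F base_point) \<le> cmod (F w - a) + cmod (avg \<alpha> r F base_point - a)"
      using norm_triangle_ineq4[of "F w - a" "avg \<alpha> r F base_point - a"] by simp
    then show "norm (F w - avg \<alpha> r F base_point) powr p \<le> (2 * B) powr p"
      using le[OF w] avg p by (intro powr_mono2) auto
  qed
  also have "\<dots> = V * (2 * B) powr p" by (simp add: const)
  finally have "(LINT w:?C|vol \<alpha>. norm (F w - avg \<alpha> r F base_point) powr p) / V \<le> (2 * B) powr p"
    using V by (simp add: field_simps)
  then have "MO p \<alpha> r F base_point \<le> ((2 * B) powr p) powr (1 / p)"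
    unfolding MO_def V_def[symmetric] using p V
    by (intro powr_mono2) (auto simp: set_lebesgue_integral_def intro!: divide_nonneg_nonneg Bochner_Integration.integral_nonneg)
  also have "\<dots> = 2 * B" using p B by (simp add: powr_powr)
  finally show ?thesis .
qed

text \<open>The pointwise bound \<open>x \<le> s + x^p / s^(p - 1)\<close> stands in for Jensen's inequality.\<close>

lemma le_add_powr:
  fixes x s p :: real
  assumes "0 \<le> x" "0 < s" "1 \<le> p"
  shows "x \<le> s + s powr (1 - p) * x powr p"
proof (cases "x \<le> s")
  case True
  then show ?thesis using assms by (simp add: add_increasing2)
next
  case False
  then have "x powr (1 - p) \<le> s powr (1 - p)" using assms by (intro powr_mono2') auto
  then have "x powr (1 - p) * x powr p \<le> s powr (1 - p) * x powr p" by (intro mult_right_mono) auto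
  moreover have "x powr (1 - p) * x powr p = x" using False assms by (simp add: powr_add[symmetric])
  ultimately show ?thesis using assms by simp
qed

text \<open>Integrating \<open>le_add_powr\<close> with \<open>s\<close> equal to the oscillation
  \<open>m\<close> makes each of the two terms \<open>V * m\<close>, whence the factor 2. Since
  \<open>s\<close> must be positive, \<open>m = 0\<close> is reached by letting \<open>s\<close>
  tend to 0.\<close>

lemma set_integral_norm_le_MO:
  fixes F :: "complex^'n::{finite,linorder} \<Rightarrow> complex"
  assumes \<alpha>: "-1 < \<alpha>" and F: "continuous_on TB F" and p: "1 \<le> p"
    and V: "0 < measure (vol \<alpha>) (bergman_ball \<alpha> (base_point :: complex^'n::{finite,linorder}) r)"
  shows "(LINT w:bergman_ball \<alpha> base_point r|vol \<alpha>. cmod (F w - avg \<alpha> r F base_point))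
    \<le> 2 * measure (vol \<alpha>) (bergman_ball \<alpha> (base_point :: complex^'n::{finite,linorder}) r) * MO p \<alpha> r F base_point"
proof -
  let ?C = "bergman_ball \<alpha> base_point r :: (complex^'n::{finite,linorder}) set"
  define V where "V = measure (vol \<alpha>) ?C"
  have V: "V > 0" using V by (simp add: V_def)
  obtain K where K: "compact K" "convex K" "K \<subseteq> TB" "?C \<subseteq> K"
    using bergman_ball_base_point_compact[OF \<alpha>] by metis
  have C: "?C \<in> sets borel" by (intro borel_open open_bergman_ball base_point_in_TB \<alpha>)
  have Cv: "?C \<in> sets (vol \<alpha>)" using C bergman_ball_subset_TB by (rule sets_vol_borel)
  have FK: "continuous_on K F" using F K(3) by (rule continuous_on_subset)
  define g where "g w = cmod (F w - avg \<alpha> r F base_point)" for w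
  define m where "m = MO p \<alpha> r F base_point"
  define I where "I = (LINT w:?C|vol \<alpha>. g w powr p)"
  have I0: "0 \<le> I" unfolding I_def set_lebesgue_integral_def by (intro Bochner_Integration.integral_nonneg) auto
  have "m powr p = I / V"
    using p I0 V unfolding m_def MO_def I_def g_def V_def[symmetric] by (simp add: powr_powr)
  then have I: "I = V * m powr p" using V by simp
  have m0: "0 \<le> m" by (simp add: m_def MO_nonneg)
  have ig: "set_integrable (vol \<alpha>) ?C g"
    unfolding g_def using FK by (intro set_integrable_vol[OF C K(4,1,3)] continuous_intros)
  have igp: "set_integrable (vol \<alpha>) ?C (\<lambda>w. g w powr p)"
    unfolding g_def using FK p by (intro set_integrable_vol[OF C K(4,1,3)] continuous_on_norm_powr continuous_intros) auto
  have le: "(LINT w:?C|vol \<alpha>. g w) \<le> V * (s + s powr (1 - p) * m powr p)" if s: "s > 0" for s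
  proof -
    have i2: "set_integrable (vol \<alpha>) ?C (\<lambda>w. s)" by (intro set_integrable_vol[OF C K(4,1,3)]) simp
    have "(LINT w:?C|vol \<alpha>. g w) \<le> (LINT w:?C|vol \<alpha>. s + s powr (1 - p) * g w powr p)"
      using le_add_powr[OF _ s p] by (intro set_integral_mono set_integral_add ig i2 set_integrable_mult_right igp) (simp add: g_def)
    also have "\<dots> = (LINT w:?C|vol \<alpha>. s) + s powr (1 - p) * I"
      unfolding I_def using igp i2 by (subst set_integral_add) auto
    also have "(LINT w:?C|vol \<alpha>. s) = s * V"
      using sets.sets_into_space[OF Cv] by (simp add: V_def set_lebesgue_integral_def Int_absorb2)
    finally show ?thesis by (simp add: I algebra_simps)
  qed
  have "(LINT w:?C|vol \<alpha>. g w) \<le> 2 * V * m"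
  proof (cases "m = 0")
    case True
    \<comment> \<open>Here \<open>0 powr p = 0\<close> removes the second term of \<open>le\<close>,
      and \<open>s = e / V\<close> leaves exactly \<open>e\<close>.\<close>
    have "(LINT w:?C|vol \<alpha>. g w) \<le> 0 + e" if "e > 0" for e
      using le[of "e / V"] that V p by (simp add: True)
    then have "(LINT w:?C|vol \<alpha>. g w) \<le> 0" by (rule field_le_epsilon)
    then show ?thesis by (simp add: True)
  next
    case False
    then have "m powr (1 - p) * m powr p = m" using m0 by (simp add: powr_add[symmetric])
    then show ?thesis using le[of m] False m0 by simp
  qed
  then show ?thesis unfolding g_def V_def m_def .
qed

lemma measure_bergman_ball_pos:
  assumes "-1 < \<alpha>" "0 < r"
  shows "0 < measure (vol \<alpha>) (bergman_ball \<alpha> (base_point :: complex^'n::{finite,linorder}) r)"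
proof -
  let ?C = "bergman_ball \<alpha> base_point r :: (complex^'n::{finite,linorder}) set"
  obtain K where K: "compact K" "convex K" "K \<subseteq> TB" "?C \<subseteq> K"
    using bergman_ball_base_point_compact[OF assms(1)] by metis
  have o: "open ?C" by (intro open_bergman_ball base_point_in_TB assms)
  then have C [measurable]: "?C \<in> sets borel" by (rule borel_open)
  obtain a where a: "0 < a" "\<And>w. w \<in> K \<Longrightarrow> a \<le> rho w powr \<alpha>"
    using compact_rho_bounds[OF K(1,3), where \<alpha> = \<alpha>] by metis
  have "0 < ennreal a * emeasure lborel ?C"
    using a(1) emeasure_lborel_open_pos[OF o center_in_bergman_ball[OF base_point_in_TB assms]]
    by (simp add: ennreal_zero_less_mult_iff)
  also have "\<dots> = (\<integral>\<^sup>+w\<in>?C. ennreal a \<partial>lborel)" by (simp add: nn_integral_cmult_indicator)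
  also have "\<dots> \<le> emeasure (vol \<alpha>) ?C"
    unfolding emeasure_vol[OF C bergman_ball_subset_TB] using a(2) K(4)
    by (intro nn_integral_mono) (auto simp: indicator_def intro!: ennreal_leI)
  finally have "0 < emeasure (vol \<alpha>) ?C" .
  \<comment> \<open>Positivity of \<open>emeasure\<close> alone is not enough:
    \<open>measure\<close> is 0 on sets of infinite measure.\<close>
  moreover have "emeasure (vol \<alpha>) ?C < \<infinity>"
    using emeasure_vol_compact[OF K(1,3), of \<alpha>] emeasure_mono[OF K(4) sets_vol_borel[OF borel_compact[OF K(1)] K(3)], of \<alpha>]
    by (simp add: le_less_trans)
  ultimately show ?thesis by (simp add: measure_def enn2real_positive_iff)
qed

text \<open>A Euclidean ball inside the Bergman ball carries the averaged Cauchy estimate; on the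
  Bergman ball the weight is bounded below, so Lebesgue integrals pass to weighted ones at the cost
  of a constant independent of \<open>F\<close>.\<close>

lemma inv_grad_base_point_le_MO:
  assumes \<alpha>: "-1 < \<alpha>" and r: "0 < r" and p: "1 \<le> p"
  obtains C where "0 \<le> C" "\<And>F :: complex^'n::{finite,linorder} \<Rightarrow> complex. F \<in> holo \<Longrightarrow> inv_grad F base_point \<le> C * MO p \<alpha> r F base_point"
proof -
  let ?C = "bergman_ball \<alpha> base_point r :: (complex^'n::{finite,linorder}) set"
  define V where "V = measure (vol \<alpha>) ?C"
  have V: "V > 0" using measure_bergman_ball_pos[OF \<alpha> r] by (simp add: V_def)
  obtain K where K: "compact K" "convex K" "K \<subseteq> TB" "?C \<subseteq> K"
    using bergman_ball_base_point_compact[OF \<alpha>] by metis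
  have o: "open ?C" by (intro open_bergman_ball base_point_in_TB \<alpha>)
  then have C [measurable]: "?C \<in> sets borel" by (rule borel_open)
  obtain a where a: "0 < a" "\<And>w. w \<in> K \<Longrightarrow> a \<le> rho w powr \<alpha>"
    using compact_rho_bounds[OF K(1,3), where \<alpha> = \<alpha>] by metis
  obtain d where d: "d > 0" "ball base_point d \<subseteq> ?C"
    using openE[OF o center_in_bergman_ball[OF base_point_in_TB \<alpha> r]] by metis
  define s where "s = d / 2"
  define U where "U = measure lborel (ball (0 :: complex^'n::{finite,linorder}) s)"
  have s: "s > 0" "2 * s = d" using d by (auto simp: s_def)
  have U: "emeasure lborel (ball (0 :: complex^'n::{finite,linorder}) s) = ennreal U" "U > 0"
    unfolding U_def using emeasure_lborel_ball_finite[of "0::complex^'n::{finite,linorder}" s] content_ball_pos[OF s(1)]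
    by (auto intro!: emeasure_eq_ennreal_measure)
  \<comment> \<open>One factor 2 is from \<open>linear_le_ball_mean\<close>, \<open>2 * V\<close>
    from \<open>set_integral_norm_le_MO\<close>. \<open>U\<close> is the volume of the ball of
    radius \<open>s\<close>, \<open>a\<close> the lower bound of the weight, and \<open>s\<close>
    appears because the estimate is applied to \<open>s\<close> times a coordinate vector, the
    longest one allowed.\<close>
  define D where "D = 4 * V / (s * U * a)"
  have D: "D \<ge> 0" using V s U a by (simp add: D_def)
  have main: "cmod (dz j F base_point) \<le> D * MO p \<alpha> r F base_point" if F: "F \<in> holo" for F :: "complex^'n::{finite,linorder} \<Rightarrow> complex" and j
  proof -
    obtain L where L: "(F has_derivative L) (at base_point)" "\<And>c v. L (c *s v) = c * L v" "\<And>j. dz j F base_point = L (axis j 1)"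
      using holoE[OF F base_point_in_TB] by metis
    have lin: "linear L" using L(1) by (rule has_derivative_linear)
    define c where "c = avg \<alpha> r F base_point"
    define m where "m = MO p \<alpha> r F base_point"
    have cont: "continuous_on TB F" using F by (rule holo_continuous_on)
    define g where "g w = ennreal (indicator ?C w *\<^sub>R cmod (F w - c))" for w
    have g [measurable]: "g \<in> borel_measurable borel"
      unfolding g_def
      by (intro measurable_compose[OF borel_measurable_continuous_on_indicator measurable_ennreal] C
          continuous_intros continuous_on_subset[OF cont bergman_ball_subset_TB])
    have "norm (of_real s *s axis j (1::complex)) \<le> s"
      using s(1) by (simp add: norm_vector_cmult)
    then have "ennreal (cmod (L (of_real s *s axis j 1))) * ennreal U \<le> 2 * (\<integral>\<^sup>+u\<in>ball 0 d. ennreal (cmod (L u)) \<partial>lborel)"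
      using linear_le_ball_mean[OF lin, of _ s] by (simp add: s U)
    also have "\<dots> \<le> 2 * (\<integral>\<^sup>+w\<in>ball base_point d. ennreal (cmod (F w - c)) \<partial>lborel)"
      by (intro mult_left_mono derivative_le_ball_mean[OF F L(1)] order_trans[OF d(2) bergman_ball_subset_TB]) simp
    also have "\<dots> \<le> 2 * (\<integral>\<^sup>+w\<in>?C. g w \<partial>lborel)"
      using d(2) by (intro mult_left_mono nn_integral_mono) (auto simp: g_def indicator_def)
    finally have "ennreal a * (ennreal (cmod (L (of_real s *s axis j 1))) * ennreal U) \<le> ennreal a * (2 * (\<integral>\<^sup>+w\<in>?C. g w \<partial>lborel))"
      by (intro mult_left_mono) auto
    also have "\<dots> = 2 * (\<integral>\<^sup>+w. ennreal a * (g w * indicator ?C w) \<partial>lborel)"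
      by (subst nn_integral_cmult) (auto simp: mult_ac)
    also have "\<dots> \<le> 2 * (\<integral>\<^sup>+w\<in>?C. ennreal (rho w powr \<alpha>) * g w \<partial>lborel)"
      using a(2) K(4) by (intro mult_left_mono nn_integral_mono) (auto simp: indicator_def intro!: mult_right_mono ennreal_leI)
    also have "\<dots> = 2 * (\<integral>\<^sup>+w\<in>?C. g w \<partial>vol \<alpha>)"
      by (subst nn_integral_vol[OF g C bergman_ball_subset_TB]) simp
    also have "(\<integral>\<^sup>+w\<in>?C. g w \<partial>vol \<alpha>) = (\<integral>\<^sup>+w. ennreal (indicator ?C w *\<^sub>R cmod (F w - c)) \<partial>vol \<alpha>)"
      by (intro nn_integral_cong) (auto simp: g_def indicator_def)
    also have "\<dots> = ennreal (LINT w:?C|vol \<alpha>. cmod (F w - c))"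
      unfolding set_lebesgue_integral_def
      by (intro nn_integral_eq_integral set_integrable_vol[OF C K(4,1,3), unfolded set_integrable_def] continuous_intros)
         (use cont K(3) in \<open>auto intro: continuous_on_subset\<close>)
    also have "\<dots> \<le> ennreal (2 * V * m)"
      unfolding c_def V_def m_def
      by (intro ennreal_leI set_integral_norm_le_MO[OF \<alpha> cont p measure_bergman_ball_pos[OF \<alpha> r]])
    finally have "ennreal a * (ennreal (cmod (L (of_real s *s axis j 1))) * ennreal U) \<le> 2 * ennreal (2 * V * m)"
      by (simp add: mult_left_mono)
    moreover have "ennreal a * (ennreal x * ennreal U) = ennreal (a * (x * U))" if "0 \<le> x" for x
      using a(1) that by (simp add: ennreal_mult'[of a] ennreal_mult'[of x])
    moreover have "2 * ennreal x = ennreal (2 * x)" for x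
      by (subst ennreal_mult') simp_all
    ultimately have "ennreal (a * (cmod (L (of_real s *s axis j 1)) * U)) \<le> ennreal (2 * (2 * V * m))"
      by (metis norm_ge_zero)
    then have "a * (cmod (L (of_real s *s axis j 1)) * U) \<le> 2 * (2 * V * m)"
      using V by (simp add: ennreal_le_iff m_def MO_nonneg)
    moreover have "cmod (L (of_real s *s axis j 1)) = s * cmod (dz j F base_point)"
      using s by (simp add: L norm_mult)
    ultimately show ?thesis
      using a U s by (simp add: D_def m_def field_simps)
  qed
  show ?thesis
  proof (rule that)
    show "0 \<le> sqrt (4 * (2 + real CARD('n))) * D" using D by simp
    show "inv_grad F base_point \<le> sqrt (4 * (2 + real CARD('n))) * D * MO p \<alpha> r F base_point" if "F \<in> holo" for F :: "complex^'n::{finite,linorder} \<Rightarrow> complex"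
      using inv_grad_base_point_le[of F, OF main[OF that]] by (simp add: mult.assoc)
  qed
qed

text \<open>The mean value inequality needs convexity, which is available for the compact set
  \<open>K\<close> and not for the Bergman ball inside it. The gradient is therefore bounded on
  \<open>K\<close>, and \<open>K\<close> is passed on because the boundary version must know where
  the gradient is evaluated.\<close>

lemma MO_base_point_le_inv_grad:
  assumes \<alpha>: "-1 < \<alpha>" and r: "0 < r" and p: "1 \<le> p"
  obtains C and K :: "(complex^'n::{finite,linorder}) set" where "0 \<le> C" "compact K" "K \<subseteq> TB"
    "\<And>F B. F \<in> holo \<Longrightarrow> (\<And>u. u \<in> K \<Longrightarrow> inv_grad F u \<le> B) \<Longrightarrow> MO p \<alpha> r F base_point \<le> C * B"
proof -
  let ?C = "bergman_ball \<alpha> base_point r :: (complex^'n::{finite,linorder}) set"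
  obtain e M where eM: "e > 0" "?C \<subseteq> {w. e \<le> rho w} \<inter> cball 0 M"
    using bergman_ball_base_point_bounded[OF \<alpha>] by metis
  define K :: "(complex^'n::{finite,linorder}) set" where "K = {w. e \<le> rho w} \<inter> cball 0 M"
  have K: "compact K" "convex K" "K \<subseteq> TB" "?C \<subseteq> K"
    using eM compact_core[OF eM(1)] by (auto simp: K_def TB_iff_rho_pos intro: convex_Int convex_rho_ge)
  have baseK: "base_point \<in> K" using K(4) center_in_bergman_ball[OF base_point_in_TB \<alpha> r] by blast
  have M: "0 \<le> M" using baseK by (auto simp: K_def intro: order_trans[OF norm_ge_zero])
  \<comment> \<open>On \<open>K\<close>, where \<open>e \<le> rho u\<close> and
    \<open>norm u \<le> M\<close>, \<open>dz_le_inv_grad\<close> gives the factor 1/e for the last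
    derivative and 1/sqrt e + 2M/e for the others; \<open>A\<close> is their sum and serves for
    all.\<close>
  define A where "A = 1 / sqrt e + (1 + 2 * M) * (1 / e)"
  have A: "0 \<le> A" using eM M by (simp add: A_def)
  \<comment> \<open>The leading 2 is from \<open>MO_base_point_le_sup\<close>,
    \<open>CARD('n) * A\<close> bounds the derivative, and \<open>2 * M\<close> bounds the distance
    from the base point within \<open>K\<close>.\<close>
  define C where "C = 2 * (real CARD('n) * A * (2 * M))"
  have C: "0 \<le> C" using A M by (simp add: C_def)
  show ?thesis
  proof (rule that[OF C K(1,3)])
    fix F :: "complex^'n::{finite,linorder} \<Rightarrow> complex" and B
    assume F: "F \<in> holo" and B: "\<And>u. u \<in> K \<Longrightarrow> inv_grad F u \<le> B"
    have B0: "0 \<le> B" using B[OF baseK] inv_grad_nonneg[OF base_point_in_TB, of F] by linarith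
    have dz_le: "cmod (dz j F u) \<le> A * B" if u: "u \<in> K" for u j
    proof -
      have uT: "u \<in> TB" and re: "e \<le> rho u" and nu: "norm u \<le> M" using u K(3) by (auto simp: K_def)
      have i0: "0 \<le> inv_grad F u" using uT by (rule inv_grad_nonneg)
      have r1: "inv_grad F u / rho u \<le> B / e"
        using B[OF u] re eM(1) i0 B0 by (intro frac_le) auto
      have r2: "inv_grad F u / sqrt (rho u) \<le> B / sqrt e"
        using B[OF u] re eM(1) i0 B0 by (intro frac_le) auto
      have AB: "A * B = B / sqrt e + B / e + 2 * M * (B / e)" by (simp add: A_def algebra_simps add_divide_distrib)
      have nn: "0 \<le> B / sqrt e" "0 \<le> B / e" "0 \<le> 2 * M * (B / e)" using eM(1) B0 M by auto
      show ?thesis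
      proof (cases "j = lst")
        case True
        then show ?thesis using dz_le_inv_grad(1)[OF uT, of F] r1 nn AB by simp
      next
        case False
        have "\<bar>Im (u $ j)\<bar> \<le> M" using abs_Im_le_cmod[of "u $ j"] Finite_Cartesian_Product.norm_nth_le[of u j] nu by linarith
        then have "2 * \<bar>Im (u $ j)\<bar> * (inv_grad F u / rho u) \<le> 2 * M * (B / e)"
          using r1 i0 uT M by (intro mult_mono) (auto simp: TB_iff_rho_pos)
        then show ?thesis using dz_le_inv_grad(2)[OF uT False, of F] r2 nn AB by linarith
      qed
    qed
    have lip: "norm (F w - F base_point) \<le> (real CARD('n) * (A * B)) * norm (w - base_point)" if w: "w \<in> K" for w
    proof -
      have "\<exists>f'. (F has_derivative f') (at u within K) \<and> onorm f' \<le> real CARD('n) * (A * B)" if u: "u \<in> K" for u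
      proof -
        have uT: "u \<in> TB" using u K(3) by auto
        obtain f' where f': "(F has_derivative f') (at u)" "\<And>c v. f' (c *s v) = c * f' v" "\<And>j. dz j F u = f' (axis j 1)"
          using holoE[OF F uT] by metis
        have S: "(\<Sum>j\<in>UNIV. cmod (f' (axis j 1))) \<le> real CARD('n) * (A * B)"
          using sum_bounded_above[of UNIV "\<lambda>j. cmod (f' (axis j 1))" "A * B"] dz_le[OF u] by (simp add: f'(3))
        have "onorm f' \<le> real CARD('n) * (A * B)"
        proof (rule onorm_bound)
          show "0 \<le> real CARD('n) * (A * B)" using A B0 by simp
          show "norm (f' v) \<le> real CARD('n) * (A * B) * norm v" for v
            using norm_derivative_le_dz[OF has_derivative_linear[OF f'(1)] f'(2), of v] mult_right_mono[OF S, of "norm v"]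
            by (meson norm_ge_zero order_trans)
        qed
        then show ?thesis using has_derivative_at_withinI[OF f'(1)] by blast
      qed
      then obtain f' where "\<And>u. u \<in> K \<Longrightarrow> (F has_derivative f' u) (at u within K) \<and> onorm (f' u) \<le> real CARD('n) * (A * B)"
        by metis
      then show ?thesis
        using w baseK by (intro differentiable_bound[OF K(2)]) auto
    qed
    have "cmod (F w - F base_point) \<le> real CARD('n) * (A * B) * (2 * M)" if "w \<in> ?C" for w
    proof -
      have w: "w \<in> K" using that K(4) by auto
      have "norm (w - base_point) \<le> 2 * M"
        using norm_triangle_ineq4[of w base_point] w baseK by (auto simp: K_def)
      then have "real CARD('n) * (A * B) * norm (w - base_point) \<le> real CARD('n) * (A * B) * (2 * M)"
        using A B0 by (intro mult_left_mono) auto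
      then show ?thesis using lip[OF w] by linarith
    qed
    then have "MO p \<alpha> r F base_point \<le> 2 * (real CARD('n) * (A * B) * (2 * M))"
      using A B0 M by (intro MO_base_point_le_sup[OF \<alpha> holo_continuous_on[OF F] p _ _ measure_bergman_ball_pos[OF \<alpha> r]]) auto
    then show "MO p \<alpha> r F base_point \<le> C * B" by (simp add: C_def algebra_simps)
  qed
qed

section \<open>Bloch functions and mean oscillation\<close>

lemma inv_grad_le_MO:
  assumes \<alpha>: "-1 < \<alpha>" and r: "0 < r" and p: "1 \<le> p"
  obtains C where "0 \<le> C"
    "\<And>(f :: complex^'n::{finite,linorder} \<Rightarrow> complex) z. f \<in> holo \<Longrightarrow> z \<in> TB \<Longrightarrow> inv_grad f z \<le> C * MO p \<alpha> r f z"
proof -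
  obtain C where C: "0 \<le> C"
    "\<And>F :: complex^'n::{finite,linorder} \<Rightarrow> complex. F \<in> holo \<Longrightarrow> inv_grad F base_point \<le> C * MO p \<alpha> r F base_point"
    using inv_grad_base_point_le_MO[OF \<alpha> r p] by metis
  show ?thesis
  proof (rule that[OF C(1)])
    fix f :: "complex^'n::{finite,linorder} \<Rightarrow> complex" and z :: "complex^'n::{finite,linorder}"
    assume f: "f \<in> holo" and z: "z \<in> TB"
    have "inv_grad f z = inv_grad (\<lambda>w. f (TB_aut z w)) base_point"
      using inv_grad_TB_aut[OF f z base_point_in_TB] by (simp add: z)
    also have "\<dots> \<le> C * MO p \<alpha> r (\<lambda>w. f (TB_aut z w)) base_point"
      by (rule C(2)[OF holo_comp_TB_aut[OF f z]])
    finally show "inv_grad f z \<le> C * MO p \<alpha> r f z"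
      by (simp add: MO_TB_aut[OF z \<alpha> holo_continuous_on[OF f] p])
  qed
qed

lemma MO_le_inv_grad:
  assumes \<alpha>: "-1 < \<alpha>" and r: "0 < r" and p: "1 \<le> p"
  obtains C and K :: "(complex^'n::{finite,linorder}) set" where "0 \<le> C" "compact K" "K \<subseteq> TB"
    "\<And>f z B. f \<in> holo \<Longrightarrow> z \<in> TB \<Longrightarrow> (\<And>u. u \<in> K \<Longrightarrow> inv_grad f (TB_aut z u) \<le> B) \<Longrightarrow> MO p \<alpha> r f z \<le> C * B"
proof -
  obtain C and K :: "(complex^'n::{finite,linorder}) set" where C: "0 \<le> C" and K: "compact K" "K \<subseteq> TB" and
    le: "\<And>F B. F \<in> holo \<Longrightarrow> (\<And>u. u \<in> K \<Longrightarrow> inv_grad F u \<le> B) \<Longrightarrow> MO p \<alpha> r F base_point \<le> C * B"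
    using MO_base_point_le_inv_grad[OF \<alpha> r p] by metis
  show ?thesis
  proof (rule that[OF C K])
    fix f :: "complex^'n::{finite,linorder} \<Rightarrow> complex" and z :: "complex^'n::{finite,linorder}" and B
    assume f: "f \<in> holo" and z: "z \<in> TB" and B: "\<And>u. u \<in> K \<Longrightarrow> inv_grad f (TB_aut z u) \<le> B"
    have "MO p \<alpha> r (\<lambda>w. f (TB_aut z w)) base_point \<le> C * B"
      using B K(2) inv_grad_TB_aut[OF f z] by (intro le[OF holo_comp_TB_aut[OF f z]]) (auto simp: subset_iff)
    then show "MO p \<alpha> r f z \<le> C * B"
      by (simp add: MO_TB_aut[OF z \<alpha> holo_continuous_on[OF f] p])
  qed
qed

lemma eventually_TB_to_boundary: "eventually (\<lambda>z. z \<in> TB) to_boundary"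
  unfolding eventually_to_boundary by (intro exI[of _ 1]) auto

text \<open>Near the boundary \<open>g\<close> is below 1, and the rest of the domain is compact.
  This supplies the bounded oscillation that membership in \<open>VMO\<close> does not state, so
  that its holomorphic elements are seen to be Bloch functions.\<close>

lemma bounded_of_vanishing_at_boundary:
  fixes g :: "complex^'n::{finite,linorder} \<Rightarrow> real"
  assumes g: "continuous_on TB g" and lim: "(g \<longlongrightarrow> 0) to_boundary"
  shows "bdd_above (g ` TB)"
proof -
  have "eventually (\<lambda>z. g z < 1) to_boundary" using lim by (rule order_tendstoD) simp
  then obtain e M where eM: "e > 0" "\<And>z. z \<in> TB \<Longrightarrow> rho z < e \<or> M < norm z \<Longrightarrow> g z < 1"
    by (auto simp: eventually_to_boundary)
  define C :: "(complex^'n::{finite,linorder}) set" where "C = {w. e \<le> rho w} \<inter> cball 0 M"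
  have C: "compact C" "C \<subseteq> TB"
    using eM(1) compact_core[OF eM(1)] by (auto simp: C_def TB_iff_rho_pos)
  then have "compact (g ` C)" using g by (intro compact_continuous_image) (auto intro: continuous_on_subset)
  then obtain B where B: "\<And>z. z \<in> C \<Longrightarrow> g z \<le> B"
    by (meson bounded_imp_bdd_above bdd_above_def compact_imp_bounded image_eqI)
  have "g z \<le> max 1 B" if "z \<in> TB" for z
    using eM(2)[OF that] B[of z] by (cases "z \<in> C") (auto simp: C_def not_le)
  then show ?thesis by (intro bdd_aboveI2)
qed

theorem theoremB:
  fixes p \<alpha> r :: real
  assumes "1 \<le> p" and "-1 < \<alpha>" and "0 < r"
  shows "(Bloch :: (complex^'n::{finite,linorder} \<Rightarrow> complex) set) = holo \<inter> BMO p \<alpha> r \<and>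
    (little_Bloch :: (complex^'n::{finite,linorder} \<Rightarrow> complex) set) = holo \<inter> VMO p \<alpha> r \<and>
    (\<exists>C\<ge>1. \<forall>f\<in>(Bloch :: (complex^'n::{finite,linorder} \<Rightarrow> complex) set).
       norm_Bloch f / C \<le> norm_BMO p \<alpha> r f \<and> norm_BMO p \<alpha> r f \<le> C * norm_Bloch f)"
proof -
  note p = assms(1) and \<alpha> = assms(2) and r = assms(3)
  obtain A where A: "0 \<le> A"
    "\<And>(f :: complex^'n::{finite,linorder} \<Rightarrow> complex) z. f \<in> holo \<Longrightarrow> z \<in> TB \<Longrightarrow> inv_grad f z \<le> A * MO p \<alpha> r f z"
    using inv_grad_le_MO[OF \<alpha> r p] by metis
  obtain B and K :: "(complex^'n::{finite,linorder}) set" where B: "0 \<le> B" and K: "compact K" "K \<subseteq> TB" and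
    MO_le: "\<And>f z b. f \<in> holo \<Longrightarrow> z \<in> TB \<Longrightarrow> (\<And>u. u \<in> K \<Longrightarrow> inv_grad f (TB_aut z u) \<le> b) \<Longrightarrow> MO p \<alpha> r f z \<le> B * b"
    using MO_le_inv_grad[OF \<alpha> r p] by metis
  have TB_ne: "(TB :: (complex^'n::{finite,linorder}) set) \<noteq> {}" using base_point_in_TB by blast
  have le_Bloch: "inv_grad f z \<le> norm_Bloch f" if "f \<in> Bloch" "z \<in> TB" for f :: "complex^'n::{finite,linorder} \<Rightarrow> complex" and z
    using that unfolding norm_Bloch_def by (intro cSUP_upper) (auto simp: Bloch_def)
  have MO_le_Bloch: "MO p \<alpha> r f z \<le> B * norm_Bloch f" if f: "f \<in> Bloch" and z: "z \<in> TB"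
    for f :: "complex^'n::{finite,linorder} \<Rightarrow> complex" and z
    using f z K(2) by (intro MO_le le_Bloch TB_aut_in_TB) (auto simp: Bloch_def)
  have BMO_sub: "f \<in> Bloch" if f: "f \<in> holo" and b: "bdd_above (MO p \<alpha> r f ` TB)" for f :: "complex^'n::{finite,linorder} \<Rightarrow> complex"
  proof -
    obtain b where b: "\<And>z. z \<in> TB \<Longrightarrow> MO p \<alpha> r f z \<le> b" using b by (auto simp: bdd_above_def)
    have "inv_grad f z \<le> A * b" if "z \<in> TB" for z
      using A(2)[OF f that] mult_left_mono[OF b[OF that] A(1)] by linarith
    then have "bdd_above (inv_grad f ` TB)" by (rule bdd_aboveI2)
    then show ?thesis using f by (simp add: Bloch_def)
  qed
  have Bloch_bdd: "bdd_above (MO p \<alpha> r f ` TB)" if "f \<in> Bloch" for f :: "complex^'n::{finite,linorder} \<Rightarrow> complex"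
    using MO_le_Bloch[OF that] by (rule bdd_aboveI2)
  have 1: "(Bloch :: (complex^'n::{finite,linorder} \<Rightarrow> complex) set) = holo \<inter> BMO p \<alpha> r"
    using BMO_sub Bloch_bdd holo_in_Lp_loc[OF _ p] unfolding BMO_def by (auto simp: Bloch_def)
  have 2: "(little_Bloch :: (complex^'n::{finite,linorder} \<Rightarrow> complex) set) = holo \<inter> VMO p \<alpha> r"
  proof (intro equalityI subsetI)
    fix f :: "complex^'n::{finite,linorder} \<Rightarrow> complex" assume "f \<in> little_Bloch"
    then have f: "f \<in> holo" and lim: "(inv_grad f \<longlongrightarrow> 0) to_boundary"
      by (auto simp: little_Bloch_def Bloch_def)
    have "(MO p \<alpha> r f \<longlongrightarrow> 0) to_boundary"
    proof (rule tendstoI)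
      fix e :: real assume e: "e > 0"
      \<comment> \<open>The denominator \<open>B + 1\<close> covers \<open>B = 0\<close> and gives
        the strict inequality \<open>B * e' < e\<close>.\<close>
      define e' where "e' = e / (B + 1)"
      have e': "e' > 0" using e B by (simp add: e'_def)
      have "B * e' < e" using e B by (simp add: e'_def field_simps)
      have "eventually (\<lambda>z. inv_grad f z < e') to_boundary" using lim e' by (rule order_tendstoD)
      then have "eventually (\<lambda>z. \<forall>u\<in>K. inv_grad f (TB_aut z u) < e') to_boundary"
        by (rule eventually_to_boundary_TB_aut[OF K])
      then show "eventually (\<lambda>z. dist (MO p \<alpha> r f z) 0 < e) to_boundary"
        using eventually_TB_to_boundary
      proof eventually_elim
        case (elim z)
        then have "MO p \<alpha> r f z \<le> B * e'" by (intro MO_le f) (auto intro: less_imp_le)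
        then show ?case using \<open>B * e' < e\<close> MO_nonneg[of p \<alpha> r f z] by simp
      qed
    qed
    then have "((\<lambda>z. complex_of_real (MO p \<alpha> r f z)) \<longlongrightarrow> 0) to_boundary"
      using tendsto_of_real by fastforce
    then show "f \<in> holo \<inter> VMO p \<alpha> r"
      using f holo_in_Lp_loc[OF f p] continuous_on_MO[OF \<alpha> holo_continuous_on[OF f] p]
      by (auto simp: VMO_def C0_def intro!: continuous_intros)
  next
    fix f :: "complex^'n::{finite,linorder} \<Rightarrow> complex" assume "f \<in> holo \<inter> VMO p \<alpha> r"
    then have f: "f \<in> holo" and "((\<lambda>z. complex_of_real (MO p \<alpha> r f z)) \<longlongrightarrow> 0) to_boundary"
      by (auto simp: VMO_def C0_def)
    then have lim: "(MO p \<alpha> r f \<longlongrightarrow> 0) to_boundary"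
      using tendsto_Re by fastforce
    have "f \<in> Bloch"
      using f continuous_on_MO[OF \<alpha> holo_continuous_on[OF f] p] lim
      by (intro BMO_sub bounded_of_vanishing_at_boundary)
    \<comment> \<open>Gradient and oscillation are compared at the same point in this direction, so
      no uniformity over a compact set is called for.\<close>
    moreover have "(inv_grad f \<longlongrightarrow> 0) to_boundary"
    proof (rule tendsto_sandwich[of "\<lambda>_. 0" _ _ "\<lambda>z. A * MO p \<alpha> r f z"])
      show "eventually (\<lambda>z. 0 \<le> inv_grad f z) to_boundary" "eventually (\<lambda>z. inv_grad f z \<le> A * MO p \<alpha> r f z) to_boundary"
        using eventually_TB_to_boundary by (rule eventually_mono, auto intro: inv_grad_nonneg A f)+
      show "((\<lambda>z. A * MO p \<alpha> r f z) \<longlongrightarrow> 0) to_boundary"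
        using tendsto_mult_left[OF lim, of A] by simp
    qed simp
    ultimately show "f \<in> little_Bloch" by (simp add: little_Bloch_def)
  qed
  \<comment> \<open>\<open>A\<close> and \<open>B\<close> are only known to be nonnegative; the 1
    provides \<open>1 \<le> C\<close> and a positive divisor.\<close>
  define C where "C = max 1 (max A B)"
  have 3: "norm_Bloch f / C \<le> norm_BMO p \<alpha> r f \<and> norm_BMO p \<alpha> r f \<le> C * norm_Bloch f"
    if f: "f \<in> Bloch" for f :: "complex^'n::{finite,linorder} \<Rightarrow> complex"
  proof -
    have holo: "f \<in> holo" using f by (simp add: Bloch_def)
    have N0: "0 \<le> norm_Bloch f"
      using le_Bloch[OF f base_point_in_TB] inv_grad_nonneg[OF base_point_in_TB, of f] by linarith
    have MO_le_BMO: "MO p \<alpha> r f z \<le> norm_BMO p \<alpha> r f" if "z \<in> TB" for z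
      unfolding norm_BMO_def by (intro cSUP_upper Bloch_bdd f that)
    have M0: "0 \<le> norm_BMO p \<alpha> r f"
      using MO_le_BMO[OF base_point_in_TB] MO_nonneg[of p \<alpha> r f base_point] by linarith
    have "norm_BMO p \<alpha> r f \<le> B * norm_Bloch f"
      unfolding norm_BMO_def using TB_ne MO_le_Bloch[OF f] by (rule cSUP_least)
    also have "\<dots> \<le> C * norm_Bloch f" using N0 by (intro mult_right_mono) (auto simp: C_def)
    finally have 4: "norm_BMO p \<alpha> r f \<le> C * norm_Bloch f" .
    have "inv_grad f z \<le> A * norm_BMO p \<alpha> r f" if "z \<in> TB" for z
      using A(2)[OF holo that] mult_left_mono[OF MO_le_BMO[OF that] A(1)] by linarith
    then have "norm_Bloch f \<le> A * norm_BMO p \<alpha> r f"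
      unfolding norm_Bloch_def using TB_ne by (intro cSUP_least)
    also have "\<dots> \<le> C * norm_BMO p \<alpha> r f" using M0 by (intro mult_right_mono) (auto simp: C_def)
    finally have "norm_Bloch f / C \<le> norm_BMO p \<alpha> r f"
      by (simp add: C_def pos_divide_le_eq mult.commute)
    with 4 show ?thesis by simp
  qed
  have "1 \<le> C" by (simp add: C_def)
  with 1 2 3 show ?thesis by blast
qed

end
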